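(* Let $r=r_n$ be integers with $2\le r\le n$ and $r/n\to c\in[0,1)$. For each $n$ let $\mathbf Z=(Z_\ell)_{1\le\ell\le M}$ be a vector of i.i.d. standard Gaussians. Then the expected empirical spectral distribution of $n^{-1/2}H_n(\mathbf Z)$ converges weakly to $\nu_{\mathrm{sc},(1-c)^2}$. In fact, $$d_{\mathrm{BL}}\big(\bar\mu_{n^{-1/2}H_n(\mathbf Z)},\nu_{\mathrm{sc},(1-c)^2}\big)=O\Big(\max\Big\{\Big|\frac rn-c\Big|,\frac1{\sqrt n}\Big\}\Big)\quad\text{as } n\to\infty.$$
   Context: For integers $2\le r\le n$ put $M=\binom nr$, $N=\binom{n-2}{r-2}$, and let $e_1,\dots,e_M$ be an enumeration of the $r$-element subsets of $\{1,\dots,n\}$. Let $\mathbf a_\ell\in\{0,1\}^n$ be the indicator vector of $e_\ell$ and $Q_\ell=\mathbf a_\ell\mathbf a_\ell^\top-\mathrm{diag}(\mathbf a_\ell)$. For $\mathbf x\in\mathbb R^M$ let $H_n(\mathbf x)=N^{-1/2}\sum_{\ell=1}^M x_\ell Q_\ell$. For an $n\times n$ symmetric matrix $A$ with eigenvalues $\lambda_1,\dots,\lambda_n$, $\mu_A=\frac1n\sum_i\delta_{\lambda_i}$; for random $A$ the expected empirical spectral distribution $\bar\mu_A$ is defined by $\int f\,d\bar\mu_A=\mathbb E\int f\,d\mu_A$ for bounded measurable $f$. $\nu_{\mathrm{sc},\sigma^2}$ is the semi-circle law with density $\frac{1}{2\pi\sigma^2}\sqrt{4\sigma^2-x^2}$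 on $[-2\sigma,2\sigma]$. $d_{\mathrm{BL}}(\mu,\nu)=\sup\{|\int f\,d\mu-\int f\,d\nu|:\ \|f\|_{\mathrm{Lip}}+\|f\|_\infty\le1\}$ for probability measures on $\mathbb R$, where $\|f\|_{\mathrm{Lip}}=\sup_{x\ne y}|f(x)-f(y)|/|x-y|$. *)

theory Defs
  imports
    "HOL-Probability.Probability"
    "HOL-Library.Landau_Symbols"
    "Jordan_Normal_Form.Char_Poly"
begin

text \<open>
  Matrices are dimension-carrying \<open>real mat\<close>, since the size \<open>n\<close> tends to infinity. Their entries
  are indexed from 0, so row \<open>i\<close> belongs to the vertex \<open>Suc i\<close> of \<open>{1..n}\<close>.
\<close>

definition edge_vec :: "nat \<Rightarrow> nat set \<Rightarrow> real vec" where
  "edge_vec n e = vec n (\<lambda>i. if Suc i \<in> e then 1 else 0)"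

definition edge_mat :: "nat \<Rightarrow> nat set \<Rightarrow> real mat" where
  "edge_mat n e =
     mat n n (\<lambda>(i, j). vec_index (edge_vec n e) i * vec_index (edge_vec n e) j)
       - mat_diag n (\<lambda>i. vec_index (edge_vec n e) i)"

text \<open>The sum of the matrices is taken entrywise, because \<open>real mat\<close> has no global zero matrix.\<close>

definition H_mat :: "nat \<Rightarrow> nat \<Rightarrow> (nat \<Rightarrow> nat set) \<Rightarrow> (nat \<Rightarrow> real) \<Rightarrow> real mat" where
  "H_mat n r e x =
     (1 / sqrt (real ((n - 2) choose (r - 2)))) \<cdot>\<^sub>m
       mat n n (\<lambda>(i, j). \<Sum>l = 1..n choose r. x l * (edge_mat n (e l) $$ (i, j)))"

text \<open>
  For a real symmetric matrix of size \<open>n\<close> the characteristic polynomial splits over the reals, so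
  the multiset of its real roots is the multiset of all \<open>n\<close> eigenvalues, and this is
  \<open>(1/n) * (\<delta>\<^sub>1 + \<dots> + \<delta>\<^sub>n)\<close> with \<open>\<delta>\<^sub>k\<close> the Dirac measure at the \<open>k\<close>-th eigenvalue.
\<close>

definition esd :: "real mat \<Rightarrow> real measure" where
  "esd A = measure_of UNIV (sets borel)
     (\<lambda>B. ennreal (1 / real (dim_row A)) *
        (\<Sum>t\<in>#proots (char_poly A). emeasure (return borel t) B))"

text \<open>
  The defining property determines the measure uniquely (take indicator functions for \<open>f\<close>);
  it includes the integrability of the random variable whose expectation is formed.
\<close>

definition expected_esd :: "'a measure \<Rightarrow> ('a \<Rightarrow> real mat) \<Rightarrow> real measure" where
  "expected_esd P A = (THE \<mu>. sets \<mu> = sets borel \<and> prob_space \<mu> \<and>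
     (\<forall>f \<in> borel_measurable borel. bounded (range f) \<longrightarrow>
        has_bochner_integral P (\<lambda>\<omega>. \<integral>t. f t \<partial>esd (A \<omega>)) (\<integral>t. f t \<partial>\<mu> :: real)))"

text \<open>The parameter \<open>v\<close> is the variance, so that the support is \<open>[-2 * sqrt v, 2 * sqrt v]\<close>.\<close>

definition semicircle :: "real \<Rightarrow> real measure" where
  "semicircle v = density lborel
     (\<lambda>x. ennreal (1 / (2 * pi * v) * sqrt (4 * v - x\<^sup>2) *
        indicator {- 2 * sqrt v .. 2 * sqrt v} x))"

text \<open>
  Both norms are extended-real valued, so that functions that are unbounded or not Lipschitz
  are excluded from the supremum in \<open>d_BL\<close>.
\<close>

definition lip_norm :: "(real \<Rightarrow> real) \<Rightarrow> ereal" where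
  "lip_norm f = (SUP (x, y) \<in> {(x, y). x \<noteq> y}. ereal (\<bar>f x - f y\<bar> / \<bar>x - y\<bar>))"

definition sup_norm :: "(real \<Rightarrow> real) \<Rightarrow> ereal" where
  "sup_norm f = (SUP x. ereal \<bar>f x\<bar>)"

text \<open>
  For probability measures the supremum is over a nonempty set of reals bounded by 2.
\<close>

definition d_BL :: "real measure \<Rightarrow> real measure \<Rightarrow> real" where
  "d_BL \<mu> \<nu> =
     (SUP f \<in> {f. lip_norm f + sup_norm f \<le> 1}. \<bar>(\<integral>t. f t \<partial>\<mu>) - (\<integral>t. f t \<partial>\<nu>)\<bar>)"

end

theory Submission
  imports Defs "Jordan_Normal_Form.Schur_Decomposition" "HOL-Real_Asymp.Real_Asymp"
begin

text \<open>
The test functions \<open>f\<close> are 1-Lipschitz with \<open>\<bar>f\<bar> \<le> 1\<close>, and \<open>spec_sum n f M\<close> is the sum of \<open>f\<close> over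
the eigenvalues of \<open>M\<close>. Everything is expressed through expectations of spectral sums, and every error
is measured in trace norm: changing \<open>M\<close> by a matrix of trace norm \<open>\<tau>\<close> changes a spectral sum by
\<open>O(\<tau>)\<close> (\<open>spec_sum_perturb\<close>). After dividing by \<open>n\<close>, a perturbation whose trace norm is \<open>O(sqrt n)\<close>
is admissible; this includes matrices of rank one or two with entries of order \<open>n powr (-1/2)\<close>, although
their operator norms tend to infinity. This is where the rate \<open>1 / sqrt n\<close> comes from.

The entries of the hypergraph matrix form a Gaussian family whose covariance depends only on the
overlap of two index pairs. Such a family has the law of
\<open>\<gamma> * W\<^sub>i\<^sub>j + \<beta> * (V\<^sub>i + V\<^sub>j) + \<alpha> * U\<close> off the diagonal, with white noise \<open>U\<close>, \<open>V\<close>, \<open>W\<close>. Here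
\<open>\<gamma>\<^sup>2 = (n-4 choose r-2) / (n-2 choose r-2)\<close> tends to \<open>(1 - c)\<^sup>2\<close>, and the terms with \<open>U\<close> and \<open>V\<close> and the
missing diagonal are perturbations of the admissible kind. So \<open>\<gamma>\<close> times the Gaussian orthogonal
ensemble remains (\<open>hypergraph_mean\<close>).

The ensemble is tridiagonalised one row at a time. A Householder reflection that depends only on the
current row turns this row into its norm times a basis vector, and the block below is invariant in law
under any fixed rotation. Instead of keeping the random norm \<open>\<chi>\<^sub>m\<close>, one replaces it at once by
the integer part \<open>t\<close> of \<open>sqrt m\<close>, at an expected cost \<open>O(1)\<close> before scaling (\<open>hybrid_step\<close>). As
\<open>t\<close> is constant between consecutive squares, cutting one link per square leaves blocks that are
tridiagonal Toeplitz matrices with explicit eigenvalues \<open>2 * t * cos (pi * j / (k+1))\<close>, whose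
distribution is close to the arcsine law on \<open>[- 2 * t, 2 * t]\<close> (\<open>goe_block\<close>, \<open>tridiag_arcsine\<close>).
With \<open>s = 1 - c\<close>, summing over the blocks gives a Riemann sum of arcsine laws of radius \<open>2 * s * \<rho>\<close> with
\<open>\<rho>\<close> distributed with density \<open>2 * \<rho>\<close> on \<open>[0, 1]\<close> (\<open>radial_riemann\<close>): the first coordinate of a
uniform point in the disc of radius \<open>2 * s\<close>, which has the semicircle law (\<open>integral_semicircle\<close>).

All estimates are uniform over the test functions, so they bound the bounded Lipschitz distance, and
weak convergence follows by testing against piecewise linear step functions.
\<close>

section \<open>Spectral sums of symmetric matrices\<close>

text \<open>
Matrices are represented by functions of two indices, of which only the arguments below \<open>n\<close> matter.
Calculations then take place in finite sums, and matrices with carriers appear only where the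
characteristic polynomial does.
\<close>

definition fmat :: "nat \<Rightarrow> (nat \<Rightarrow> nat \<Rightarrow> real) \<Rightarrow> real mat" where
  "fmat n M = mat n n (\<lambda>(i, j). M i j)"

definition spec_sum :: "nat \<Rightarrow> (real \<Rightarrow> real) \<Rightarrow> (nat \<Rightarrow> nat \<Rightarrow> real) \<Rightarrow> real" where
  "spec_sum n f M = (\<Sum>t\<in>#proots (char_poly (fmat n M)). f t)"

definition sym_on :: "nat \<Rightarrow> (nat \<Rightarrow> nat \<Rightarrow> real) \<Rightarrow> bool" where
  "sym_on n M \<longleftrightarrow> (\<forall>i<n. \<forall>j<n. M i j = M j i)"

definition orth_on :: "nat \<Rightarrow> (nat \<Rightarrow> nat \<Rightarrow> real) \<Rightarrow> bool" where
  "orth_on n R \<longleftrightarrow> (\<forall>i<n. \<forall>j<n. (\<Sum>k<n. R i k * R j k) = of_bool (i = j))"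

lemma fmat_carrier [simp]: "fmat n M \<in> carrier_mat n n"
  by (simp add: fmat_def)

lemma fmat_dim [simp]: "dim_row (fmat n M) = n" "dim_col (fmat n M) = n"
  by (simp_all add: fmat_def)

lemma fmat_cong: "(\<And>i j. i < n \<Longrightarrow> j < n \<Longrightarrow> M i j = M' i j) \<Longrightarrow> fmat n M = fmat n M'"
  by (auto simp: fmat_def intro!: eq_matI)

lemma spec_sum_cong:
  "(\<And>i j. i < n \<Longrightarrow> j < n \<Longrightarrow> M i j = M' i j) \<Longrightarrow> spec_sum n f M = spec_sum n f M'"
  unfolding spec_sum_def using fmat_cong[of n M M'] by metis

lemma fmat_mult: "fmat n A * fmat n B = fmat n (\<lambda>i j. \<Sum>k<n. A i k * B k j)"
  by (auto simp: fmat_def scalar_prod_def atLeast0LessThan intro!: eq_matI sum.cong)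

lemma fmat_one: "fmat n (\<lambda>i j. of_bool (i = j)) = 1\<^sub>m n"
  by (auto simp: fmat_def intro!: eq_matI)

lemma sum_swap3:
  fixes g :: "'a \<Rightarrow> 'b \<Rightarrow> 'c \<Rightarrow> 'd :: comm_monoid_add"
  shows "(\<Sum>k\<in>A. \<Sum>l\<in>B. \<Sum>m\<in>C. g k l m) = (\<Sum>l\<in>B. \<Sum>m\<in>C. \<Sum>k\<in>A. g k l m)"
proof -
  have "(\<Sum>k\<in>A. \<Sum>l\<in>B. \<Sum>m\<in>C. g k l m) = (\<Sum>l\<in>B. \<Sum>k\<in>A. \<Sum>m\<in>C. g k l m)"
    by (rule sum.swap)
  also have "\<dots> = (\<Sum>l\<in>B. \<Sum>m\<in>C. \<Sum>k\<in>A. g k l m)"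
    by (intro sum.cong refl sum.swap)
  finally show ?thesis .
qed

lemma orth_on_mult_transpose:
  assumes "orth_on n R" shows "fmat n R * fmat n (\<lambda>i j. R j i) = 1\<^sub>m n"
proof -
  have "fmat n R * fmat n (\<lambda>i j. R j i) = fmat n (\<lambda>i j. of_bool (i = j))"
    unfolding fmat_mult using assms by (intro fmat_cong) (simp add: orth_on_def)
  thus ?thesis by (simp only: fmat_one)
qed

lemma orth_on_transpose_mult:
  assumes "orth_on n R" shows "fmat n (\<lambda>i j. R j i) * fmat n R = 1\<^sub>m n"
  using mat_mult_left_right_inverse[OF _ _ orth_on_mult_transpose[OF assms]] by simp

lemma orth_on_transpose:
  assumes "orth_on n R" shows "orth_on n (\<lambda>i j. R j i)"
  unfolding orth_on_def
proof (intro allI impI)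
  fix i j assume ij: "i < n" "j < n"
  have "(fmat n (\<lambda>i j. R j i) * fmat n R) $$ (i, j) = (\<Sum>k<n. R k i * R k j)"
    unfolding fmat_mult using ij by (simp add: fmat_def)
  thus "(\<Sum>k<n. R k i * R k j) = of_bool (i = j)"
    using ij by (subst (asm) orth_on_transpose_mult[OF assms], cases "i = j") auto
qed

lemma orth_on_similar:
  assumes "orth_on n R"
  shows "similar_mat (fmat n (\<lambda>i j. \<Sum>k<n. \<Sum>l<n. R i k * M k l * R j l)) (fmat n M)"
proof -
  have "fmat n (\<lambda>i j. \<Sum>k<n. \<Sum>l<n. R i k * M k l * R j l)
      = fmat n R * fmat n M * fmat n (\<lambda>i j. R j i)"
    unfolding fmat_mult
    by (intro fmat_cong) (subst sum.swap, simp add: sum_distrib_right)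
  thus ?thesis
    unfolding similar_mat_def similar_mat_wit_def Let_def
    using orth_on_mult_transpose[OF assms] orth_on_transpose_mult[OF assms]
    by (intro exI[of _ "fmat n R"] exI[of _ "fmat n (\<lambda>i j. R j i)"]) auto
qed

lemma spec_sum_conj:
  assumes "orth_on n R"
  shows "spec_sum n f (\<lambda>i j. \<Sum>k<n. \<Sum>l<n. R i k * M k l * R j l) = spec_sum n f M"
  unfolding spec_sum_def char_poly_similar[OF orth_on_similar[OF assms]] ..

text \<open>
The reflection in the hyperplane orthogonal to \<open>v\<close>. For \<open>v = 0\<close> the quotient is \<open>0\<close>, which makes the
reflection the identity, as the applications need it.
\<close>

definition householder :: "nat \<Rightarrow> (nat \<Rightarrow> real) \<Rightarrow> nat \<Rightarrow> nat \<Rightarrow> real" where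
  "householder n v i j = of_bool (i = j) - 2 * v i * v j / (\<Sum>k<n. (v k)\<^sup>2)"

lemma householder_sym: "householder n v i j = householder n v j i"
  unfolding householder_def by (simp add: eq_commute[of i j] mult.commute mult.left_commute)

lemma householder_trivial: "v i = 0 \<or> v j = 0 \<Longrightarrow> householder n v i j = of_bool (i = j)"
  by (auto simp: householder_def)

lemma sum_of_bool_eq:
  fixes g :: "nat \<Rightarrow> real"
  assumes "i < n"
  shows "(\<Sum>k<n. of_bool (i = k) * g k) = g i" "(\<Sum>k<n. of_bool (k = i) * g k) = g i"
    "(\<Sum>k<n. g k * of_bool (i = k)) = g i" "(\<Sum>k<n. g k * of_bool (k = i)) = g i"
proof -
  note \<open>i < n\<close>
  have 1: "(\<Sum>k<n. of_bool (i = k) * g k) = (\<Sum>k<n. if i = k then g k else 0)"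
    by (intro sum.cong) auto
  thus "(\<Sum>k<n. of_bool (i = k) * g k) = g i" using \<open>i < n\<close> by simp
  thus "(\<Sum>k<n. of_bool (k = i) * g k) = g i" "(\<Sum>k<n. g k * of_bool (i = k)) = g i"
    "(\<Sum>k<n. g k * of_bool (k = i)) = g i"
    by (simp_all only: mult.commute eq_commute[of _ i])
qed

lemma householder_apply:
  assumes "i < n"
  shows "(\<Sum>k<n. householder n v i k * x k)
           = x i - 2 * v i * (\<Sum>k<n. v k * x k) / (\<Sum>k<n. (v k)\<^sup>2)"
proof -
  have "(\<Sum>k<n. householder n v i k * x k)
      = (\<Sum>k<n. of_bool (i = k) * x k - 2 * v i / (\<Sum>k<n. (v k)\<^sup>2) * (v k * x k))"
    by (intro sum.cong) (simp_all add: householder_def algebra_simps)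
  also have "\<dots> = (\<Sum>k<n. of_bool (i = k) * x k) - 2 * v i / (\<Sum>k<n. (v k)\<^sup>2) * (\<Sum>k<n. v k * x k)"
    by (simp only: sum_subtractf sum_distrib_left)
  finally show ?thesis using assms by (simp add: sum_of_bool_eq)
qed

lemma orth_householder: "orth_on n (householder n v)"
  unfolding orth_on_def
proof (intro allI impI)
  fix i j assume ij: "i < n" "j < n"
  let ?S = "\<Sum>k<n. (v k)\<^sup>2"
  have *: "(\<Sum>k<n. v k * householder n v j k) = v j - 2 * v j * ?S / ?S"
    using householder_apply[OF ij(2), of v v] by (simp add: mult.commute power2_eq_square)
  have "v j = 0" if "?S = 0"
    using that ij(2) by (subst (asm) sum_nonneg_eq_0_iff) auto
  hence **: "v j - 2 * v j * ?S / ?S = - v j" by auto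
  show "(\<Sum>k<n. householder n v i k * householder n v j k) = of_bool (i = j)"
    unfolding householder_apply[OF ij(1)] * ** using ij
    by (auto simp: householder_def)
qed

text \<open>
Vectors of equal length are exchanged by the reflection along their difference \<open>v\<close>, because then
\<open>2 * (v \<bullet> a) = v \<bullet> v\<close>.
\<close>

lemma householder_maps:
  assumes "(\<Sum>k<n. (a k)\<^sup>2) = (\<Sum>k<n. (b k)\<^sup>2)" "i < n"
  shows "(\<Sum>k<n. householder n (\<lambda>k. a k - b k) i k * a k) = b i"
proof -
  let ?v = "\<lambda>k. a k - b k"
  let ?S = "\<Sum>k<n. (?v k)\<^sup>2"
  have "?S = (\<Sum>k<n. (a k)\<^sup>2) + (\<Sum>k<n. (b k)\<^sup>2) - 2 * (\<Sum>k<n. a k * b k)"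
    by (simp add: power2_diff sum.distrib sum_subtractf sum_distrib_left algebra_simps)
  also have "\<dots> = 2 * ((\<Sum>k<n. (a k)\<^sup>2) - (\<Sum>k<n. a k * b k))"
    using assms(1) by simp
  also have "(\<Sum>k<n. (a k)\<^sup>2) - (\<Sum>k<n. a k * b k) = (\<Sum>k<n. ?v k * a k)"
    unfolding sum_subtractf[symmetric] by (intro sum.cong refl) (simp add: power2_eq_square algebra_simps)
  finally have S: "?S = 2 * (\<Sum>k<n. ?v k * a k)" .
  show ?thesis
  proof (cases "?S = 0")
    case True
    hence "?v i = 0" using assms(2) by (subst (asm) sum_nonneg_eq_0_iff) auto
    thus ?thesis using assms(2) by (subst householder_apply) auto
  next
    case False
    hence "2 * ?v i * (\<Sum>k<n. ?v k * a k) / ?S = ?v i"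
      using S by (simp add: field_simps)
    thus ?thesis using assms(2) by (subst householder_apply) auto
  qed
qed

text \<open>
Over the complex numbers there is an eigenvalue \<open>a\<close> with an eigenvector \<open>w\<close>. The Hermitian form of \<open>M\<close>
at \<open>w\<close> is its own conjugate and equals \<open>a * norm w ^ 2\<close>, so \<open>a\<close> is real; the real part or the imaginary
part of \<open>w\<close> is then a nonzero real eigenvector.
\<close>

lemma sym_real_eigenvector:
  assumes "sym_on n M" "n > 0"
  shows "\<exists>lam u. (\<Sum>i<n. (u i)\<^sup>2) = 1 \<and> (\<forall>i<n. (\<Sum>j<n. M i j * u j) = lam * u i)"
proof -
  let ?A = "map_mat complex_of_real (fmat n M)"
  have A: "?A \<in> carrier_mat n n" by simp
  obtain as where as: "char_poly ?A = (\<Prod>a\<leftarrow>as. [:- a, 1:])" "length as = n"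
    using char_poly_factorized[OF A] by blast
  then obtain a where "a \<in> set as" using \<open>n > 0\<close> by (cases as) auto
  hence "poly (char_poly ?A) a = 0"
    unfolding as by (auto simp: poly_prod_list prod_list_zero_iff)
  hence "eigenvalue ?A a" using eigenvalue_root_char_poly[OF A] by simp
  then obtain v where v: "v \<in> carrier_vec n" "v \<noteq> 0\<^sub>v n" "?A *\<^sub>v v = a \<cdot>\<^sub>v v"
    unfolding eigenvalue_def eigenvector_def by auto
  define w where "w i = v $ i" for i
  have ev: "(\<Sum>j<n. complex_of_real (M i j) * w j) = a * w i" if "i < n" for i
  proof -
    have "(?A *\<^sub>v v) $ i = (a \<cdot>\<^sub>v v) $ i" using v(3) by simp
    thus ?thesis using that v(1)
      by (simp add: scalar_prod_def w_def fmat_def atLeast0LessThan)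
  qed
  obtain i0 where i0: "i0 < n" "w i0 \<noteq> 0"
    using v(1,2) by (auto simp: w_def vec_eq_iff)
  define N where "N = (\<Sum>i<n. (cmod (w i))\<^sup>2)"
  have "N > 0" unfolding N_def using i0 by (intro sum_pos2[of _ i0]) auto
  define X where "X = (\<Sum>i<n. \<Sum>j<n. complex_of_real (M i j) * w j * cnj (w i))"
  have "X = (\<Sum>i<n. a * w i * cnj (w i))"
    unfolding X_def sum_distrib_right[symmetric] by (intro sum.cong) (simp_all add: ev)
  also have "\<dots> = a * complex_of_real N"
    by (simp add: N_def sum_distrib_left complex_norm_square[symmetric] mult.assoc)
  finally have X: "X = a * complex_of_real N" .
  have "cnj X = (\<Sum>i<n. \<Sum>j<n. complex_of_real (M j i) * w i * cnj (w j))"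
    unfolding X_def using assms(1) by (auto simp: sym_on_def mult.commute mult.left_commute intro!: sum.cong)
  also have "\<dots> = X" unfolding X_def by (rule sum.swap)
  finally have "Im X = 0" by (metis complex_cnj_cancel_iff complex_cnj_complex_of_real complex_eq_iff cnj.simps(2) neg_equal_zero)
  hence a: "Im a = 0" using X \<open>N > 0\<close> by simp
  have "Re (w i0) \<noteq> 0 \<or> Im (w i0) \<noteq> 0" using i0(2) by (simp add: complex_eq_iff)
  moreover have "(\<Sum>j<n. M i j * Re (w j)) = Re a * Re (w i)"
    "(\<Sum>j<n. M i j * Im (w j)) = Re a * Im (w i)" if "i < n" for i
    using arg_cong[OF ev[OF that], of Re] arg_cong[OF ev[OF that], of Im] a by simp_all
  ultimately obtain z where z: "z i0 \<noteq> 0" "\<And>i. i < n \<Longrightarrow> (\<Sum>j<n. M i j * z j) = Re a * z i"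
    using that[of "\<lambda>i. Re (w i)"] that[of "\<lambda>i. Im (w i)"] by blast
  define S where "S = (\<Sum>i<n. (z i)\<^sup>2)"
  have S: "S > 0" unfolding S_def using i0 z(1) by (intro sum_pos2[of _ i0]) auto
  define u where "u i = z i / sqrt S" for i
  have "(\<Sum>i<n. (u i)\<^sup>2) = 1"
    using S by (simp add: u_def power_divide flip: sum_divide_distrib S_def)
  moreover have "(\<Sum>j<n. M i j * u j) = Re a * u i" if "i < n" for i
    using z(2)[OF that] by (simp add: u_def flip: sum_divide_distrib)
  ultimately show ?thesis by blast
qed

text \<open>
Induction on \<open>n\<close>: a reflection that takes a unit eigenvector to the last basis vector makes the last row
and column of the matrix vanish off the diagonal, and the induction hypothesis applies to the rest.
\<close>

lemma spectral_decomposition: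
  assumes "sym_on n M"
  shows "\<exists>lam u. orth_on n u \<and> (\<forall>i<n. \<forall>j<n. M i j = (\<Sum>k<n. lam k * u k i * u k j))"
  using assms
proof (induction n arbitrary: M)
  case 0
  thus ?case by (auto simp: orth_on_def)
next
  case (Suc n M)
  obtain lam0 w where w: "(\<Sum>i<Suc n. (w i)\<^sup>2) = 1"
      "\<And>i. i < Suc n \<Longrightarrow> (\<Sum>j<Suc n. M i j * w j) = lam0 * w i"
    using sym_real_eigenvector[OF Suc.prems] by auto
  define b :: "nat \<Rightarrow> real" where "b i = of_bool (i = n)" for i
  have b2: "(\<Sum>k<Suc n. (b k)\<^sup>2) = 1" by (simp add: b_def)
  define R where "R = householder (Suc n) (\<lambda>k. w k - b k)"
  have Rorth: "orth_on (Suc n) R" unfolding R_def by (rule orth_householder)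
  have Rsym: "R i j = R j i" for i j unfolding R_def by (rule householder_sym)
  have RR: "(\<Sum>k<Suc n. R i k * R k j) = of_bool (i = j)" if "i < Suc n" "j < Suc n" for i j
    using Rorth that by (simp add: orth_on_def Rsym[of _ j])
  have Rw: "(\<Sum>k<Suc n. R i k * w k) = b i" if "i < Suc n" for i
    unfolding R_def by (rule householder_maps) (use w b2 that in auto)
  define M' where "M' i j = (\<Sum>k<Suc n. \<Sum>l<Suc n. R i k * M k l * R j l)" for i j
  have M'sym: "sym_on (Suc n) M'"
    unfolding sym_on_def M'_def
  proof (intro allI impI)
    fix i j assume "i < Suc n" "j < Suc n"
    show "(\<Sum>k<Suc n. \<Sum>l<Suc n. R i k * M k l * R j l) = (\<Sum>k<Suc n. \<Sum>l<Suc n. R j k * M k l * R i l)"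
      using Suc.prems by (subst sum.swap) (auto simp: sym_on_def ac_simps intro!: sum.cong)
  qed
  have Rn: "R j n = w j" if "j < Suc n" for j
  proof -
    have "R j n = (\<Sum>k<Suc n. R j k * b k)" by (simp add: b_def)
    also have "\<dots> = (\<Sum>k<Suc n. R j k * (\<Sum>l<Suc n. R k l * w l))"
      by (intro sum.cong) (simp_all add: Rw del: sum.lessThan_Suc)
    also have "\<dots> = (\<Sum>l<Suc n. (\<Sum>k<Suc n. R j k * R k l) * w l)"
      unfolding sum_distrib_left sum_distrib_right by (subst sum.swap) (simp only: mult.assoc)
    also have "\<dots> = (\<Sum>l<Suc n. of_bool (j = l) * w l)"
      by (intro sum.cong) (use that in \<open>simp_all add: RR del: sum.lessThan_Suc\<close>)
    also have "\<dots> = w j" using that by (rule sum_of_bool_eq)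
    finally show ?thesis .
  qed
  have M'n: "M' i n = lam0 * of_bool (i = n)" if "i < Suc n" for i
  proof -
    have "M' i n = (\<Sum>k<Suc n. R i k * (\<Sum>l<Suc n. M k l * w l))"
      unfolding M'_def sum_distrib_left
      by (intro sum.cong refl) (simp add: Rsym[of n] Rn mult.assoc del: sum.lessThan_Suc)
    also have "\<dots> = (\<Sum>k<Suc n. lam0 * (R i k * w k))"
      by (intro sum.cong refl) (simp add: w del: sum.lessThan_Suc)
    also have "\<dots> = lam0 * b i" using that by (simp only: Rw sum_distrib_left[symmetric])
    finally show ?thesis by (simp add: b_def)
  qed
  have "sym_on n M'" using M'sym by (auto simp: sym_on_def)
  from Suc.IH[OF this] obtain lam u where u: "orth_on n u"
    "\<And>i j. i < n \<Longrightarrow> j < n \<Longrightarrow> M' i j = (\<Sum>k<n. lam k * u k i * u k j)" by blast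
  define lam' where "lam' k = (if k = n then lam0 else lam k)" for k
  define u' where "u' k i = (if k = n \<or> i = n then of_bool (k = i) else u k i)" for k i
  have u'orth: "orth_on (Suc n) u'"
    using u(1) unfolding orth_on_def u'_def by (auto simp: less_Suc_eq intro!: sum.neutral)
  have u'M: "M' i j = (\<Sum>k<Suc n. lam' k * u' k i * u' k j)" if "i < Suc n" "j < Suc n" for i j
  proof (cases "i = n \<or> j = n")
    case True
    have "M' n j = lam0 * of_bool (j = n)"
      using M'n[OF that(2)] M'sym that by (simp add: sym_on_def)
    moreover have "(\<Sum>k<n. lam' k * u' k i * u' k j) = 0"
      using True by (intro sum.neutral) (auto simp: u'_def)
    ultimately show ?thesis using True M'n[OF that(1)]
      by (auto simp: lam'_def u'_def)
  next
    case False
    thus ?thesis using that u(2)[of i j] by (auto simp: lam'_def u'_def intro!: sum.cong)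
  qed
  \<comment> \<open>The eigenbasis of the reflected matrix is reflected back.\<close>
  define U where "U k i = (\<Sum>l<Suc n. u' k l * R l i)" for k i
  have Uorth: "orth_on (Suc n) U"
    unfolding orth_on_def
  proof (intro allI impI)
    fix i j assume ij: "i < Suc n" "j < Suc n"
    have "(\<Sum>k<Suc n. U i k * U j k)
        = (\<Sum>k<Suc n. \<Sum>l<Suc n. \<Sum>m<Suc n. (u' i l * u' j m) * (R l k * R m k))"
      unfolding U_def sum_product by (intro sum.cong refl) (simp add: ac_simps)
    also have "\<dots> = (\<Sum>l<Suc n. \<Sum>m<Suc n. \<Sum>k<Suc n. (u' i l * u' j m) * (R l k * R m k))"
      by (rule sum_swap3)
    also have "\<dots> = (\<Sum>l<Suc n. \<Sum>m<Suc n. (u' i l * u' j m) * of_bool (l = m))"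
      unfolding sum_distrib_left[symmetric]
      by (intro sum.cong refl) (use Rorth in \<open>simp add: orth_on_def del: sum.lessThan_Suc\<close>)
    also have "\<dots> = (\<Sum>l<Suc n. u' i l * u' j l)"
      by (intro sum.cong refl) (simp add: sum_of_bool_eq del: sum.lessThan_Suc)
    also have "\<dots> = of_bool (i = j)" using u'orth ij unfolding orth_on_def by blast
    finally show "(\<Sum>k<Suc n. U i k * U j k) = of_bool (i = j)" .
  qed
  have "M i j = (\<Sum>k<Suc n. lam' k * U k i * U k j)" if ij: "i < Suc n" "j < Suc n" for i j
  proof -
    have "(\<Sum>k<Suc n. lam' k * U k i * U k j)
        = (\<Sum>k<Suc n. \<Sum>l<Suc n. \<Sum>m<Suc n. (lam' k * u' k l * u' k m) * (R l i * R m j))"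
    proof (intro sum.cong refl)
      fix k
      have "lam' k * U k i * U k j = lam' k * (U k i * U k j)" by simp
      also have "\<dots> = lam' k * (\<Sum>l<Suc n. \<Sum>m<Suc n. (u' k l * R l i) * (u' k m * R m j))"
        unfolding U_def sum_product ..
      also have "\<dots> = (\<Sum>l<Suc n. \<Sum>m<Suc n. lam' k * ((u' k l * R l i) * (u' k m * R m j)))"
        by (simp only: sum_distrib_left)
      finally show "lam' k * U k i * U k j
          = (\<Sum>l<Suc n. \<Sum>m<Suc n. (lam' k * u' k l * u' k m) * (R l i * R m j))"
        by (simp only: ac_simps)
    qed
    also have "\<dots> = (\<Sum>l<Suc n. \<Sum>m<Suc n. \<Sum>k<Suc n. (lam' k * u' k l * u' k m) * (R l i * R m j))"
      by (rule sum_swap3)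
    also have "\<dots> = (\<Sum>l<Suc n. \<Sum>m<Suc n. M' l m * (R l i * R m j))"
      unfolding sum_distrib_right[symmetric]
      by (intro sum.cong refl) (simp add: u'M del: sum.lessThan_Suc)
    also have "\<dots> = (\<Sum>l<Suc n. \<Sum>m<Suc n. \<Sum>k<Suc n. \<Sum>p<Suc n. (R i l * R l k) * (M k p * (R p m * R m j)))"
      unfolding M'_def sum_distrib_right
    proof (intro sum.cong refl)
      fix l m k p
      have "R i l = R l i" "R p m = R m p" by (rule Rsym)+
      thus "R l k * M k p * R m p * (R l i * R m j) = (R i l * R l k) * (M k p * (R p m * R m j))"
        by (simp only: ac_simps)
    qed
    also have "\<dots> = (\<Sum>k<Suc n. \<Sum>p<Suc n. \<Sum>l<Suc n. \<Sum>m<Suc n. (R i l * R l k) * (M k p * (R p m * R m j)))"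
    proof -
      have sw: "(\<Sum>l<N. \<Sum>m<N. \<Sum>k<N. \<Sum>p<N. g l m k p) = (\<Sum>k<N. \<Sum>p<N. \<Sum>l<N. \<Sum>m<N. g l m k p)"
        for g :: "nat \<Rightarrow> nat \<Rightarrow> nat \<Rightarrow> nat \<Rightarrow> real" and N
      proof -
        have "(\<Sum>l<N. \<Sum>m<N. \<Sum>k<N. \<Sum>p<N. g l m k p) = (\<Sum>l<N. \<Sum>k<N. \<Sum>m<N. \<Sum>p<N. g l m k p)"
          by (intro sum.cong refl sum.swap)
        also have "\<dots> = (\<Sum>k<N. \<Sum>l<N. \<Sum>m<N. \<Sum>p<N. g l m k p)" by (rule sum.swap)
        also have "\<dots> = (\<Sum>k<N. \<Sum>l<N. \<Sum>p<N. \<Sum>m<N. g l m k p)"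
          by (intro sum.cong refl sum.swap)
        also have "\<dots> = (\<Sum>k<N. \<Sum>p<N. \<Sum>l<N. \<Sum>m<N. g l m k p)"
          by (intro sum.cong refl sum.swap)
        finally show ?thesis .
      qed
      show ?thesis by (rule sw)
    qed
    also have "\<dots> = (\<Sum>k<Suc n. \<Sum>p<Suc n. of_bool (i = k) * (M k p * of_bool (p = j)))"
      by (intro sum.cong refl)
         (use ij in \<open>simp add: RR sum_distrib_left[symmetric] sum_distrib_right[symmetric] del: sum.lessThan_Suc\<close>)
    also have "\<dots> = M i j"
      using ij by (simp add: sum_of_bool_eq sum_distrib_left[symmetric] del: sum.lessThan_Suc)
    finally show ?thesis by simp
  qed
  with Uorth show ?case by blast
qed

lemma char_poly_eigenbasis:
  assumes "orth_on n u" "\<And>i j. i < n \<Longrightarrow> j < n \<Longrightarrow> M i j = (\<Sum>k<n. lam k * u k i * u k j)"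
  shows "char_poly (fmat n M) = (\<Prod>a\<leftarrow>map lam [0..<n]. [:- a, 1:])"
proof -
  have "fmat n M = fmat n (\<lambda>i j. \<Sum>k<n. \<Sum>l<n. u k i * (of_bool (k = l) * lam k) * u l j)"
  proof (intro fmat_cong)
    fix i j assume "i < n" "j < n"
    have "(\<Sum>k<n. \<Sum>l<n. u k i * (of_bool (k = l) * lam k) * u l j)
        = (\<Sum>k<n. \<Sum>l<n. of_bool (k = l) * (lam k * u k i * u l j))"
      by (intro sum.cong refl) simp
    thus "M i j = (\<Sum>k<n. \<Sum>l<n. u k i * (of_bool (k = l) * lam k) * u l j)"
      using assms(2)[OF \<open>i < n\<close> \<open>j < n\<close>] by (simp add: sum_of_bool_eq)
  qed
  hence "similar_mat (fmat n M) (fmat n (\<lambda>k l. of_bool (k = l) * lam k))"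
    using orth_on_similar[OF orth_on_transpose[OF assms(1)]] by simp
  hence "char_poly (fmat n M) = char_poly (fmat n (\<lambda>k l. of_bool (k = l) * lam k))"
    by (rule char_poly_similar)
  also have "\<dots> = (\<Prod>a\<leftarrow>diag_mat (fmat n (\<lambda>k l. of_bool (k = l) * lam k)). [:- a, 1:])"
    by (rule char_poly_upper_triangular[of _ n]) (auto simp: fmat_def)
  also have "diag_mat (fmat n (\<lambda>k l. of_bool (k = l) * lam k)) = map lam [0..<n]"
    by (auto simp: diag_mat_def fmat_def)
  finally show ?thesis .
qed

lemma proots_eigenbasis:
  assumes "orth_on n u" "\<And>i j. i < n \<Longrightarrow> j < n \<Longrightarrow> M i j = (\<Sum>k<n. lam k * u k i * u k j)"
  shows "proots (char_poly (fmat n M)) = image_mset lam (mset_set {..<n})"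
proof -
  have "proots (\<Prod>a\<leftarrow>xs. [:- a, 1:]) = mset xs" for xs :: "real list"
  proof (induction xs)
    case (Cons x xs)
    have "(\<Prod>a\<leftarrow>xs. [:- a, 1:]) \<noteq> (0 :: real poly)" by (auto simp: prod_list_zero_iff)
    have "proots ([:- x, 1:] * (\<Prod>a\<leftarrow>xs. [:- a, 1:])) = proots [:- x, 1:] + proots (\<Prod>a\<leftarrow>xs. [:- a, 1:])"
      by (rule proots_mult) (use \<open>(\<Prod>a\<leftarrow>xs. [:- a, 1:]) \<noteq> 0\<close> in auto)
    thus ?case using Cons by simp
  qed simp
  moreover have "char_poly (fmat n M) = (\<Prod>a\<leftarrow>map lam [0..<n]. [:- a, 1:])"
    by (rule char_poly_eigenbasis[OF assms])
  ultimately show ?thesis by (simp only: mset_map mset_upt atLeast0LessThan)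
qed

lemma spec_sum_eigenbasis:
  assumes "orth_on n u" "\<And>i j. i < n \<Longrightarrow> j < n \<Longrightarrow> M i j = (\<Sum>k<n. lam k * u k i * u k j)"
  shows "spec_sum n f M = (\<Sum>k<n. f (lam k))"
  by (simp add: spec_sum_def proots_eigenbasis[of n u M lam] assms image_mset.compositionality comp_def sum_unfold_sum_mset)

text \<open>
Gaussian elimination: an equation with a nonzero coefficient removes one unknown.
\<close>

lemma underdetermined_system:
  fixes c :: "'j \<Rightarrow> 'i \<Rightarrow> real"
  assumes "finite J" "finite I" "card J < card I"
  shows "\<exists>x. (\<exists>i\<in>I. x i \<noteq> 0) \<and> (\<forall>j\<in>J. (\<Sum>i\<in>I. c j i * x i) = 0)"
  using assms
proof (induction J arbitrary: I c rule: finite_induct)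
  case empty
  hence "I \<noteq> {}" by auto
  thus ?case by (intro exI[of _ "\<lambda>_. 1"]) auto
next
  case (insert j J I c)
  show ?case
  proof (cases "\<forall>i\<in>I. c j i = 0")
    case True
    have "card J < card I" using insert by simp
    from insert.IH[OF \<open>finite I\<close> this, of c] True show ?thesis by auto
  next
    case False
    then obtain p where p: "p \<in> I" "c j p \<noteq> 0" by auto
    define I' where "I' = I - {p}"
    define c' where "c' k i = c k i - c k p * c j i / c j p" for k i
    have fin: "finite I'" and card: "card J < card I'"
      using insert p by (auto simp: I'_def)
    from insert.IH[OF this, of c'] obtain x where x: "\<exists>i\<in>I'. x i \<noteq> 0"
      "\<And>k. k \<in> J \<Longrightarrow> (\<Sum>i\<in>I'. c' k i * x i) = 0" by blast
    define y where "y = x(p := - (\<Sum>i\<in>I'. c j i * x i) / c j p)"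
    have split: "(\<Sum>i\<in>I. c k i * y i)
        = (\<Sum>i\<in>I'. c k i * x i) - c k p * (\<Sum>i\<in>I'. c j i * x i) / c j p" for k
    proof -
      have "(\<Sum>i\<in>I. c k i * y i) = c k p * y p + (\<Sum>i\<in>I'. c k i * y i)"
        unfolding I'_def using p(1) \<open>finite I\<close> by (rule sum.remove[rotated])
      also have "(\<Sum>i\<in>I'. c k i * y i) = (\<Sum>i\<in>I'. c k i * x i)"
        by (intro sum.cong) (auto simp: y_def I'_def)
      finally show ?thesis by (simp add: y_def)
    qed
    have "(\<Sum>i\<in>I. c k i * y i) = (\<Sum>i\<in>I'. c' k i * x i)" for k
      unfolding split by (simp add: c'_def left_diff_distrib sum_subtractf sum_distrib_left
          sum_divide_distrib mult.assoc)
    moreover have "(\<Sum>i\<in>I. c j i * y i) = 0" unfolding split using p(2) by simp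
    moreover have "\<exists>i\<in>I. y i \<noteq> 0" using x(1) by (auto simp: y_def I'_def)
    ultimately show ?thesis using x(2) by (intro exI[of _ y]) auto
  qed
qed

definition quad :: "nat \<Rightarrow> (nat \<Rightarrow> nat \<Rightarrow> real) \<Rightarrow> (nat \<Rightarrow> real) \<Rightarrow> real" where
  "quad n M x = (\<Sum>i<n. \<Sum>j<n. M i j * x i * x j)"

lemma quad_eigenbasis:
  assumes "\<And>i j. i < n \<Longrightarrow> j < n \<Longrightarrow> M i j = (\<Sum>k<n. lam k * u k i * u k j)"
  shows "quad n M x = (\<Sum>k<n. lam k * (\<Sum>i<n. u k i * x i)\<^sup>2)"
proof -
  have "quad n M x = (\<Sum>i<n. \<Sum>j<n. \<Sum>k<n. lam k * ((u k i * x i) * (u k j * x j)))"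
    unfolding quad_def
    by (intro sum.cong refl) (simp add: assms sum_distrib_left sum_distrib_right ac_simps)
  also have "\<dots> = (\<Sum>k<n. \<Sum>i<n. \<Sum>j<n. lam k * ((u k i * x i) * (u k j * x j)))"
    by (rule sum_swap3[symmetric])
  also have "\<dots> = (\<Sum>k<n. lam k * (\<Sum>i<n. u k i * x i)\<^sup>2)"
  proof -
    have "(\<Sum>i<n. u k i * x i)\<^sup>2 = (\<Sum>i<n. \<Sum>j<n. (u k i * x i) * (u k j * x j))" for k
      by (simp only: power2_eq_square sum_product)
    thus ?thesis by (simp only: sum_distrib_left)
  qed
  finally show ?thesis .
qed

lemma parseval:
  assumes "orth_on n u"
  shows "(\<Sum>k<n. (\<Sum>i<n. u k i * x i)\<^sup>2) = (\<Sum>i<n. (x i)\<^sup>2)"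
proof -
  have "quad n (\<lambda>i j. of_bool (i = j)) x = (\<Sum>k<n. 1 * (\<Sum>i<n. u k i * x i)\<^sup>2)"
    by (rule quad_eigenbasis) (use orth_on_transpose[OF assms] in \<open>simp add: orth_on_def\<close>)
  moreover have "quad n (\<lambda>i j. of_bool (i = j)) x = (\<Sum>i<n. (x i)\<^sup>2)"
    unfolding quad_def mult.assoc
    by (intro sum.cong refl) (simp add: sum_of_bool_eq power2_eq_square)
  ultimately show ?thesis by simp
qed

text \<open>
Weyl's monotonicity in terms of counting functions. If \<open>M\<close> had more eigenvalues above \<open>t\<close> than \<open>M'\<close>, there
would be a nonzero \<open>x\<close> in the span of the corresponding eigenvectors of \<open>M\<close> that is orthogonal to the
eigenvectors of \<open>M'\<close> above \<open>t\<close>; at this \<open>x\<close> the form of \<open>M\<close> exceeds \<open>t * norm x ^ 2\<close>, and the form of \<open>M'\<close>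
does not.
\<close>

lemma eigenvalue_count_mono:
  assumes u: "orth_on n u" "\<And>i j. i < n \<Longrightarrow> j < n \<Longrightarrow> M i j = (\<Sum>k<n. lam k * u k i * u k j)"
    and u': "orth_on n u'" "\<And>i j. i < n \<Longrightarrow> j < n \<Longrightarrow> M' i j = (\<Sum>k<n. lam' k * u' k i * u' k j)"
    and le: "\<And>x. quad n M x \<le> quad n M' x"
  shows "card {k. k < n \<and> t < lam k} \<le> card {k. k < n \<and> t < lam' k}"
proof (rule ccontr)
  define I where "I = {k. k < n \<and> t < lam k}"
  define J where "J = {k. k < n \<and> t < lam' k}"
  assume "\<not> ?thesis"
  hence card: "card J < card I" by (simp add: I_def J_def)
  have fin: "finite I" "finite J" by (auto simp: I_def J_def)
  obtain c where c: "\<exists>i\<in>I. c i \<noteq> 0"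
    "\<And>j. j \<in> J \<Longrightarrow> (\<Sum>i\<in>I. (\<Sum>p<n. u' j p * u i p) * c i) = 0"
    using underdetermined_system[OF fin(2,1) card, of "\<lambda>j i. \<Sum>p<n. u' j p * u i p"] by blast
  define x where "x p = (\<Sum>i\<in>I. c i * u i p)" for p
  have ux: "(\<Sum>p<n. u k p * x p) = (if k \<in> I then c k else 0)" if "k < n" for k
  proof -
    have "(\<Sum>p<n. u k p * x p) = (\<Sum>i\<in>I. c i * (\<Sum>p<n. u k p * u i p))"
      unfolding x_def sum_distrib_left by (subst sum.swap) (simp add: ac_simps)
    also have "\<dots> = (\<Sum>i\<in>I. if i = k then c i else 0)"
      using u(1) that by (intro sum.cong refl) (auto simp: orth_on_def I_def)
    finally show ?thesis using fin by simp
  qed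
  have u'x: "(\<Sum>p<n. u' k p * x p) = 0" if "k \<in> J" for k
  proof -
    have "(\<Sum>p<n. u' k p * x p) = (\<Sum>i\<in>I. (\<Sum>p<n. u' k p * u i p) * c i)"
      unfolding x_def sum_distrib_left sum_distrib_right by (subst sum.swap) (simp add: ac_simps)
    thus ?thesis using c(2)[OF that] by simp
  qed
  let ?N = "\<Sum>i<n. (x i)\<^sup>2"
  obtain i0 where i0: "i0 \<in> I" "c i0 \<noteq> 0" using c(1) by blast
  have "t * ?N = (\<Sum>k<n. t * (\<Sum>p<n. u k p * x p)\<^sup>2)"
    by (simp add: parseval[OF u(1)] flip: sum_distrib_left)
  also have "\<dots> < (\<Sum>k<n. lam k * (\<Sum>p<n. u k p * x p)\<^sup>2)"
    using i0 by (intro sum_strict_mono_ex1 ballI bexI[of _ i0]) (auto simp: ux I_def intro!: mult_right_mono)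
  also have "\<dots> = quad n M x" using quad_eigenbasis[OF u(2)] by simp
  also have "\<dots> \<le> quad n M' x" by (rule le)
  also have "\<dots> = (\<Sum>k<n. lam' k * (\<Sum>p<n. u' k p * x p)\<^sup>2)" using quad_eigenbasis[OF u'(2)] by simp
  also have "\<dots> \<le> (\<Sum>k<n. t * (\<Sum>p<n. u' k p * x p)\<^sup>2)"
  proof (intro sum_mono)
    fix k assume "k \<in> {..<n}"
    show "lam' k * (\<Sum>p<n. u' k p * x p)\<^sup>2 \<le> t * (\<Sum>p<n. u' k p * x p)\<^sup>2"
    proof (cases "k \<in> J")
      case False
      thus ?thesis using \<open>k \<in> {..<n}\<close> by (intro mult_right_mono) (auto simp: J_def)
    qed (simp add: u'x)
  qed
  also have "\<dots> = t * ?N" by (simp add: parseval[OF u'(1)] flip: sum_distrib_left)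
  finally show False by simp
qed

lemma sorted_nth_le:
  fixes xs ys :: "real list"
  assumes "sorted xs" "sorted ys" "length xs = n" "length ys = n"
    and cnt: "\<And>t. length (filter (\<lambda>x. t < x) xs) \<le> length (filter (\<lambda>x. t < x) ys)"
    and k: "k < n"
  shows "xs ! k \<le> ys ! k"
proof (rule ccontr)
  assume "\<not> ?thesis"
  hence lt: "ys ! k < xs ! k" by simp
  have "{k..<n} \<subseteq> {i. i < n \<and> ys ! k < xs ! i}"
    using assms(1,3) by (auto intro!: less_le_trans[OF lt] sorted_nth_mono)
  hence "n - k \<le> card {i. i < n \<and> ys ! k < xs ! i}"
    using card_mono[of "{i. i < n \<and> ys ! k < xs ! i}" "{k..<n}"] by simp
  moreover have "{i. i < n \<and> ys ! k < ys ! i} \<subseteq> {Suc k..<n}"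
  proof
    fix i assume i: "i \<in> {i. i < n \<and> ys ! k < ys ! i}"
    have "\<not> i \<le> k" using i k assms(2,4) sorted_nth_mono[of ys i k] by auto
    thus "i \<in> {Suc k..<n}" using i by auto
  qed
  hence "card {i. i < n \<and> ys ! k < ys ! i} \<le> n - Suc k"
    using card_mono[of "{Suc k..<n}" "{i. i < n \<and> ys ! k < ys ! i}"] by simp
  ultimately show False using cnt[of "ys ! k"] assms(3,4) k by (simp add: length_filter_conv_card)
qed

text \<open>
By monotonicity the sorted eigenvalues of \<open>M\<close> lie below those of \<open>M'\<close> one by one. Hence the sum of their
distances is the difference of the traces.
\<close>

lemma spec_sum_mono_lipschitz:
  assumes "sym_on n M" "sym_on n M'" "\<And>x. quad n M x \<le> quad n M' x"
    and f: "L-lipschitz_on UNIV f"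
  shows "\<bar>spec_sum n f M' - spec_sum n f M\<bar> \<le> L * (\<Sum>i<n. M' i i - M i i)"
proof -
  obtain lam u where u: "orth_on n u"
    "\<And>i j. i < n \<Longrightarrow> j < n \<Longrightarrow> M i j = (\<Sum>k<n. lam k * u k i * u k j)"
    using spectral_decomposition[OF assms(1)] by blast
  obtain lam' u' where u': "orth_on n u'"
    "\<And>i j. i < n \<Longrightarrow> j < n \<Longrightarrow> M' i j = (\<Sum>k<n. lam' k * u' k i * u' k j)"
    using spectral_decomposition[OF assms(2)] by blast
  define xs where "xs = sort (map lam [0..<n])"
  define ys where "ys = sort (map lam' [0..<n])"
  have len: "length xs = n" "length ys = n" by (simp_all add: xs_def ys_def)
  have sum_sort: "(\<Sum>k<n. g (sort (map l [0..<n]) ! k)) = (\<Sum>k<n. g (l k))"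
    for g l :: "_ \<Rightarrow> real"
  proof -
    have "(\<Sum>k<n. g (sort (map l [0..<n]) ! k)) = sum_list (map g (sort (map l [0..<n])))"
      by (simp add: sum_list_sum_nth atLeast0LessThan)
    also have "\<dots> = sum_mset (mset (map g (sort (map l [0..<n]))))"
      by (rule sum_mset_sum_list[symmetric])
    also have "\<dots> = sum_mset (mset (map g (map l [0..<n])))"
      by (simp only: mset_map mset_sort)
    also have "\<dots> = (\<Sum>k<n. g (l k))"
      unfolding sum_mset_sum_list by (simp add: sum_list_sum_nth atLeast0LessThan)
    finally show ?thesis .
  qed
  have count: "length (filter (\<lambda>x. t < x) (sort (map l [0..<n]))) = card {k. k < n \<and> t < l k}"
    for t and l :: "nat \<Rightarrow> real"
  proof -
    have "length (filter (\<lambda>x. t < x) (sort (map l [0..<n]))) = length (filter (\<lambda>x. t < x) (map l [0..<n]))"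
      by (simp only: size_mset[symmetric] mset_filter mset_sort)
    also have "\<dots> = card {k. k < n \<and> t < l k}"
      by (subst length_filter_conv_card) (auto intro!: arg_cong[of _ _ card])
    finally show ?thesis .
  qed
  have le: "xs ! k \<le> ys ! k" if "k < n" for k
  proof (rule sorted_nth_le[OF _ _ len _ that])
    show "length (filter (\<lambda>x. t < x) xs) \<le> length (filter (\<lambda>x. t < x) ys)" for t
      unfolding xs_def ys_def count by (rule eigenvalue_count_mono[OF u u' assms(3)])
  qed (simp_all add: xs_def ys_def)
  have trace: "(\<Sum>i<n. A i i) = (\<Sum>k<n. l k)"
    if "orth_on n v" "\<And>i j. i < n \<Longrightarrow> j < n \<Longrightarrow> A i j = (\<Sum>k<n. l k * v k i * v k j)" for A l v
  proof -
    have "(\<Sum>i<n. A i i) = (\<Sum>i<n. \<Sum>k<n. l k * (v k i * v k i))"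
      by (intro sum.cong refl) (simp add: that(2) mult.assoc)
    also have "\<dots> = (\<Sum>k<n. l k * (\<Sum>i<n. v k i * v k i))"
      by (subst sum.swap) (simp add: sum_distrib_left)
    also have "\<dots> = (\<Sum>k<n. l k)"
      using that(1) by (intro sum.cong refl) (simp add: orth_on_def)
    finally show ?thesis .
  qed
  have "\<bar>spec_sum n f M' - spec_sum n f M\<bar> = \<bar>\<Sum>k<n. f (ys ! k) - f (xs ! k)\<bar>"
    using spec_sum_eigenbasis[OF u, of f] spec_sum_eigenbasis[OF u', of f]
    by (simp add: sum_subtractf xs_def ys_def sum_sort)
  also have "\<dots> \<le> (\<Sum>k<n. L * (ys ! k - xs ! k))"
  proof (intro order_trans[OF sum_abs] sum_mono)
    fix k assume "k \<in> {..<n}"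
    thus "\<bar>f (ys ! k) - f (xs ! k)\<bar> \<le> L * (ys ! k - xs ! k)"
      using lipschitz_onD[OF f, of "ys ! k" "xs ! k"] le[of k] by (simp add: dist_real_def)
  qed
  also have "\<dots> = L * ((\<Sum>k<n. ys ! k) - (\<Sum>k<n. xs ! k))"
    by (simp add: sum_subtractf flip: sum_distrib_left)
  also have "\<dots> = L * (\<Sum>i<n. M' i i - M i i)"
    using trace[OF u] trace[OF u'] sum_sort[of "\<lambda>x. x"] by (simp add: sum_subtractf xs_def ys_def)
  finally show ?thesis .
qed

lemma quad_add: "quad n (\<lambda>i j. A i j + B i j) x = quad n A x + quad n B x"
  by (simp add: quad_def distrib_right sum.distrib)

lemma quad_unit: "i < n \<Longrightarrow> quad n M (\<lambda>j. of_bool (j = i)) = M i i"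
  by (simp only: quad_def sum_of_bool_eq)

text \<open>
A trace norm bound in which only a dominating form \<open>S\<close> has to be exhibited: both \<open>A\<close> and \<open>B\<close> are at most
\<open>A + S\<close>, so two monotone comparisons suffice. Its merit over a bound by the Hilbert-Schmidt norm
is that a perturbation of bounded rank costs no factor \<open>sqrt n\<close>.
\<close>

lemma spec_sum_perturb:
  assumes "sym_on n A" "sym_on n B" "sym_on n S"
    and dom: "\<And>x. \<bar>quad n B x - quad n A x\<bar> \<le> quad n S x"
    and f: "L-lipschitz_on UNIV f"
  shows "\<bar>spec_sum n f B - spec_sum n f A\<bar> \<le> 3 * L * (\<Sum>i<n. S i i)"
proof -
  let ?C = "\<lambda>i j. A i j + S i j"
  have L: "L \<ge> 0" using f by (rule lipschitz_on_nonneg)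
  have C: "sym_on n ?C" using assms(1,3) by (simp add: sym_on_def)
  have S0: "quad n S x \<ge> 0" for x using dom[of x] by linarith
  have 1: "\<bar>spec_sum n f ?C - spec_sum n f A\<bar> \<le> L * (\<Sum>i<n. ?C i i - A i i)"
    by (rule spec_sum_mono_lipschitz[OF assms(1) C _ f]) (simp add: quad_add S0)
  have 2: "\<bar>spec_sum n f ?C - spec_sum n f B\<bar> \<le> L * (\<Sum>i<n. ?C i i - B i i)"
  proof (rule spec_sum_mono_lipschitz[OF assms(2) C _ f])
    show "quad n B x \<le> quad n ?C x" for x using dom[of x] by (simp add: quad_add)
  qed
  have "(\<Sum>i<n. ?C i i - B i i) \<le> (\<Sum>i<n. 2 * S i i)"
  proof (intro sum_mono)
    fix i assume "i \<in> {..<n}"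
    thus "?C i i - B i i \<le> 2 * S i i" using dom[of "\<lambda>j. of_bool (j = i)"] by (simp add: quad_unit)
  qed
  hence "L * (\<Sum>i<n. ?C i i - B i i) \<le> L * (2 * (\<Sum>i<n. S i i))"
    using L by (intro mult_left_mono) (simp_all add: sum_distrib_left)
  with 1 2 show ?thesis by (simp add: abs_if algebra_simps split: if_splits)
qed

lemma char_poly_fmat_splits:
  assumes "sym_on n A"
  shows "\<exists>es. char_poly (fmat n A) = (\<Prod>a\<leftarrow>es. [:- a, 1:])"
proof -
  obtain lam u where u: "orth_on n u"
    "\<And>i j. i < n \<Longrightarrow> j < n \<Longrightarrow> A i j = (\<Sum>k<n. lam k * u k i * u k j)"
    using spectral_decomposition[OF assms] by blast
  show ?thesis by (rule exI[of _ "map lam [0..<n]"], rule char_poly_eigenbasis[OF u])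
qed

lemma char_poly_fmat_monic:
  "degree (char_poly (fmat n M)) = n" "char_poly (fmat n M) \<noteq> 0"
  using degree_monic_char_poly[of "fmat n M" n] by auto

lemma spec_sum_block:
  assumes sym: "sym_on (q + m) M"
    and off: "\<And>i j. i < q \<Longrightarrow> q \<le> j \<Longrightarrow> j < q + m \<Longrightarrow> M i j = 0"
  shows "spec_sum (q + m) f M = spec_sum q f M + spec_sum m f (\<lambda>i j. M (q + i) (q + j))"
proof -
  let ?M2 = "\<lambda>i j. M (q + i) (q + j)"
  have s1: "sym_on q M" and s2: "sym_on m ?M2" using sym by (auto simp: sym_on_def)
  have "fmat (q + m) M = four_block_mat (fmat q M) (0\<^sub>m q m) (0\<^sub>m m q) (fmat m ?M2)"
  proof (rule eq_matI)
    fix i j assume "i < dim_row (four_block_mat (fmat q M) (0\<^sub>m q m) (0\<^sub>m m q) (fmat m ?M2))"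
      "j < dim_col (four_block_mat (fmat q M) (0\<^sub>m q m) (0\<^sub>m m q) (fmat m ?M2))"
    hence ij: "i < q + m" "j < q + m" by auto
    have "M i j = 0" if "\<not> i < q" "j < q"
      using that ij off[of j i] sym by (simp add: sym_on_def)
    thus "fmat (q + m) M $$ (i, j) = four_block_mat (fmat q M) (0\<^sub>m q m) (0\<^sub>m m q) (fmat m ?M2) $$ (i, j)"
      using ij off[of i j] by (auto simp: fmat_def)
  qed auto
  hence "char_poly (fmat (q + m) M) = char_poly (fmat q M) * char_poly (fmat m ?M2)"
    by (rule char_poly_0_block) (use char_poly_fmat_splits s1 s2 in auto)
  thus ?thesis by (simp add: spec_sum_def proots_mult char_poly_fmat_monic)
qed

lemma proots_distinct_eigenvalues:
  assumes inj: "inj_on lam {..<n}"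
    and ev: "\<And>k i. k < n \<Longrightarrow> i < n \<Longrightarrow> (\<Sum>j<n. M i j * v k j) = lam k * v k i"
    and nz: "\<And>k. k < n \<Longrightarrow> \<exists>i<n. v k i \<noteq> 0"
  shows "proots (char_poly (fmat n M)) = image_mset lam (mset_set {..<n})"
proof -
  let ?p = "char_poly (fmat n M)"
  have root: "poly ?p (lam k) = 0" if k: "k < n" for k
  proof -
    have "eigenvector (fmat n M) (vec n (v k)) (lam k)"
      unfolding eigenvector_def using nz[OF k] ev[OF k]
      by (auto simp: fmat_def scalar_prod_def atLeast0LessThan vec_eq_iff)
    thus ?thesis using eigenvalue_root_char_poly[of "fmat n M" n "lam k"] by (auto simp: eigenvalue_def)
  qed
  have "mset_set (lam ` {..<n}) \<subseteq># mset_set (set_mset (proots ?p))"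
    by (rule subset_imp_msubset_mset_set) (use root poly_roots_finite[of ?p] in \<open>auto simp: char_poly_fmat_monic\<close>)
  also have "\<dots> \<subseteq># proots ?p" by (rule mset_set_set_mset_msubset)
  finally have sub: "mset_set (lam ` {..<n}) \<subseteq># proots ?p" .
  have "size (proots ?p) \<le> n" using size_proots_le[of ?p] by (simp add: char_poly_fmat_monic)
  also have "n = size (mset_set (lam ` {..<n}))" using inj by (simp add: card_image)
  finally have "mset_set (lam ` {..<n}) = proots ?p"
    using sub mset_subset_size[of "mset_set (lam ` {..<n})" "proots ?p"] 
    by (metis not_le subset_mset.le_imp_less_or_eq)
  thus ?thesis using inj by (simp add: image_mset_mset_set)
qed

definition tridiag :: "real \<Rightarrow> nat \<Rightarrow> nat \<Rightarrow> real" where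
  "tridiag a i j = (if j = Suc i \<or> i = Suc j then a else 0)"

text \<open>
The eigenvectors are the sine vectors \<open>sin (th * (i + 1))\<close>; the boundary conditions at both ends select
the frequencies. The eigenvalues are distinct, so they exhaust the roots of the characteristic polynomial.
\<close>

lemma spec_sum_tridiag:
  assumes a: "a > 0"
  shows "spec_sum k f (tridiag a) = (\<Sum>j<k. f (2 * a * cos (pi * real (Suc j) / real (Suc k))))"
proof -
  define th where "th j = pi * real (Suc j) / real (Suc k)" for j
  define v where "v j i = sin (th j * real (Suc i))" for j i
  have th: "0 < th j" "th j < pi" if "j < k" for j
    using that by (auto simp: th_def field_simps add_pos_nonneg)
  have "proots (char_poly (fmat k (tridiag a))) = image_mset (\<lambda>j. 2 * a * cos (th j)) (mset_set {..<k})"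
  proof (rule proots_distinct_eigenvalues[where v = v])
    show "inj_on (\<lambda>j. 2 * a * cos (th j)) {..<k}"
    proof (rule inj_onI)
      fix i j assume ij: "i \<in> {..<k}" "j \<in> {..<k}" "2 * a * cos (th i) = 2 * a * cos (th j)"
      have "cos (th i) = cos (th j)" using ij(3) a by simp
      hence "th i = th j"
        using ij(1,2) th[of i] th[of j] by (rule_tac cos_inj_pi) (simp_all add: less_imp_le)
      hence "real (Suc i) = real (Suc j)" unfolding th_def by (simp del: of_nat_Suc)
      thus "i = j" by simp
    qed
    show "\<exists>i<k. v j i \<noteq> 0" if "j < k" for j
      using that th[OF that] sin_gt_zero[of "th j"] by (intro exI[of _ 0]) (auto simp: v_def)
    show "(\<Sum>l<k. tridiag a i l * v j l) = 2 * a * cos (th j) * v j i" if "j < k" "i < k" for j i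
    proof -
      have up: "(if Suc i < k then v j (Suc i) else 0) = sin (th j * real (Suc (Suc i)))"
      proof (cases "Suc i < k")
        case False
        hence "Suc (Suc i) = Suc k" using that by simp
        hence "th j * real (Suc (Suc i)) = pi * real (Suc j)"
          unfolding th_def by (simp del: of_nat_Suc)
        thus ?thesis using False sin_npi2[of "Suc j"] by (simp del: of_nat_Suc)
      qed (simp add: v_def)
      have down: "(if i > 0 then v j (i - 1) else 0) = sin (th j * real i)"
        by (simp add: v_def)
      have "(\<Sum>l<k. tridiag a i l * v j l)
          = (\<Sum>l<k. (if l = Suc i then a * v j l else 0) + (if i = Suc l then a * v j l else 0))"
        by (intro sum.cong refl) (auto simp: tridiag_def)
      also have "\<dots> = (\<Sum>l<k. if l = Suc i then a * v j l else 0) + (\<Sum>l<k. if l = i - 1 \<and> i > 0 then a * v j l else 0)"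
        unfolding sum.distrib by (intro arg_cong2[of _ _ _ _ "(+)"] sum.cong) auto
      also have "\<dots> = a * (if Suc i < k then v j (Suc i) else 0) + a * (if i > 0 then v j (i - 1) else 0)"
        using that by auto
      also have "\<dots> = a * (sin (th j * real (Suc i) + th j) + sin (th j * real (Suc i) - th j))"
        unfolding up down by (simp add: algebra_simps)
      also have "\<dots> = 2 * a * cos (th j) * v j i"
        unfolding sin_add sin_diff v_def by (simp add: algebra_simps)
      finally show ?thesis .
    qed
  qed
  thus ?thesis
    by (simp add: spec_sum_def image_mset.compositionality comp_def sum_unfold_sum_mset th_def)
qed

section \<open>Gaussian families are determined by their covariance\<close>

text \<open>
After normalisation, \<open>w\<close> is a probability density, and the claim is Levy's uniqueness theorem for the
law of \<open>X\<close> under it. The weight carries the information about all other coordinates in the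
multivariate theorem below.
\<close>

lemma weighted_fourier_unique:
  fixes X w :: "'a \<Rightarrow> real"
  assumes "prob_space D" "prob_space D'" and sets: "sets D' = sets D"
    and [measurable]: "w \<in> borel_measurable D" "X \<in> borel_measurable D"
    and w: "\<And>x. 0 \<le> w x" "\<And>x. w x \<le> B"
    and eq: "\<And>t. (CLINT x|D. complex_of_real (w x) * iexp (t * X x)) = (CLINT x|D'. complex_of_real (w x) * iexp (t * X x))"
    and S[measurable]: "S \<in> sets borel"
  shows "(\<integral>x. w x * indicator S (X x) \<partial>D) = (\<integral>x. w x * indicator S (X x) \<partial>D')"
proof -
  interpret D: prob_space D by fact
  interpret D': prob_space D' by fact
  have [measurable]: "w \<in> borel_measurable D'" "X \<in> borel_measurable D'"
    using assms(4,5) by (simp_all add: measurable_cong_sets[OF sets refl])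
  have wD: "integrable D w" "integrable D' w"
    using w by (auto intro!: D.integrable_const_bound[where B = B] D'.integrable_const_bound[where B = B])
  define m where "m = (\<integral>x. w x \<partial>D)"
  have "complex_of_real (\<integral>x. w x \<partial>D) = complex_of_real (\<integral>x. w x \<partial>D')"
    using eq[of 0] by simp
  hence m': "m = (\<integral>x. w x \<partial>D')" unfolding m_def of_real_eq_iff .
  have m0: "m \<ge> 0" unfolding m_def using w by simp
  show ?thesis
  proof (cases "m = 0")
    case True
    have "AE x in D. w x = 0" "AE x in D'. w x = 0"
      using integral_nonneg_eq_0_iff_AE[OF wD(1)] integral_nonneg_eq_0_iff_AE[OF wD(2)] True m' w
      by (auto simp: m_def)
    hence "AE x in D. w x * indicator S (X x) = 0" "AE x in D'. w x * indicator S (X x) = 0"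
      by auto
    thus ?thesis by (simp add: integral_eq_zero_AE)
  next
    case False
    hence m: "m > 0" using m0 by simp
    define E where "E N = distr (density N (\<lambda>x. ennreal (w x / m))) borel X" for N
    have main: "real_distribution (E N) \<and> measure (E N) S = (\<integral>x. w x * indicator S (X x) \<partial>N) / m \<and>
        char (E N) t = (CLINT x|N. complex_of_real (w x) * iexp (t * X x)) / m"
      if N: "prob_space N" "w \<in> borel_measurable N" "X \<in> borel_measurable N"
        "(\<integral>x. w x \<partial>N) = m" "integrable N w" for N t
    proof -
      interpret N: prob_space N by fact
      note [measurable] = N(2,3)
      have "(\<integral>\<^sup>+x. ennreal (w x / m) \<partial>N) = ennreal (\<integral>x. w x / m \<partial>N)"
        using w m N(5) by (intro nn_integral_eq_integral) auto
      also have "\<dots> = 1" using N(4) m by simp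
      finally have one: "(\<integral>\<^sup>+x. ennreal (w x / m) \<partial>N) = 1" .
      have dens: "prob_space (density N (\<lambda>x. ennreal (w x / m)))"
        by (rule prob_spaceI) (simp add: emeasure_density one cong: nn_integral_cong)
      hence "prob_space (E N)" unfolding E_def
        by (rule prob_space.prob_space_distr) measurable
      hence 1: "real_distribution (E N)"
        by (simp add: real_distribution_def real_distribution_axioms_def E_def)
      have "measure (E N) S = (\<integral>x. indicator S x \<partial>E N)"
        using S by (simp add: E_def)
      also have "\<dots> = (\<integral>x. (w x / m) *\<^sub>R indicator S (X x) \<partial>N)"
        unfolding E_def using w m
        by (subst integral_distr, simp, simp, subst integral_density) auto
      finally have 2: "measure (E N) S = (\<integral>x. w x * indicator S (X x) \<partial>N) / m" by simp
      have "char (E N) t = (CLINT x|N. (w x / m) *\<^sub>R iexp (t * X x))"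
        unfolding E_def char_def using w m
        by (subst integral_distr, simp, simp, subst integral_density) auto
      also have "\<dots> = (CLINT x|N. complex_of_real (w x) * iexp (t * X x) / m)"
        by (intro Bochner_Integration.integral_cong refl) (simp add: scaleR_conv_of_real)
      finally show ?thesis using 1 2 by simp
    qed
    note 1 = main[of D, OF D.prob_space_axioms] and 2 = main[of D', OF D'.prob_space_axioms]
    have "E D = E D'"
      using 1 2 m' wD eq m_def by (intro Levy_uniqueness ext) auto
    hence "(\<integral>x. w x * indicator S (X x) \<partial>D) / m = (\<integral>x. w x * indicator S (X x) \<partial>D') / m"
      using 1 2 m' wD m_def by (metis (no_types, lifting) \<open>X \<in> borel_measurable D'\<close> \<open>w \<in> borel_measurable D'\<close> assms(4,5))
    thus ?thesis using m by simp
  qed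
qed

text \<open>
Exponentials are replaced by indicators of Borel sets one coordinate at a time. The exponential of
the remaining coordinates is not a nonnegative weight, but it is a linear combination of the weights
\<open>1\<close>, \<open>1 + cos\<close> and \<open>1 + sin\<close>, to which the one-dimensional statement applies.
\<close>

lemma fourier_unique_PiM:
  fixes D D' :: "('j \<Rightarrow> real) measure"
  assumes "prob_space D" "prob_space D'" and J: "finite J"
    and sets: "sets D = sets (PiM J (\<lambda>_. borel))" "sets D' = sets (PiM J (\<lambda>_. borel))"
    and eq: "\<And>t. (CLINT x|D. iexp (\<Sum>j\<in>J. t j * x j)) = (CLINT x|D'. iexp (\<Sum>j\<in>J. t j * x j))"
  shows "D = D'"
proof -
  interpret D: prob_space D by fact
  interpret D': prob_space D' by fact
  have sets': "sets D' = sets D" using sets by simp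
  have meas: "g \<in> borel_measurable D'" if "g \<in> borel_measurable D" for g :: "_ \<Rightarrow> 'b :: topological_space"
    using that by (simp add: measurable_cong_sets[OF sets' refl])
  have comp[measurable]: "(\<lambda>x. x j) \<in> borel_measurable D" if "j \<in> J" for j
    using that by (simp add: measurable_cong_sets[OF sets(1) refl] measurable_component_singleton)
  define p where "p A S x = (\<Prod>j\<in>A. indicator (S j) (x j) :: real)" for A and S :: "'j \<Rightarrow> real set" and x
  have p01: "0 \<le> p A S x" "p A S x \<le> 1" for A S x
    unfolding p_def by (auto intro!: prod_nonneg prod_le_1 simp: indicator_def)
  have claim: "(CLINT x|D. complex_of_real (p A S x) * iexp (\<Sum>j\<in>J-A. t j * x j))
      = (CLINT x|D'. complex_of_real (p A S x) * iexp (\<Sum>j\<in>J-A. t j * x j))"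
    if "A \<subseteq> J" "\<And>j. j \<in> A \<Longrightarrow> S j \<in> sets borel" for A S t
  proof -
    have "finite A" using that(1) J by (rule finite_subset)
    from this that show ?thesis
    proof (induction A arbitrary: t rule: finite_induct)
      case empty
      show ?case using eq[of t] by (simp add: p_def)
    next
      case (insert b A)
      have bJ: "b \<in> J" and AJ: "A \<subseteq> J" and SA: "\<And>j. j \<in> A \<Longrightarrow> S j \<in> sets borel"
        using insert.prems by auto
      have Sb: "S b \<in> sets borel" using insert.prems by auto
      note IH = insert.IH[OF AJ SA]
      define th where "th x = (\<Sum>j\<in>J-insert b A. t j * x j)" for x
      have [measurable]: "th \<in> borel_measurable D" unfolding th_def by measurable
      have [measurable]: "p A S \<in> borel_measurable D"
        unfolding p_def using AJ SA by (intro borel_measurable_prod) (measurable, auto)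
      have [measurable]: "(\<lambda>x. x b) \<in> borel_measurable D" using bJ by (rule comp)
      have JA: "J - A = insert b (J - insert b A)" using bJ insert.hyps by auto
      have E: "(CLINT x|D. complex_of_real (p A S x) * iexp (s * th x + \<tau> * x b))
          = (CLINT x|D'. complex_of_real (p A S x) * iexp (s * th x + \<tau> * x b))" for s \<tau>
      proof -
        define t' where "t' = (\<lambda>j. if j = b then \<tau> else s * t j)"
        have "(\<Sum>j\<in>J-A. t' j * x j) = s * th x + \<tau> * x b" for x
        proof -
          have "(\<Sum>j\<in>J-insert b A. t' j * x j) = s * th x"
            unfolding th_def sum_distrib_left by (intro sum.cong) (auto simp: t'_def)
          thus ?thesis unfolding JA using J by (subst sum.insert) (auto simp: t'_def)
        qed
        thus ?thesis using IH[of t'] by simp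
      qed
      have int: "integrable N (\<lambda>x. complex_of_real (p A S x) * iexp (g x))"
        if "N = D \<or> N = D'" "g \<in> borel_measurable D" for N g
      proof -
        have "integrable D (\<lambda>x. complex_of_real (p A S x) * iexp (g x))"
          using that(2) p01 by (intro D.integrable_const_bound[where B = 1]) (auto simp: norm_mult)
        moreover have "integrable D' (\<lambda>x. complex_of_real (p A S x) * iexp (g x))"
          using meas[OF that(2)] meas[of "p A S"] p01 by (intro D'.integrable_const_bound[where B = 1]) (auto simp: norm_mult)
        ultimately show ?thesis using that by auto
      qed
      have cosE: "complex_of_real (p A S x * (1 + cos (th x))) * iexp (\<tau> * x b)
          = complex_of_real (p A S x) * iexp (0 * th x + \<tau> * x b)
          + (complex_of_real (p A S x) * iexp (1 * th x + \<tau> * x b)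
              + complex_of_real (p A S x) * iexp ((-1) * th x + \<tau> * x b)) / 2" for x \<tau>
        by (simp add: cos_of_real[symmetric] cos_exp_eq exp_add exp_diff exp_minus distrib_left distrib_right field_simps)
      have sinE: "complex_of_real (p A S x * (1 + sin (th x))) * iexp (\<tau> * x b)
          = complex_of_real (p A S x) * iexp (0 * th x + \<tau> * x b)
          + (complex_of_real (p A S x) * iexp (1 * th x + \<tau> * x b)
              - complex_of_real (p A S x) * iexp ((-1) * th x + \<tau> * x b)) / (2 * \<i>)" for x \<tau>
        by (simp add: sin_of_real[symmetric] sin_exp_eq exp_add exp_diff exp_minus distrib_left distrib_right field_simps)
      have I: "integrable N (\<lambda>x. complex_of_real (p A S x) * iexp (s * th x + \<tau> * x b))"
        if "N = D \<or> N = D'" for N s \<tau> by (rule int[OF that]) measurable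
      have cosI: "(CLINT x|N. complex_of_real (p A S x * (1 + cos (th x))) * iexp (\<tau> * x b))
          = (CLINT x|N. complex_of_real (p A S x) * iexp (0 * th x + \<tau> * x b))
          + ((CLINT x|N. complex_of_real (p A S x) * iexp (1 * th x + \<tau> * x b))
              + (CLINT x|N. complex_of_real (p A S x) * iexp ((-1) * th x + \<tau> * x b))) / 2"
        and sinI: "(CLINT x|N. complex_of_real (p A S x * (1 + sin (th x))) * iexp (\<tau> * x b))
          = (CLINT x|N. complex_of_real (p A S x) * iexp (0 * th x + \<tau> * x b))
          + ((CLINT x|N. complex_of_real (p A S x) * iexp (1 * th x + \<tau> * x b))
              - (CLINT x|N. complex_of_real (p A S x) * iexp ((-1) * th x + \<tau> * x b))) / (2 * \<i>)"
        if "N = D \<or> N = D'" for N \<tau>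
        unfolding cosE sinE
        by (simp_all only: Bochner_Integration.integral_add Bochner_Integration.integral_diff
            Bochner_Integration.integrable_add Bochner_Integration.integrable_diff
            integrable_divide integral_divide_zero I[OF that])
      have fac: "0 \<le> 1 + (if c = (0::nat) then cos (th x) else if c = 1 then sin (th x) else 0)"
        "1 + (if c = (0::nat) then cos (th x) else if c = 1 then sin (th x) else 0) \<le> 2" for c x
      proof -
        have "0 \<le> 1 + cos (th x)" "0 \<le> 1 + sin (th x)"
          using cos_ge_minus_one[of "th x"] sin_ge_minus_one[of "th x"] by linarith+
        thus "0 \<le> 1 + (if c = (0::nat) then cos (th x) else if c = 1 then sin (th x) else 0)"
          "1 + (if c = (0::nat) then cos (th x) else if c = 1 then sin (th x) else 0) \<le> 2" by auto
      qed
      \<comment> \<open>The index \<open>c\<close> selects the weight with \<open>cos\<close>, with \<open>sin\<close>, or the constant weight.\<close>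
      define W where "W = (\<lambda>c x. p A S x * (1 + (if c = (0::nat) then cos (th x) else if c = 1 then sin (th x) else 0)))"
      have W[measurable]: "W c \<in> borel_measurable D" for c
        unfolding W_def by measurable
      have eqW: "(\<integral>x. W c x * indicator (S b) (x b) \<partial>D) = (\<integral>x. W c x * indicator (S b) (x b) \<partial>D')" for c
      proof (rule weighted_fourier_unique[OF assms(1,2) sets', where B = 2])
        show "0 \<le> W c x" for x
          unfolding W_def by (intro mult_nonneg_nonneg p01 fac)
        show "W c x \<le> 2" for x
        proof -
          have "W c x \<le> 1 * 2" unfolding W_def by (intro mult_mono p01 fac) simp
          thus ?thesis by simp
        qed
        show "(CLINT x|D. complex_of_real (W c x) * iexp (\<tau> * x b)) = (CLINT x|D'. complex_of_real (W c x) * iexp (\<tau> * x b))" for \<tau>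
        proof -
          consider "c = 0" | "c = 1" | "c > 1" by linarith
          thus ?thesis
          proof cases
            case 1
            have "W c x = p A S x * (1 + cos (th x))" for x by (simp add: W_def 1)
            thus ?thesis by (simp only: cosI[of D] cosI[of D'] E refl simp_thms)
          next
            case 2
            have "W c x = p A S x * (1 + sin (th x))" for x by (simp add: W_def 2)
            thus ?thesis by (simp only: sinI[of D] sinI[of D'] E refl simp_thms)
          next
            case 3
            thus ?thesis unfolding W_def using E[of 0] by simp
          qed
        qed
      qed (use Sb in auto)
      have pins: "p (insert b A) S x = p A S x * indicator (S b) (x b)" for x
        using insert.hyps by (simp add: p_def)
      have W3: "W 2 x = p A S x" "W 0 x = p A S x + p A S x * cos (th x)" "W 1 x = p A S x + p A S x * sin (th x)" for x
        by (simp_all add: W_def algebra_simps)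
      have iexp_split: "complex_of_real (p (insert b A) S x) * iexp (th x)
          = complex_of_real (W 0 x * indicator (S b) (x b)) - complex_of_real (W 2 x * indicator (S b) (x b))
           + \<i> * (complex_of_real (W 1 x * indicator (S b) (x b)) - complex_of_real (W 2 x * indicator (S b) (x b)))" for x
        unfolding pins W3 by (simp add: exp_Euler cos_of_real sin_of_real algebra_simps)
      have WI: "integrable N (\<lambda>x. W c x * indicator (S b) (x b))" if "N = D \<or> N = D'" for N c
      proof -
        have b: "\<bar>W c x * indicator (S b) (x b)\<bar> \<le> 2" for x
        proof -
          have "W c x \<le> 1 * 2" unfolding W_def by (intro mult_mono p01 fac) simp
          moreover have "0 \<le> W c x" unfolding W_def by (intro mult_nonneg_nonneg p01 fac)
          ultimately show ?thesis by (simp add: abs_mult indicator_def)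
        qed
        have m: "(\<lambda>x. W c x * indicator (S b) (x b)) \<in> borel_measurable D"
          using Sb by measurable
        have "integrable D (\<lambda>x. W c x * indicator (S b) (x b))"
          using m b by (intro D.integrable_const_bound[where B = 2]) auto
        moreover have "integrable D' (\<lambda>x. W c x * indicator (S b) (x b))"
          using meas[OF m] b by (intro D'.integrable_const_bound[where B = 2]) auto
        ultimately show ?thesis using that by auto
      qed
      have "(CLINT x|N. complex_of_real (p (insert b A) S x) * iexp (th x))
          = complex_of_real (\<integral>x. W 0 x * indicator (S b) (x b) \<partial>N) - complex_of_real (\<integral>x. W 2 x * indicator (S b) (x b) \<partial>N)
           + \<i> * (complex_of_real (\<integral>x. W 1 x * indicator (S b) (x b) \<partial>N) - complex_of_real (\<integral>x. W 2 x * indicator (S b) (x b) \<partial>N))"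
        if "N = D \<or> N = D'" for N
        unfolding iexp_split using WI[OF that, THEN integrable_of_real[where 'a = complex]]
        by (simp del: of_real_mult)
      thus ?case unfolding th_def[symmetric] using eqW by simp
    qed
  qed
  show ?thesis
  proof (rule measure_eqI_PiM_finite[OF J sets])
    show "emeasure D (Pi\<^sub>E J A) = emeasure D' (Pi\<^sub>E J A)" if "\<And>i. i \<in> J \<Longrightarrow> A i \<in> sets borel" for A
    proof -
      have sp: "space D = Pi\<^sub>E J (\<lambda>_. UNIV)" "space D' = Pi\<^sub>E J (\<lambda>_. UNIV)"
        using sets_eq_imp_space_eq[OF sets(1)] sets_eq_imp_space_eq[OF sets(2)] by (simp_all add: space_PiM)
      have ind: "p J A x = indicator (Pi\<^sub>E J A) x" if "x \<in> Pi\<^sub>E J (\<lambda>_. UNIV)" for x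
        using that J by (auto simp: p_def indicator_def PiE_iff)
      have m: "Pi\<^sub>E J A \<in> sets D" "Pi\<^sub>E J A \<in> sets D'"
        using that J by (auto simp: sets intro!: sets_PiM_I_finite)
      have "complex_of_real (\<integral>x. p J A x \<partial>D) = complex_of_real (\<integral>x. p J A x \<partial>D')"
        using claim[of J A] that by simp
      hence "(\<integral>x. p J A x \<partial>D) = (\<integral>x. p J A x \<partial>D')" unfolding of_real_eq_iff .
      moreover have "(\<integral>x. p J A x \<partial>D) = (\<integral>x. indicator (Pi\<^sub>E J A) x \<partial>D)"
        "(\<integral>x. p J A x \<partial>D') = (\<integral>x. indicator (Pi\<^sub>E J A) x \<partial>D')"
        by (intro Bochner_Integration.integral_cong refl; simp add: ind sp)+
      ultimately show ?thesis using m by (simp add: D.emeasure_eq_measure D'.emeasure_eq_measure)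
    qed
    show "range (\<lambda>i::nat. Pi\<^sub>E J (\<lambda>_. UNIV)) \<subseteq> prod_algebra J (\<lambda>_. borel :: real measure)"
      using J by (auto intro!: prod_algebraI_finite)
    show "(\<Union>i::nat. Pi\<^sub>E J (\<lambda>_. UNIV)) = space (Pi\<^sub>M J (\<lambda>_. borel :: real measure))"
      by (simp add: space_PiM)
  qed auto
qed

text \<open>
A finite centred Gaussian family with covariance \<open>K\<close>. The definition by characteristic functions admits
degenerate covariances, and makes the passage to linear images a change of variables in \<open>t\<close>.
\<close>

definition gauss_fam :: "'a measure \<Rightarrow> 'j set \<Rightarrow> ('j \<Rightarrow> 'a \<Rightarrow> real) \<Rightarrow> ('j \<Rightarrow> 'j \<Rightarrow> real) \<Rightarrow> bool" where
  "gauss_fam M J Y K \<longleftrightarrow> prob_space M \<and> finite J \<and> (\<forall>j\<in>J. Y j \<in> borel_measurable M) \<and>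
     (\<forall>t. (CLINT \<omega>|M. iexp (\<Sum>j\<in>J. t j * Y j \<omega>))
          = complex_of_real (exp (- (\<Sum>i\<in>J. \<Sum>j\<in>J. K i j * t i * t j) / 2)))"

lemma gauss_fam_linear:
  assumes g: "gauss_fam M J Y K" and J': "finite J'"
    and K': "\<And>i i'. i \<in> J' \<Longrightarrow> i' \<in> J' \<Longrightarrow> K' i i' = (\<Sum>j\<in>J. \<Sum>j'\<in>J. L i j * L i' j' * K j j')"
  shows "gauss_fam M J' (\<lambda>i \<omega>. \<Sum>j\<in>J. L i j * Y j \<omega>) K'"
  unfolding gauss_fam_def
proof (intro conjI ballI allI)
  show "prob_space M" "finite J'" using g J' by (simp_all add: gauss_fam_def)
  show "(\<lambda>\<omega>. \<Sum>j\<in>J. L i j * Y j \<omega>) \<in> borel_measurable M" for i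
    using g unfolding gauss_fam_def by (intro borel_measurable_sum) auto
  fix t
  define s where "s j = (\<Sum>i\<in>J'. t i * L i j)" for j
  have "(\<Sum>i\<in>J'. t i * (\<Sum>j\<in>J. L i j * Y j \<omega>)) = (\<Sum>j\<in>J. s j * Y j \<omega>)" for \<omega>
    unfolding s_def sum_distrib_left sum_distrib_right by (subst sum.swap) (simp add: mult.assoc)
  moreover have "(\<Sum>i\<in>J'. \<Sum>i'\<in>J'. K' i i' * t i * t i') = (\<Sum>j\<in>J. \<Sum>j'\<in>J. K j j' * s j * s j')"
  proof -
    have "(\<Sum>i\<in>J'. \<Sum>i'\<in>J'. K' i i' * t i * t i')
        = (\<Sum>i\<in>J'. \<Sum>i'\<in>J'. \<Sum>j\<in>J. \<Sum>j'\<in>J. K j j' * ((t i * L i j) * (t i' * L i' j')))"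
      by (intro sum.cong refl) (simp add: K' sum_distrib_left sum_distrib_right ac_simps)
    also have "\<dots> = (\<Sum>j\<in>J. \<Sum>j'\<in>J. \<Sum>i\<in>J'. \<Sum>i'\<in>J'. K j j' * ((t i * L i j) * (t i' * L i' j')))"
    proof -
      have "(\<Sum>i\<in>J'. \<Sum>i'\<in>J'. \<Sum>j\<in>J. \<Sum>j'\<in>J. G i i' j j') = (\<Sum>i\<in>J'. \<Sum>j\<in>J. \<Sum>j'\<in>J. \<Sum>i'\<in>J'. G i i' j j')"
        for G :: "_ \<Rightarrow> _ \<Rightarrow> _ \<Rightarrow> _ \<Rightarrow> real"
        by (intro sum.cong refl sum_swap3)
      also have "(\<Sum>i\<in>J'. \<Sum>j\<in>J. \<Sum>j'\<in>J. \<Sum>i'\<in>J'. G i i' j j') = (\<Sum>j\<in>J. \<Sum>j'\<in>J. \<Sum>i\<in>J'. \<Sum>i'\<in>J'. G i i' j j')"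
        for G :: "_ \<Rightarrow> _ \<Rightarrow> _ \<Rightarrow> _ \<Rightarrow> real"
        by (rule sum_swap3)
      finally show ?thesis .
    qed
    also have "\<dots> = (\<Sum>j\<in>J. \<Sum>j'\<in>J. K j j' * s j * s j')"
    proof (intro sum.cong refl)
      fix j j'
      have "s j * s j' = (\<Sum>i\<in>J'. \<Sum>i'\<in>J'. (t i * L i j) * (t i' * L i' j'))"
        unfolding s_def by (rule sum_product)
      hence "K j j' * (s j * s j') = (\<Sum>i\<in>J'. \<Sum>i'\<in>J'. K j j' * ((t i * L i j) * (t i' * L i' j')))"
        by (simp only: sum_distrib_left)
      thus "(\<Sum>i\<in>J'. \<Sum>i'\<in>J'. K j j' * ((t i * L i j) * (t i' * L i' j'))) = K j j' * s j * s j'"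
        by (simp only: mult.assoc)
    qed
    finally show ?thesis .
  qed
  ultimately show "(CLINT \<omega>|M. iexp (\<Sum>i\<in>J'. t i * (\<Sum>j\<in>J. L i j * Y j \<omega>)))
      = complex_of_real (exp (- (\<Sum>i\<in>J'. \<Sum>i'\<in>J'. K' i i' * t i * t i') / 2))"
    using g unfolding gauss_fam_def by simp
qed

text \<open>
The covariance determines the joint law. All identities in law below are therefore reduced to an
equality of two finite sums.
\<close>

lemma gauss_fam_unique:
  assumes Y: "gauss_fam M J Y K" and Y': "gauss_fam N J Y' K'"
    and K: "\<And>i j. i \<in> J \<Longrightarrow> j \<in> J \<Longrightarrow> K i j = K' i j"
  shows "distr M (PiM J (\<lambda>_. borel)) (\<lambda>\<omega>. \<lambda>j\<in>J. Y j \<omega>) = distr N (PiM J (\<lambda>_. borel)) (\<lambda>\<omega>. \<lambda>j\<in>J. Y' j \<omega>)"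
proof (rule fourier_unique_PiM[where J = J])
  have m: "(\<lambda>\<omega>. \<lambda>j\<in>J. Y j \<omega>) \<in> M \<rightarrow>\<^sub>M PiM J (\<lambda>_. borel)" "(\<lambda>\<omega>. \<lambda>j\<in>J. Y' j \<omega>) \<in> N \<rightarrow>\<^sub>M PiM J (\<lambda>_. borel)"
    using Y Y' by (auto simp: gauss_fam_def intro!: measurable_restrict)
  show "prob_space (distr M (PiM J (\<lambda>_. borel)) (\<lambda>\<omega>. \<lambda>j\<in>J. Y j \<omega>))"
    "prob_space (distr N (PiM J (\<lambda>_. borel)) (\<lambda>\<omega>. \<lambda>j\<in>J. Y' j \<omega>))"
    using m Y Y' by (auto simp: gauss_fam_def intro: prob_space.prob_space_distr)
  show "finite J" using Y by (simp add: gauss_fam_def)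
  have Keq: "(\<Sum>i\<in>J. \<Sum>j\<in>J. K i j * t i * t j) = (\<Sum>i\<in>J. \<Sum>j\<in>J. K' i j * t i * t j)" for t
    by (intro sum.cong refl) (simp add: K)
  show "(CLINT x|distr M (PiM J (\<lambda>_. borel)) (\<lambda>\<omega>. \<lambda>j\<in>J. Y j \<omega>). iexp (\<Sum>j\<in>J. t j * x j))
      = (CLINT x|distr N (PiM J (\<lambda>_. borel)) (\<lambda>\<omega>. \<lambda>j\<in>J. Y' j \<omega>). iexp (\<Sum>j\<in>J. t j * x j))" for t
  proof -
    have [measurable]: "(\<lambda>x. \<Sum>j\<in>J. t j * x j) \<in> borel_measurable (PiM J (\<lambda>_. borel))" by measurable
    show ?thesis using Y Y' m Keq[of t]
      by (simp add: integral_distr gauss_fam_def del: of_real_sum cong: sum.cong)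
  qed
qed auto

lemma sum_of_bool_Kronecker:
  fixes t :: "'i \<Rightarrow> real"
  assumes "finite I"
  shows "(\<Sum>i\<in>I. \<Sum>j\<in>I. of_bool (i = j) * t i * t j) = (\<Sum>i\<in>I. (t i)\<^sup>2)"
proof (intro sum.cong refl)
  fix i assume "i \<in> I"
  have "(\<Sum>j\<in>I. of_bool (i = j) * t i * t j) = (\<Sum>j\<in>I. if i = j then (t j)\<^sup>2 else 0)"
    by (intro sum.cong refl) (auto simp: power2_eq_square)
  thus "(\<Sum>j\<in>I. of_bool (i = j) * t i * t j) = (t i)\<^sup>2" using assms \<open>i \<in> I\<close> by simp
qed

lemma gauss_fam_indep:
  assumes "prob_space M" "finite I" "prob_space.indep_vars M (\<lambda>_. borel) Z I"
    and Z: "\<And>i. i \<in> I \<Longrightarrow> distributed M lborel (Z i) std_normal_density"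
  shows "gauss_fam M I Z (\<lambda>i j. of_bool (i = j))"
  unfolding gauss_fam_def
proof (intro conjI ballI allI)
  interpret prob_space M by fact
  show "prob_space M" "finite I" by fact+
  show mZ: "Z i \<in> borel_measurable M" if "i \<in> I" for i
    using distributed_measurable[OF Z[OF that]] by simp
  fix t
  have ind: "indep_vars (\<lambda>_. borel) (\<lambda>i \<omega>. t i * Z i \<omega>) I"
    by (rule indep_vars_compose2[OF assms(3)]) measurable
  have one: "char (distr M borel (\<lambda>\<omega>. t i * Z i \<omega>)) 1 = complex_of_real (exp (- (t i)\<^sup>2 / 2))" if "i \<in> I" for i
  proof -
    have "distr M borel (Z i) = distr M lborel (Z i)" by (rule distr_cong) auto
    also have "\<dots> = std_normal_distribution"
      using distributed_distr_eq_density[OF Z[OF that]] by simp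
    finally have d: "distr M borel (Z i) = std_normal_distribution" .
    have "char (distr M borel (\<lambda>\<omega>. t i * Z i \<omega>)) 1 = (CLINT \<omega>|M. iexp (t i * Z i \<omega>))"
      using mZ[OF that] by (simp add: char_def integral_distr)
    also have "\<dots> = char (distr M borel (Z i)) (t i)"
      using mZ[OF that] by (simp add: char_def integral_distr)
    finally show ?thesis unfolding d char_std_normal_distribution by simp
  qed
  have "(CLINT \<omega>|M. iexp (\<Sum>j\<in>I. t j * Z j \<omega>)) = char (distr M borel (\<lambda>\<omega>. \<Sum>j\<in>I. t j * Z j \<omega>)) 1"
    using mZ by (simp add: char_def integral_distr)
  also have "\<dots> = (\<Prod>i\<in>I. complex_of_real (exp (- (t i)\<^sup>2 / 2)))"
    unfolding char_distr_sum[OF ind] by (intro prod.cong refl one)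
  also have "\<dots> = complex_of_real (exp (\<Sum>i\<in>I. - (t i)\<^sup>2 / 2))"
    using \<open>finite I\<close> by (simp only: exp_sum of_real_prod)
  also have "(\<Sum>i\<in>I. - (t i)\<^sup>2 / 2) = - (\<Sum>i\<in>I. \<Sum>j\<in>I. of_bool (i = j) * t i * t j) / 2"
    unfolding sum_of_bool_Kronecker[OF \<open>finite I\<close>] by (simp add: sum_negf sum_divide_distrib)
  finally show "(CLINT \<omega>|M. iexp (\<Sum>j\<in>I. t j * Z j \<omega>))
      = complex_of_real (exp (- (\<Sum>i\<in>I. \<Sum>j\<in>I. of_bool (i = j) * t i * t j) / 2))" .
qed

text \<open>
The form of \<open>B - A\<close> is dominated by the diagonal matrix of its absolute row sums, since
\<open>2 * \<bar>x\<^sub>i * x\<^sub>j\<bar> \<le> x\<^sub>i\<^sup>2 + x\<^sub>j\<^sup>2\<close>.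
\<close>

lemma spec_sum_entrywise:
  assumes A: "sym_on n A" and B: "sym_on n B" and f: "L-lipschitz_on UNIV f"
  shows "\<bar>spec_sum n f B - spec_sum n f A\<bar> \<le> 3 * L * (\<Sum>i<n. \<Sum>j<n. \<bar>B i j - A i j\<bar>)"
proof -
  define D where "D i j = \<bar>B i j - A i j\<bar>" for i j
  define S where "S i j = of_bool (i = j) * (\<Sum>k<n. D i k)" for i j
  have Dsym: "D i j = D j i" if "i < n" "j < n" for i j
    using A B that by (simp add: D_def sym_on_def)
  have "\<bar>spec_sum n f B - spec_sum n f A\<bar> \<le> 3 * L * (\<Sum>i<n. S i i)"
  proof (rule spec_sum_perturb[OF A B _ _ f, where S = S])
    show "sym_on n S" by (simp add: sym_on_def S_def)
    fix x
    have "\<bar>quad n B x - quad n A x\<bar> = \<bar>\<Sum>i<n. \<Sum>j<n. (B i j - A i j) * x i * x j\<bar>"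
      by (simp add: quad_def left_diff_distrib sum_subtractf)
    also have "\<dots> \<le> (\<Sum>i<n. \<Sum>j<n. \<bar>(B i j - A i j) * x i * x j\<bar>)"
      by (intro order_trans[OF sum_abs] sum_mono sum_abs)
    also have "\<dots> \<le> (\<Sum>i<n. \<Sum>j<n. D i j * (x i)\<^sup>2 / 2 + D i j * (x j)\<^sup>2 / 2)"
    proof (intro sum_mono)
      fix i j
      have "0 \<le> (\<bar>x i\<bar> - \<bar>x j\<bar>)\<^sup>2" by simp
      hence "2 * (\<bar>x i\<bar> * \<bar>x j\<bar>) \<le> (x i)\<^sup>2 + (x j)\<^sup>2" by (simp add: power2_diff)
      hence "D i j * (2 * (\<bar>x i\<bar> * \<bar>x j\<bar>)) \<le> D i j * ((x i)\<^sup>2 + (x j)\<^sup>2)"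
        by (intro mult_left_mono) (auto simp: D_def)
      moreover have "\<bar>(B i j - A i j) * x i * x j\<bar> = D i j * (\<bar>x i\<bar> * \<bar>x j\<bar>)"
        by (simp add: abs_mult D_def)
      moreover have "D i j * ((x i)\<^sup>2 + (x j)\<^sup>2) = D i j * (x i)\<^sup>2 + D i j * (x j)\<^sup>2"
        by (rule distrib_left)
      ultimately show "\<bar>(B i j - A i j) * x i * x j\<bar> \<le> D i j * (x i)\<^sup>2 / 2 + D i j * (x j)\<^sup>2 / 2"
        by linarith
    qed
    also have "\<dots> = (\<Sum>i<n. \<Sum>j<n. D i j * (x i)\<^sup>2 / 2) + (\<Sum>i<n. \<Sum>j<n. D i j * (x j)\<^sup>2 / 2)"
      by (simp add: sum.distrib)
    also have "(\<Sum>i<n. \<Sum>j<n. D i j * (x j)\<^sup>2 / 2) = (\<Sum>i<n. \<Sum>j<n. D i j * (x i)\<^sup>2 / 2)"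
      by (subst sum.swap) (intro sum.cong refl, simp add: Dsym)
    also have "(\<Sum>i<n. \<Sum>j<n. D i j * (x i)\<^sup>2 / 2) + (\<Sum>i<n. \<Sum>j<n. D i j * (x i)\<^sup>2 / 2) = quad n S x"
    proof -
      have "quad n S x = (\<Sum>i<n. \<Sum>j<n. of_bool (i = j) * ((\<Sum>k<n. D i k) * x i * x j))"
        unfolding quad_def S_def by (intro sum.cong refl) (simp only: mult.assoc)
      also have "\<dots> = (\<Sum>i<n. (\<Sum>k<n. D i k) * x i * x i)"
        by (intro sum.cong refl) (simp only: sum_of_bool_eq lessThan_iff)
      finally show ?thesis
        by (simp add: sum_distrib_right sum_distrib_left power2_eq_square ac_simps flip: sum.distrib)
    qed
    finally show "\<bar>quad n B x - quad n A x\<bar> \<le> quad n S x" .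
  qed
  thus ?thesis by (simp add: S_def D_def)
qed

lemma spec_sum_bound:
  assumes "sym_on n A" "\<And>x. \<bar>f x\<bar> \<le> B"
  shows "\<bar>spec_sum n f A\<bar> \<le> real n * B"
proof -
  obtain lam u where u: "orth_on n u"
    "\<And>i j. i < n \<Longrightarrow> j < n \<Longrightarrow> A i j = (\<Sum>k<n. lam k * u k i * u k j)"
    using spectral_decomposition[OF assms(1)] by blast
  have "\<bar>spec_sum n f A\<bar> = \<bar>\<Sum>k<n. f (lam k)\<bar>" using spec_sum_eigenbasis[OF u, of f] by simp
  also have "\<dots> \<le> (\<Sum>k<n. B)" by (intro order_trans[OF sum_abs] sum_mono assms(2))
  finally show ?thesis by simp
qed

text \<open>
For a Lipschitz function the spectral sum is Lipschitz in the entries, hence continuous in the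
product topology. This avoids a measurable choice of eigenvalues.
\<close>

lemma spec_sum_measurable:
  fixes M :: "'a \<Rightarrow> nat \<Rightarrow> nat \<Rightarrow> real"
  assumes M: "\<And>i j. i < n \<Longrightarrow> j < n \<Longrightarrow> (\<lambda>\<omega>. M \<omega> i j) \<in> borel_measurable N"
    and sym: "\<And>\<omega>. sym_on n (M \<omega>)" and f: "L-lipschitz_on UNIV f"
  shows "(\<lambda>\<omega>. spec_sum n f (M \<omega>)) \<in> borel_measurable N"
proof -
  define S where "S a i j = (a (i, j) + a (j, i)) / 2" for a :: "nat \<times> nat \<Rightarrow> real" and i j
  define F where "F a = spec_sum n f (S a)" for a
  have Ssym: "sym_on n (S a)" for a by (simp add: S_def sym_on_def add.commute)
  have coord: "((\<lambda>a. a p) \<longlongrightarrow> a0 p) (at a0)" for a0 :: "nat \<times> nat \<Rightarrow> real" and p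
  proof -
    have "continuous_on UNIV (\<lambda>a :: nat \<times> nat \<Rightarrow> real. a p)" by (rule continuous_on_product_coordinates)
    thus ?thesis by (simp add: continuous_on_def)
  qed
  have "continuous_on UNIV F"
    unfolding continuous_on_def
  proof (intro ballI)
    fix a0 :: "nat \<times> nat \<Rightarrow> real"
    have Scoord: "((\<lambda>a. S a i j) \<longlongrightarrow> S a0 i j) (at a0)" for i j
      unfolding S_def by (intro tendsto_intros coord) auto
    have "((\<lambda>a. 3 * L * (\<Sum>i<n. \<Sum>j<n. \<bar>S a i j - S a0 i j\<bar>))
            \<longlongrightarrow> 3 * L * (\<Sum>i<n. \<Sum>j<n. \<bar>S a0 i j - S a0 i j\<bar>)) (at a0)"
      by (intro tendsto_intros Scoord)
    hence lim: "((\<lambda>a. 3 * L * (\<Sum>i<n. \<Sum>j<n. \<bar>S a i j - S a0 i j\<bar>)) \<longlongrightarrow> 0) (at a0)" by simp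
    have "((\<lambda>a. F a - F a0) \<longlongrightarrow> 0) (at a0)"
      by (rule Lim_null_comparison[OF _ lim])
         (use spec_sum_entrywise[OF Ssym Ssym f] in \<open>auto simp: F_def\<close>)
    thus "(F \<longlongrightarrow> F a0) (at a0 within UNIV)" by (simp add: LIM_zero_iff)
  qed
  hence [measurable]: "F \<in> borel_measurable borel" by (rule borel_measurable_continuous_onI)
  define m where "m \<omega> p = (if fst p < n \<and> snd p < n then M \<omega> (fst p) (snd p) else 0)" for \<omega> p
  have "m \<in> N \<rightarrow>\<^sub>M PiM UNIV (\<lambda>_. borel)"
  proof -
    have "(\<lambda>\<omega>. m \<omega> p) \<in> borel_measurable N" for p
      using M[of "fst p" "snd p"] by (cases "fst p < n \<and> snd p < n") (auto simp: m_def)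
    hence "(\<lambda>\<omega> p. m \<omega> p) \<in> N \<rightarrow>\<^sub>M PiM UNIV (\<lambda>_. borel)" by (rule measurable_abs_UNIV)
    thus ?thesis by simp
  qed
  hence [measurable]: "m \<in> borel_measurable N"
    by (simp add: measurable_cong_sets[OF refl sets_PiM_equal_borel])
  have "spec_sum n f (M \<omega>) = F (m \<omega>)" for \<omega>
    unfolding F_def using sym[of \<omega>]
    by (intro spec_sum_cong) (auto simp: S_def m_def sym_on_def)
  thus ?thesis by simp
qed

abbreviation gauss_space :: "'i set \<Rightarrow> ('i \<Rightarrow> real) measure" where
  "gauss_space I \<equiv> PiM I (\<lambda>_. std_normal_distribution)"

lemma prob_space_std_normal: "prob_space std_normal_distribution"
  by (rule prob_space_normal_density) simp

lemma product_prob_space_std_normal: "product_prob_space (\<lambda>_. std_normal_distribution)"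
  by (simp add: product_prob_space_def product_prob_space_axioms_def product_sigma_finite_def
      prob_space_std_normal prob_space_imp_sigma_finite)

lemma prob_space_gauss_space: "prob_space (gauss_space I)"
  by (intro prob_space_PiM prob_space_std_normal)

lemma measurable_gauss_space_coord:
  "i \<in> I \<Longrightarrow> (\<lambda>x. x i) \<in> borel_measurable (gauss_space I)"
  using measurable_component_singleton[of i I "\<lambda>_. std_normal_distribution"] by simp

lemma gauss_space_integral_prod:
  fixes g :: "'i \<Rightarrow> real \<Rightarrow> 'b :: {real_normed_field, banach, second_countable_topology}"
  assumes "finite I" "\<And>i. i \<in> I \<Longrightarrow> integrable std_normal_distribution (g i)"
  shows "(\<integral>x. (\<Prod>i\<in>I. g i (x i)) \<partial>gauss_space I) = (\<Prod>i\<in>I. \<integral>x. g i x \<partial>std_normal_distribution)"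
    "integrable (gauss_space I) (\<lambda>x. \<Prod>i\<in>I. g i (x i))"
proof -
  interpret product_prob_space "\<lambda>_ :: 'i. std_normal_distribution" by (rule product_prob_space_std_normal)
  show "(\<integral>x. (\<Prod>i\<in>I. g i (x i)) \<partial>gauss_space I) = (\<Prod>i\<in>I. \<integral>x. g i x \<partial>std_normal_distribution)"
    by (rule product_integral_prod[OF assms])
  show "integrable (gauss_space I) (\<lambda>x. \<Prod>i\<in>I. g i (x i))"
    by (rule product_integrable_prod[OF assms])
qed

lemma gauss_fam_gauss_space:
  assumes "finite I"
  shows "gauss_fam (gauss_space I) I (\<lambda>i x. x i) (\<lambda>i j. of_bool (i = j))"
  unfolding gauss_fam_def
proof (intro conjI ballI allI)
  show "prob_space (gauss_space I)" by (rule prob_space_gauss_space)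
  show "(\<lambda>x. x i) \<in> borel_measurable (gauss_space I)" if "i \<in> I" for i
    using that by (rule measurable_gauss_space_coord)
  interpret N: prob_space std_normal_distribution by (rule prob_space_std_normal)
  fix t :: "'a \<Rightarrow> real"
  have "(CLINT x|gauss_space I. iexp (\<Sum>j\<in>I. t j * x j)) = (CLINT x|gauss_space I. (\<Prod>j\<in>I. iexp (t j * x j)))"
    using assms by (simp add: exp_sum sum_distrib_left)
  also have "\<dots> = (\<Prod>j\<in>I. CLINT x|std_normal_distribution. iexp (t j * x))"
    using assms by (intro gauss_space_integral_prod N.integrable_iexp) auto
  also have "\<dots> = (\<Prod>j\<in>I. complex_of_real (exp (- (t j)\<^sup>2 / 2)))"
    using char_std_normal_distribution by (simp add: char_def fun_eq_iff)
  also have "\<dots> = complex_of_real (exp (\<Sum>i\<in>I. - (t i)\<^sup>2 / 2))"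
    using assms by (simp only: exp_sum of_real_prod)
  also have "(\<Sum>i\<in>I. - (t i)\<^sup>2 / 2) = - (\<Sum>i\<in>I. \<Sum>j\<in>I. of_bool (i = j) * t i * t j) / 2"
    unfolding sum_of_bool_Kronecker[OF assms] by (simp add: sum_negf sum_divide_distrib)
  finally show "(CLINT x|gauss_space I. iexp (\<Sum>j\<in>I. t j * x j))
      = complex_of_real (exp (- (\<Sum>i\<in>I. \<Sum>j\<in>I. of_bool (i = j) * t i * t j) / 2))" .
qed (use assms in auto)

lemma gauss_fam_pair:
  assumes Y: "gauss_fam M I Y (\<lambda>i j. of_bool (i = j))" and Z: "gauss_fam N J Z (\<lambda>i j. of_bool (i = j))"
  shows "gauss_fam (M \<Otimes>\<^sub>M N) (I <+> J) (\<lambda>s w. case s of Inl i \<Rightarrow> Y i (fst w) | Inr j \<Rightarrow> Z j (snd w)) (\<lambda>i j. of_bool (i = j))"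
  unfolding gauss_fam_def
proof (intro conjI ballI allI)
  interpret M: prob_space M using Y by (simp add: gauss_fam_def)
  interpret N: prob_space N using Z by (simp add: gauss_fam_def)
  interpret P: pair_prob_space M N ..
  show "prob_space (M \<Otimes>\<^sub>M N)" by (rule P.prob_space_axioms)
  have fin: "finite I" "finite J" using Y Z by (simp_all add: gauss_fam_def)
  thus fin': "finite (I <+> J)" by simp
  have [measurable]: "\<And>i. i \<in> I \<Longrightarrow> Y i \<in> borel_measurable M" "\<And>j. j \<in> J \<Longrightarrow> Z j \<in> borel_measurable N"
    using Y Z by (auto simp: gauss_fam_def)
  show "(\<lambda>w. case s of Inl i \<Rightarrow> Y i (fst w) | Inr j \<Rightarrow> Z j (snd w)) \<in> borel_measurable (M \<Otimes>\<^sub>M N)"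
    if "s \<in> I <+> J" for s
    using that by (auto intro: measurable_compose[OF measurable_fst] measurable_compose[OF measurable_snd])
  fix t :: "'b + 'd \<Rightarrow> real"
  define p where "p \<omega> = iexp (\<Sum>i\<in>I. t (Inl i) * Y i \<omega>)" for \<omega>
  define q where "q \<omega> = iexp (\<Sum>j\<in>J. t (Inr j) * Z j \<omega>)" for \<omega>
  have [measurable]: "p \<in> borel_measurable M" "q \<in> borel_measurable N"
    unfolding p_def q_def by measurable
  have int: "integrable (M \<Otimes>\<^sub>M N) (\<lambda>w. p (fst w) * q (snd w))"
    by (rule P.integrable_const_bound[where B = 1]) (auto simp: norm_mult p_def q_def simp del: of_real_sum)
  have "(CLINT w|M \<Otimes>\<^sub>M N. iexp (\<Sum>s\<in>I <+> J. t s * (case s of Inl i \<Rightarrow> Y i (fst w) | Inr j \<Rightarrow> Z j (snd w))))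
      = (CLINT w|M \<Otimes>\<^sub>M N. p (fst w) * q (snd w))"
  proof (intro Bochner_Integration.integral_cong refl)
    fix w
    have "(\<Sum>s\<in>I <+> J. t s * (case s of Inl i \<Rightarrow> Y i (fst w) | Inr j \<Rightarrow> Z j (snd w)))
        = (\<Sum>i\<in>I. t (Inl i) * Y i (fst w)) + (\<Sum>j\<in>J. t (Inr j) * Z j (snd w))"
      using fin by (simp add: sum.Plus)
    thus "iexp (\<Sum>s\<in>I <+> J. t s * (case s of Inl i \<Rightarrow> Y i (fst w) | Inr j \<Rightarrow> Z j (snd w)))
        = p (fst w) * q (snd w)"
      by (simp only: p_def q_def exp_add[symmetric] of_real_add distrib_left)
  qed
  also have "\<dots> = (CLINT \<omega>|M. CLINT \<omega>'|N. p \<omega> * q \<omega>')"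
    using P.integral_fst'[OF int] by simp
  also have "\<dots> = (CLINT \<omega>|M. p \<omega>) * (CLINT \<omega>'|N. q \<omega>')" by simp
  also have "\<dots> = complex_of_real (exp (- (\<Sum>i\<in>I. \<Sum>j\<in>I. of_bool (i = j) * t (Inl i) * t (Inl j)) / 2))
       * complex_of_real (exp (- (\<Sum>i\<in>J. \<Sum>j\<in>J. of_bool (i = j) * t (Inr i) * t (Inr j)) / 2))"
  proof -
    have "(CLINT \<omega>|M. p \<omega>) = complex_of_real (exp (- (\<Sum>i\<in>I. \<Sum>j\<in>I. of_bool (i = j) * t (Inl i) * t (Inl j)) / 2))"
      using Y unfolding gauss_fam_def p_def by (elim conjE allE[of _ "\<lambda>i. t (Inl i)"])
    moreover have "(CLINT \<omega>|N. q \<omega>) = complex_of_real (exp (- (\<Sum>i\<in>J. \<Sum>j\<in>J. of_bool (i = j) * t (Inr i) * t (Inr j)) / 2))"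
      using Z unfolding gauss_fam_def q_def by (elim conjE allE[of _ "\<lambda>i. t (Inr i)"])
    ultimately show ?thesis by simp
  qed
  also have "\<dots> = complex_of_real (exp (- (\<Sum>i\<in>I <+> J. \<Sum>j\<in>I <+> J. of_bool (i = j) * t i * t j) / 2))"
  proof -
    note K = sum_of_bool_Kronecker[OF fin(1), of "\<lambda>i. t (Inl i)"]
      sum_of_bool_Kronecker[OF fin(2), of "\<lambda>i. t (Inr i)"] sum_of_bool_Kronecker[OF fin', of t]
    have "(\<Sum>i\<in>I <+> J. (t i)\<^sup>2) = (\<Sum>i\<in>I. (t (Inl i))\<^sup>2) + (\<Sum>j\<in>J. (t (Inr j))\<^sup>2)"
      using fin by (simp add: sum.Plus)
    hence "- (\<Sum>i\<in>I <+> J. (t i)\<^sup>2) / 2 = - (\<Sum>i\<in>I. (t (Inl i))\<^sup>2) / 2 + - (\<Sum>j\<in>J. (t (Inr j))\<^sup>2) / 2"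
      by (simp add: field_simps)
    thus ?thesis unfolding K by (simp only: exp_add of_real_mult)
  qed
  finally show "(CLINT w|M \<Otimes>\<^sub>M N. iexp (\<Sum>s\<in>I <+> J. t s * (case s of Inl i \<Rightarrow> Y i (fst w) | Inr j \<Rightarrow> Z j (snd w))))
      = complex_of_real (exp (- (\<Sum>i\<in>I <+> J. \<Sum>j\<in>I <+> J. of_bool (i = j) * t i * t j) / 2))" .
qed

lemma gauss_fam_white_linear:
  assumes g: "gauss_fam M J Y (\<lambda>i j. of_bool (i = j))" and J': "finite J'"
  shows "gauss_fam M J' (\<lambda>i \<omega>. \<Sum>j\<in>J. L i j * Y j \<omega>) (\<lambda>i i'. \<Sum>j\<in>J. L i j * L i' j)"
proof (rule gauss_fam_linear[OF g J'])
  have fin: "finite J" using g by (simp add: gauss_fam_def)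
  fix i i'
  show "(\<Sum>j\<in>J. L i j * L i' j) = (\<Sum>j\<in>J. \<Sum>j'\<in>J. L i j * L i' j' * of_bool (j = j'))"
  proof (intro sum.cong refl)
    fix j assume "j \<in> J"
    have "(\<Sum>j'\<in>J. L i j * L i' j' * of_bool (j = j')) = (\<Sum>j'\<in>J. if j = j' then L i j * L i' j' else 0)"
      by (intro sum.cong refl) auto
    thus "L i j * L i' j = (\<Sum>j'\<in>J. L i j * L i' j' * of_bool (j = j'))" using fin \<open>j \<in> J\<close> by simp
  qed
qed

abbreviation sq :: "nat \<Rightarrow> (nat \<times> nat) set" where
  "sq n \<equiv> {..<n} \<times> {..<n}"

text \<open>
The functional of the law to which uniqueness is applied. The deterministic part \<open>B\<close> is
kept apart because the partially tridiagonalised matrices have one.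
\<close>

lemma gauss_fam_spec_sum_eq:
  assumes Y: "gauss_fam M (sq n) (\<lambda>p \<omega>. Y \<omega> (fst p) (snd p)) K"
    and Y': "gauss_fam N (sq n) (\<lambda>p \<omega>. Y' \<omega> (fst p) (snd p)) K'"
    and K: "\<And>i j k l. i < n \<Longrightarrow> j < n \<Longrightarrow> k < n \<Longrightarrow> l < n \<Longrightarrow> K (i, j) (k, l) = K' (i, j) (k, l)"
    and sym: "\<And>\<omega>. sym_on n (Y \<omega>)" "\<And>\<omega>. sym_on n (Y' \<omega>)" "sym_on n B"
    and f: "L-lipschitz_on UNIV f"
  shows "(\<integral>\<omega>. spec_sum n f (\<lambda>i j. B i j + \<kappa> * Y \<omega> i j) \<partial>M) = (\<integral>\<omega>. spec_sum n f (\<lambda>i j. B i j + \<kappa> * Y' \<omega> i j) \<partial>N)"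
proof -
  define \<Phi> where "\<Phi> y = spec_sum n f (\<lambda>i j. B i j + \<kappa> * ((y (i, j) + y (j, i)) / 2))" for y :: "nat \<times> nat \<Rightarrow> real"
  have meas: "\<Phi> \<in> borel_measurable (PiM (sq n) (\<lambda>_. borel))"
    unfolding \<Phi>_def
  proof (rule spec_sum_measurable[OF _ _ f])
    show "(\<lambda>y. B i j + \<kappa> * ((y (i, j) + y (j, i)) / 2)) \<in> borel_measurable (PiM (sq n) (\<lambda>_. borel))"
      if "i < n" "j < n" for i j
    proof -
      have "(\<lambda>y. y p) \<in> borel_measurable (PiM (sq n) (\<lambda>_. borel :: real measure))" if "p \<in> sq n" for p
        using measurable_component_singleton[OF that, of "\<lambda>_. borel :: real measure"] by simp
      from this[of "(i, j)"] this[of "(j, i)"] that show ?thesis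
        by (intro borel_measurable_add borel_measurable_times borel_measurable_divide borel_measurable_const) auto
    qed
    show "sym_on n (\<lambda>i j. B i j + \<kappa> * ((y (i, j) + y (j, i)) / 2))" for y :: "nat \<times> nat \<Rightarrow> real"
      using sym(3) by (simp add: sym_on_def add.commute)
  qed
  have mY: "(\<lambda>\<omega>. \<lambda>p\<in>sq n. Y \<omega> (fst p) (snd p)) \<in> M \<rightarrow>\<^sub>M PiM (sq n) (\<lambda>_. borel)"
    using Y by (auto simp: gauss_fam_def intro!: measurable_restrict)
  have mY': "(\<lambda>\<omega>. \<lambda>p\<in>sq n. Y' \<omega> (fst p) (snd p)) \<in> N \<rightarrow>\<^sub>M PiM (sq n) (\<lambda>_. borel)"
    using Y' by (auto simp: gauss_fam_def intro!: measurable_restrict)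
  have eq: "distr M (PiM (sq n) (\<lambda>_. borel)) (\<lambda>\<omega>. \<lambda>p\<in>sq n. Y \<omega> (fst p) (snd p))
      = distr N (PiM (sq n) (\<lambda>_. borel)) (\<lambda>\<omega>. \<lambda>p\<in>sq n. Y' \<omega> (fst p) (snd p))"
    by (rule gauss_fam_unique[OF Y Y']) (use K in auto)
  have "spec_sum n f (\<lambda>i j. B i j + \<kappa> * Y \<omega> i j) = \<Phi> (\<lambda>p\<in>sq n. Y \<omega> (fst p) (snd p))" for \<omega>
    unfolding \<Phi>_def using sym(1)[of \<omega>] by (intro spec_sum_cong) (simp add: sym_on_def)
  moreover have "spec_sum n f (\<lambda>i j. B i j + \<kappa> * Y' \<omega> i j) = \<Phi> (\<lambda>p\<in>sq n. Y' \<omega> (fst p) (snd p))" for \<omega>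
    unfolding \<Phi>_def using sym(2)[of \<omega>] by (intro spec_sum_cong) (simp add: sym_on_def)
  ultimately show ?thesis
    using arg_cong[OF eq, of "\<lambda>D. integral\<^sup>L D \<Phi>"] by (simp add: integral_distr[OF mY meas] integral_distr[OF mY' meas])
qed

text \<open>
White noise is the family with covariance \<open>of_bool (i = j)\<close>. This is the form in which all matrix
models below are introduced: the coefficients \<open>L\<close> are exhibited, and the covariance is computed from them.
\<close>

lemma gauss_fam_white_linearI:
  assumes g: "gauss_fam M J Y (\<lambda>i j. of_bool (i = j))" and J': "finite J'"
    and Y': "\<And>i \<omega>. i \<in> J' \<Longrightarrow> Y' i \<omega> = (\<Sum>j\<in>J. L i j * Y j \<omega>)"
    and K': "\<And>i i'. i \<in> J' \<Longrightarrow> i' \<in> J' \<Longrightarrow> K' i i' = (\<Sum>j\<in>J. L i j * L i' j)"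
  shows "gauss_fam M J' Y' K'"
proof -
  have e: "(\<Sum>i\<in>J'. t i * Y' i \<omega>) = (\<Sum>i\<in>J'. t i * (\<Sum>j\<in>J. L i j * Y j \<omega>))" for t \<omega>
    by (intro sum.cong refl) (simp add: Y')
  have k: "(\<Sum>i\<in>J'. \<Sum>j\<in>J'. K' i j * t i * t j)
      = (\<Sum>i\<in>J'. \<Sum>i'\<in>J'. (\<Sum>j\<in>J. L i j * L i' j) * t i * t i')" for t
    by (intro sum.cong refl) (simp add: K')
  have "(\<lambda>\<omega>. \<Sum>j\<in>J. L i j * Y j \<omega>) = Y' i" if "i \<in> J'" for i
    using Y'[OF that] by auto
  thus ?thesis
    using gauss_fam_white_linear[OF g J', of L] unfolding gauss_fam_def e k by simp
qed

section \<open>Row-by-row tridiagonalisation of the Gaussian orthogonal ensemble\<close>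

lemma sum_of_bool_finite:
  fixes g :: "'i \<Rightarrow> real"
  assumes "finite A" "a \<in> A"
  shows "(\<Sum>q\<in>A. of_bool (a = q) * g q) = g a"
proof -
  have "(\<Sum>q\<in>A. of_bool (a = q) * g q) = (\<Sum>q\<in>A. if a = q then g q else 0)"
    by (intro sum.cong) auto
  thus ?thesis using assms by simp
qed

text \<open>
For white noise \<open>x\<close> this is the Gaussian orthogonal ensemble, with variance 1 off the diagonal and 2 on it.
\<close>

definition symm :: "(nat \<times> nat \<Rightarrow> real) \<Rightarrow> nat \<Rightarrow> nat \<Rightarrow> real" where
  "symm x i j = (x (i, j) + x (j, i)) / sqrt 2"

lemma symm_sym: "symm x i j = symm x j i"
  by (simp add: symm_def add.commute)

text \<open>
The covariance of the entries \<open>(i, j)\<close> and \<open>(k, l)\<close> of the Gaussian orthogonal ensemble.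
\<close>

definition goe_cov :: "nat \<Rightarrow> nat \<Rightarrow> nat \<Rightarrow> nat \<Rightarrow> real" where
  "goe_cov i j k l = of_bool (i = k \<and> j = l) + of_bool (i = l \<and> j = k)"

definition sym_delta :: "nat \<Rightarrow> nat \<Rightarrow> nat \<times> nat \<Rightarrow> real" where
  "sym_delta i j q = (of_bool ((i, j) = q) + of_bool ((j, i) = q)) / sqrt 2"

lemma sum_sym_delta:
  assumes "i < n" "j < n"
  shows "(\<Sum>q\<in>sq n. sym_delta i j q * g q) = symm g i j"
proof -
  have "(\<Sum>q\<in>sq n. sym_delta i j q * g q)
      = ((\<Sum>q\<in>sq n. of_bool ((i, j) = q) * g q) + (\<Sum>q\<in>sq n. of_bool ((j, i) = q) * g q)) / sqrt 2"
    by (simp only: sym_delta_def times_divide_eq_left distrib_right sum_divide_distrib[symmetric] sum.distrib)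
  thus ?thesis using assms by (simp add: sum_of_bool_finite symm_def)
qed

lemma sym_delta_cov:
  assumes "i < n" "j < n"
  shows "(\<Sum>q\<in>sq n. sym_delta i j q * sym_delta k l q) = goe_cov i j k l"
proof -
  have s: "((A + B) / sqrt 2 + (B + A) / sqrt 2) / sqrt 2 = A + B" for A B :: real
    by (simp add: add_divide_distrib)
  have e: "((k, l) = (i, j)) = (i = k \<and> j = l)" "((l, k) = (i, j)) = (i = l \<and> j = k)"
    "((k, l) = (j, i)) = (i = l \<and> j = k)" "((l, k) = (j, i)) = (i = k \<and> j = l)" by auto
  show ?thesis
    unfolding sum_sym_delta[OF assms] unfolding symm_def sym_delta_def goe_cov_def e by (rule s)
qed

lemma gauss_fam_symm:
  assumes X: "gauss_fam M (sq n) X (\<lambda>i j. of_bool (i = j))"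
  shows "gauss_fam M (sq n) (\<lambda>p \<omega>. of_bool (Q (fst p) (snd p)) * symm (\<lambda>q. X q \<omega>) (fst p) (snd p))
    (\<lambda>p q. of_bool (Q (fst p) (snd p) \<and> Q (fst q) (snd q)) * goe_cov (fst p) (snd p) (fst q) (snd q))"
proof (rule gauss_fam_white_linearI[OF X, where L = "\<lambda>p q. of_bool (Q (fst p) (snd p)) * sym_delta (fst p) (snd p) q"])
  show "of_bool (Q (fst p) (snd p)) * symm (\<lambda>q. X q \<omega>) (fst p) (snd p)
      = (\<Sum>q\<in>sq n. of_bool (Q (fst p) (snd p)) * sym_delta (fst p) (snd p) q * X q \<omega>)"
    if "p \<in> sq n" for p \<omega>
    using that sum_sym_delta[of "fst p" n "snd p" "\<lambda>q. X q \<omega>"]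
    by (auto simp: mult.assoc simp flip: sum_distrib_left)
  show "of_bool (Q (fst p) (snd p) \<and> Q (fst q) (snd q)) * goe_cov (fst p) (snd p) (fst q) (snd q)
      = (\<Sum>j\<in>sq n. of_bool (Q (fst p) (snd p)) * sym_delta (fst p) (snd p) j
           * (of_bool (Q (fst q) (snd q)) * sym_delta (fst q) (snd q) j))"
    if "p \<in> sq n" "q \<in> sq n" for p q
  proof -
    have "(\<Sum>j\<in>sq n. of_bool (Q (fst p) (snd p)) * sym_delta (fst p) (snd p) j
           * (of_bool (Q (fst q) (snd q)) * sym_delta (fst q) (snd q) j))
        = of_bool (Q (fst p) (snd p) \<and> Q (fst q) (snd q)) * (\<Sum>j\<in>sq n. sym_delta (fst p) (snd p) j * sym_delta (fst q) (snd q) j)"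
      unfolding sum_distrib_left by (intro sum.cong refl) simp
    thus ?thesis using that sym_delta_cov[of "fst p" n "snd p" "fst q" "snd q"] by auto
  qed
qed simp

text \<open>
The matrix \<open>R x R\<^sup>T\<close>. It is white noise again if \<open>x\<close> is and \<open>R\<close> is orthogonal.
\<close>

definition rot :: "nat \<Rightarrow> (nat \<Rightarrow> nat \<Rightarrow> real) \<Rightarrow> (nat \<times> nat \<Rightarrow> real) \<Rightarrow> nat \<times> nat \<Rightarrow> real" where
  "rot n R x p = (\<Sum>k<n. \<Sum>l<n. R (fst p) k * x (k, l) * R (snd p) l)"

lemma gauss_fam_rot:
  assumes X: "gauss_fam M (sq n) X (\<lambda>i j. of_bool (i = j))" and R: "orth_on n R"
  shows "gauss_fam M (sq n) (\<lambda>p \<omega>. rot n R (\<lambda>q. X q \<omega>) p) (\<lambda>i j. of_bool (i = j))"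
proof (rule gauss_fam_white_linearI[OF X, where L = "\<lambda>p q. R (fst p) (fst q) * R (snd p) (snd q)"])
  show "rot n R (\<lambda>q. X q \<omega>) p = (\<Sum>q\<in>sq n. R (fst p) (fst q) * R (snd p) (snd q) * X q \<omega>)" for p \<omega>
    unfolding rot_def by (simp add: sum.cartesian_product case_prod_beta ac_simps)
  show "of_bool (p = q) = (\<Sum>j\<in>sq n. R (fst p) (fst j) * R (snd p) (snd j) * (R (fst q) (fst j) * R (snd q) (snd j)))"
    if "p \<in> sq n" "q \<in> sq n" for p q
  proof -
    have "(\<Sum>j\<in>sq n. R (fst p) (fst j) * R (snd p) (snd j) * (R (fst q) (fst j) * R (snd q) (snd j)))
        = (\<Sum>k<n. \<Sum>l<n. (R (fst p) k * R (fst q) k) * (R (snd p) l * R (snd q) l))"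
      by (simp add: sum.cartesian_product case_prod_beta ac_simps)
    also have "\<dots> = (\<Sum>k<n. R (fst p) k * R (fst q) k) * (\<Sum>l<n. R (snd p) l * R (snd q) l)"
      by (rule sum_product[symmetric])
    also have "\<dots> = of_bool (fst p = fst q) * of_bool (snd p = snd q)"
      using R that by (auto simp: orth_on_def)
    finally show ?thesis by (simp add: prod_eq_iff)
  qed
qed simp

text \<open>
The first \<open>p\<close> rows and columns are already tridiagonal with constant coefficient \<open>a\<close>, which includes the link
between the indices \<open>p - 1\<close> and \<open>p\<close>; the remaining block is Gaussian.
\<close>

definition hybrid :: "nat \<Rightarrow> real \<Rightarrow> (nat \<times> nat \<Rightarrow> real) \<Rightarrow> nat \<Rightarrow> nat \<Rightarrow> real" where
  "hybrid p a x i j = (if p \<le> i \<and> p \<le> j then symm x i j else tridiag a i j)"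

text \<open>
The hybrid matrix with its first random row, number \<open>p\<close>, driven by a separate noise \<open>y\<close>. This makes it
possible to condition on this row by Fubini's theorem.
\<close>

definition arrow :: "nat \<Rightarrow> real \<Rightarrow> (nat \<Rightarrow> real) \<Rightarrow> (nat \<times> nat \<Rightarrow> real) \<Rightarrow> nat \<Rightarrow> nat \<Rightarrow> real" where
  "arrow p a y x i j =
     (if p < i \<and> p < j then symm x i j
      else if i = p \<and> j = p then sqrt 2 * y p
      else if i = p \<and> p < j then y j
      else if j = p \<and> p < i then y i
      else tridiag a i j)"

lemma tridiag_sym: "tridiag a i j = tridiag a j i"
  by (auto simp: tridiag_def)

lemma hybrid_sym: "hybrid p a x i j = hybrid p a x j i"
  by (auto simp: hybrid_def intro: symm_sym tridiag_sym)

lemma arrow_sym: "arrow p a y x i j = arrow p a y x j i"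
  by (auto simp: arrow_def intro: symm_sym tridiag_sym)

text \<open>
The reflection takes the part of row \<open>p\<close> to the right of the diagonal to a multiple of basis vector \<open>Suc p\<close>.
It fixes all basis vectors up to \<open>p\<close>, so the rows that are tridiagonal already are not changed, and on the
remaining block it acts by a rotation.
\<close>

lemma arrow_rotate:
  fixes y :: "nat \<Rightarrow> real" and n p :: nat
  defines "av \<equiv> \<lambda>j. if p < j then y j else 0"
  defines "nb \<equiv> sqrt (\<Sum>k<n. (av k)\<^sup>2)"
  defines "bv \<equiv> \<lambda>j. if j = Suc p then nb else 0"
  defines "R \<equiv> householder n (\<lambda>k. av k - bv k)"
  assumes p: "Suc p < n" and ij: "i < n" "j < n"
  shows "(\<Sum>k<n. \<Sum>l<n. R i k * arrow p a y x k l * R j l)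
    = arrow p a (\<lambda>j. if p < j then bv j else y j) (rot n R x) i j"
proof -
  let ?y' = "\<lambda>j. if p < j then bv j else y j"
  define T where "T i j = (\<Sum>k<n. \<Sum>l<n. R i k * arrow p a y x k l * R j l)" for i j
  have low: "R i k = of_bool (i = k)" if "i \<le> p \<or> k \<le> p" for i k
    unfolding R_def using that by (intro householder_trivial) (auto simp: av_def bv_def)
  have Tsym: "T i j = T j i" for i j
    unfolding T_def by (subst sum.swap) (simp add: arrow_sym[of p a y x] ac_simps)
  have norm: "(\<Sum>k<n. (av k)\<^sup>2) = (\<Sum>k<n. (bv k)\<^sup>2)"
  proof -
    have "(\<Sum>k<n. (bv k)\<^sup>2) = (\<Sum>k<n. if k = Suc p then nb\<^sup>2 else 0)"
      by (intro sum.cong) (auto simp: bv_def)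
    thus ?thesis using p by (simp add: nb_def sum_nonneg)
  qed
  have Rav: "(\<Sum>k<n. R i k * av k) = bv i" if "i < n" for i
    unfolding R_def by (rule householder_maps[OF norm that])
  have case_low: "T i j = arrow p a ?y' (rot n R x) i j" if "i \<le> p" "j < n" "i < n" for i j
  proof -
    have "T i j = (\<Sum>k<n. of_bool (i = k) * (\<Sum>l<n. arrow p a y x k l * R j l))"
      unfolding T_def using that by (simp add: low sum_distrib_left mult.assoc)
    also have "\<dots> = (\<Sum>l<n. arrow p a y x i l * R j l)" using that by (simp only: sum_of_bool_eq)
    finally have T: "T i j = (\<Sum>l<n. arrow p a y x i l * R j l)" .
    show ?thesis
    proof (cases "j \<le> p")
      case True
      hence "T i j = (\<Sum>l<n. arrow p a y x i l * of_bool (j = l))" unfolding T by (simp add: low)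
      also have "\<dots> = arrow p a y x i j" using that by (simp only: sum_of_bool_eq)
      finally show ?thesis using True that by (auto simp: arrow_def)
    next
      case False
      show ?thesis
      proof (cases "i = p")
        case True
        have "T i j = (\<Sum>l<n. R j l * av l)"
          unfolding T using True False by (intro sum.cong refl) (auto simp: arrow_def av_def low)
        thus ?thesis using Rav[of j] True False that by (simp add: arrow_def)
      next
        case neq: False
        have "T i j = (\<Sum>l<n. 0)"
          unfolding T using neq False that
          by (intro sum.cong refl) (auto simp: arrow_def low tridiag_def)
        thus ?thesis using neq False that by (auto simp: arrow_def tridiag_def)
      qed
    qed
  qed
  consider "i \<le> p" | "j \<le> p" | "p < i" "p < j" by linarith
  thus ?thesis
  proof cases
    case 1
    thus ?thesis using case_low[of i j] ij by (simp add: T_def)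
  next
    case 2
    thus ?thesis using case_low[of j i] ij Tsym[of i j] by (simp add: T_def arrow_sym[of p a ?y' _ i j])
  next
    case 3
    have "T i j = (\<Sum>k<n. \<Sum>l<n. R i k * symm x k l * R j l)"
      unfolding T_def
    proof (intro sum.cong refl)
      fix k l
      show "R i k * arrow p a y x k l * R j l = R i k * symm x k l * R j l"
        using 3 by (cases "k \<le> p"; cases "l \<le> p") (auto simp: low arrow_def)
    qed
    also have "\<dots> = ((\<Sum>k<n. \<Sum>l<n. R i k * x (k, l) * R j l) + (\<Sum>k<n. \<Sum>l<n. R i k * x (l, k) * R j l)) / sqrt 2"
      by (simp add: symm_def add_divide_distrib distrib_left distrib_right sum.distrib sum_divide_distrib)
    also have "(\<Sum>k<n. \<Sum>l<n. R i k * x (l, k) * R j l) = (\<Sum>k<n. \<Sum>l<n. R j k * x (k, l) * R i l)"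
      by (subst sum.swap) (simp add: ac_simps)
    finally show ?thesis using 3 by (simp add: T_def arrow_def symm_def rot_def)
  qed
qed

text \<open>
The coefficient of \<open>y (max i j)\<close> in entry \<open>(i, j)\<close> of the matrix \<open>arrow p a y x\<close>.
\<close>

definition arrow_coeff :: "nat \<Rightarrow> nat \<Rightarrow> nat \<Rightarrow> real" where
  "arrow_coeff p i j = (if min i j = p then (if i = j then sqrt 2 else 1) else 0)"

text \<open>
Both matrices have the same deterministic part, and their random parts have the same covariance.
\<close>

lemma hybrid_arrow_mean:
  assumes f: "L-lipschitz_on UNIV f" and p: "p < n"
  shows "(\<integral>x. spec_sum n f (\<lambda>i j. \<kappa> * hybrid p a x i j) \<partial>gauss_space (sq n))
    = (\<integral>w. spec_sum n f (\<lambda>i j. \<kappa> * arrow p a (fst w) (snd w) i j) \<partial>(gauss_space {..<n} \<Otimes>\<^sub>M gauss_space (sq n)))"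
proof -
  let ?N = "gauss_space {..<n} \<Otimes>\<^sub>M gauss_space (sq n)"
  define Q where "Q i j \<longleftrightarrow> p \<le> i \<and> p \<le> j" for i j :: nat
  define Y where "Y x i j = of_bool (Q i j) * symm x i j" for x i j
  define Y' where "Y' w i j = arrow_coeff p i j * fst w (max i j) + of_bool (p < i \<and> p < j) * symm (snd w) i j"
    for w :: "(nat \<Rightarrow> real) \<times> (nat \<times> nat \<Rightarrow> real)" and i j
  define B where "B i j = \<kappa> * (of_bool (\<not> Q i j) * tridiag a i j)" for i j
  have gx: "gauss_fam (gauss_space (sq n)) (sq n) (\<lambda>q x. x q) (\<lambda>i j. of_bool (i = j))"
    by (rule gauss_fam_gauss_space) simp
  have gy: "gauss_fam (gauss_space {..<n}) {..<n} (\<lambda>q x. x q) (\<lambda>i j. of_bool (i = j))"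
    by (rule gauss_fam_gauss_space) simp
  define K where "K p q = of_bool (Q (fst p) (snd p) \<and> Q (fst q) (snd q)) * goe_cov (fst p) (snd p) (fst q) (snd q)" for p q
  have fam1: "gauss_fam (gauss_space (sq n)) (sq n) (\<lambda>q x. Y x (fst q) (snd q)) K"
    unfolding Y_def K_def by (rule gauss_fam_symm[OF gx])
  have fam2: "gauss_fam ?N (sq n) (\<lambda>q w. Y' w (fst q) (snd q)) K"
  proof (rule gauss_fam_white_linearI[OF gauss_fam_pair[OF gy gx],
      where L = "\<lambda>q s. case s of Inl k \<Rightarrow> arrow_coeff p (fst q) (snd q) * of_bool (max (fst q) (snd q) = k)
                  | Inr u \<Rightarrow> of_bool (p < fst q \<and> p < snd q) * sym_delta (fst q) (snd q) u"])
    fix q and w :: "(nat \<Rightarrow> real) \<times> (nat \<times> nat \<Rightarrow> real)" assume q: "q \<in> sq n"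
    obtain i j where ij: "q = (i, j)" "i < n" "j < n" using q by auto
    have "(\<Sum>k<n. of_bool (max i j = k) * fst w k) = fst w (max i j)"
      using ij by (intro sum_of_bool_finite[of _ "max i j" "fst w"]) auto
    thus "Y' w (fst q) (snd q) = (\<Sum>s\<in>{..<n} <+> sq n. (case s of Inl k \<Rightarrow> arrow_coeff p (fst q) (snd q) * of_bool (max (fst q) (snd q) = k)
                  | Inr u \<Rightarrow> of_bool (p < fst q \<and> p < snd q) * sym_delta (fst q) (snd q) u) *
            (case s of Inl i \<Rightarrow> fst w i | Inr j \<Rightarrow> snd w j))"
      using sum_sym_delta[OF ij(2,3), of "snd w"] ij
      by (simp add: sum.Plus Y'_def mult.assoc comp_def flip: sum_distrib_left)
  next
    fix q q' assume q: "q \<in> sq n" "q' \<in> sq n"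
    obtain i j k l where ij: "q = (i, j)" "i < n" "j < n" "q' = (k, l)" "k < n" "l < n" using q by auto
    have 1: "(\<Sum>m<n. arrow_coeff p i j * of_bool (max i j = m) * (arrow_coeff p k l * of_bool (max k l = m)))
        = arrow_coeff p i j * arrow_coeff p k l * of_bool (max k l = max i j)"
    proof -
      have "(\<Sum>m<n. arrow_coeff p i j * of_bool (max i j = m) * (arrow_coeff p k l * of_bool (max k l = m)))
          = arrow_coeff p i j * arrow_coeff p k l * (\<Sum>m<n. of_bool (max i j = m) * of_bool (max k l = m))"
        unfolding sum_distrib_left by (intro sum.cong refl) (simp only: ac_simps)
      also have "(\<Sum>m<n. of_bool (max i j = m) * of_bool (max k l = m)) = (of_bool (max k l = max i j) :: real)"
        using ij by (intro sum_of_bool_finite[of _ "max i j" "\<lambda>m. of_bool (max k l = m)"]) auto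
      finally show ?thesis .
    qed
    have 2: "(\<Sum>u\<in>sq n. of_bool (p < i \<and> p < j) * sym_delta i j u * (of_bool (p < k \<and> p < l) * sym_delta k l u))
        = of_bool (p < i \<and> p < j \<and> p < k \<and> p < l) * goe_cov i j k l"
      unfolding sym_delta_cov[OF ij(2,3), of k l, symmetric] sum_distrib_left
      by (intro sum.cong refl) simp
    have 3: "K (i, j) (k, l) = arrow_coeff p i j * arrow_coeff p k l * of_bool (max k l = max i j)
        + of_bool (p < i \<and> p < j \<and> p < k \<and> p < l) * goe_cov i j k l"
      by (auto simp: K_def Q_def arrow_coeff_def goe_cov_def min_def max_def)
    show "K q q' = (\<Sum>s\<in>{..<n} <+> sq n. (case s of Inl k \<Rightarrow> arrow_coeff p (fst q) (snd q) * of_bool (max (fst q) (snd q) = k)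
                  | Inr u \<Rightarrow> of_bool (p < fst q \<and> p < snd q) * sym_delta (fst q) (snd q) u) *
            (case s of Inl k \<Rightarrow> arrow_coeff p (fst q') (snd q') * of_bool (max (fst q') (snd q') = k)
                  | Inr u \<Rightarrow> of_bool (p < fst q' \<and> p < snd q') * sym_delta (fst q') (snd q') u))"
      using ij 3 by (simp only: sum.Plus finite_lessThan finite_cartesian_product comp_def sum.case fst_conv snd_conv 1 2)
  qed simp
  have h1: "\<kappa> * hybrid p a x i j = B i j + \<kappa> * Y x i j" for x i j
    by (simp add: hybrid_def B_def Y_def Q_def)
  have h2: "\<kappa> * arrow p a (fst w) (snd w) i j = B i j + \<kappa> * Y' w i j" for w i j
    by (auto simp: arrow_def B_def Y'_def Q_def arrow_coeff_def min_def max_def)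
  show ?thesis unfolding h1 h2
  proof (rule gauss_fam_spec_sum_eq[OF fam1 fam2 refl _ _ _ f])
    show "sym_on n (Y x)" for x by (auto simp: sym_on_def Y_def Q_def symm_sym)
    show "sym_on n (Y' w)" for w
      by (auto simp: sym_on_def Y'_def arrow_coeff_def min.commute max.commute intro: symm_sym)
    show "sym_on n B" by (auto simp: sym_on_def B_def Q_def tridiag_sym)
  qed
qed

lemma std_normal_sq_moments:
  "integrable std_normal_distribution (\<lambda>x. x\<^sup>2 - 1)" "(\<integral>x. x\<^sup>2 - 1 \<partial>std_normal_distribution) = 0"
  "integrable std_normal_distribution (\<lambda>x. (x\<^sup>2 - 1)\<^sup>2)" "(\<integral>x. (x\<^sup>2 - 1)\<^sup>2 \<partial>std_normal_distribution) = 2"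
proof -
  interpret N: prob_space std_normal_distribution by (rule prob_space_std_normal)
  have i: "integrable std_normal_distribution (\<lambda>x. x ^ 2)" "integrable std_normal_distribution (\<lambda>x. x ^ 4)"
    by (rule integrable_std_normal_distribution_moment)+
  have m: "(\<integral>x. x ^ 2 \<partial>std_normal_distribution) = 1" "(\<integral>x. x ^ 4 \<partial>std_normal_distribution) = 3"
    using std_normal_distribution_even_moments(1)[of 1] std_normal_distribution_even_moments(1)[of 2]
    by (simp_all add: fact_numeral)
  show "integrable std_normal_distribution (\<lambda>x. x\<^sup>2 - 1)" using i by simp
  show "(\<integral>x. x\<^sup>2 - 1 \<partial>std_normal_distribution) = 0"
    using i m N.prob_space by (subst Bochner_Integration.integral_diff) auto
  have e: "(x\<^sup>2 - 1)\<^sup>2 = x ^ 4 - 2 * x ^ 2 + (1 :: real)" for x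
    by (simp add: power2_diff flip: power_mult)
  show "integrable std_normal_distribution (\<lambda>x. (x\<^sup>2 - 1)\<^sup>2)" unfolding e using i by simp
  show "(\<integral>x. (x\<^sup>2 - 1)\<^sup>2 \<partial>std_normal_distribution) = 2"
    unfolding e using i m N.prob_space
    by (subst Bochner_Integration.integral_add, simp, simp, subst Bochner_Integration.integral_diff) auto
qed

lemma gauss_space_sq_cov:
  assumes I: "finite I" "i \<in> I" "j \<in> I"
  shows "integrable (gauss_space I) (\<lambda>x. ((x i)\<^sup>2 - 1) * ((x j)\<^sup>2 - 1))"
    "(\<integral>x. ((x i)\<^sup>2 - 1) * ((x j)\<^sup>2 - 1) \<partial>gauss_space I) = (if i = j then 2 else 0)"
proof -
  interpret N: prob_space std_normal_distribution by (rule prob_space_std_normal)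
  define g where "g k x = (if k = i then x\<^sup>2 - 1 else 1) * (if k = j then x\<^sup>2 - 1 else (1 :: real))" for k x
  have int: "integrable std_normal_distribution (g k)" for k
    using std_normal_sq_moments unfolding g_def
    by (cases "k = i"; cases "k = j") (simp_all add: power2_eq_square)
  have e: "(\<Prod>k\<in>I. g k (x k)) = ((x i)\<^sup>2 - 1) * ((x j)\<^sup>2 - 1)" for x
    unfolding g_def prod.distrib using I by simp
  show "integrable (gauss_space I) (\<lambda>x. ((x i)\<^sup>2 - 1) * ((x j)\<^sup>2 - 1))"
    using gauss_space_integral_prod(2)[of I g, OF I(1) int] unfolding e .
  have "(\<integral>x. ((x i)\<^sup>2 - 1) * ((x j)\<^sup>2 - 1) \<partial>gauss_space I) = (\<Prod>k\<in>I. \<integral>x. g k x \<partial>std_normal_distribution)"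
    using gauss_space_integral_prod(1)[of I g, OF I(1) int] unfolding e .
  also have "\<dots> = (if i = j then 2 else 0)"
  proof (cases "i = j")
    case True
    have "(\<integral>x. g k x \<partial>std_normal_distribution) = (if k = i then 2 else 1)" for k
      using std_normal_sq_moments N.prob_space unfolding g_def by (auto simp: True power2_eq_square)
    thus ?thesis using True I by simp
  next
    case False
    have "(\<integral>x. g i x \<partial>std_normal_distribution) = 0"
      using False std_normal_sq_moments unfolding g_def by simp
    thus ?thesis using False I by (auto intro!: prod_zero)
  qed
  finally show "(\<integral>x. ((x i)\<^sup>2 - 1) * ((x j)\<^sup>2 - 1) \<partial>gauss_space I) = (if i = j then 2 else 0)" .
qed

lemma gauss_space_sq_mean:
  assumes I: "finite I" "i \<in> I"
  shows "integrable (gauss_space I) (\<lambda>x. (x i)\<^sup>2)" "(\<integral>x. (x i)\<^sup>2 \<partial>gauss_space I) = 1"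
proof -
  interpret N: prob_space std_normal_distribution by (rule prob_space_std_normal)
  define g where "g k x = (if k = i then x\<^sup>2 else (1 :: real))" for k x
  have i2: "integrable std_normal_distribution (\<lambda>x. x ^ 2)"
    by (rule integrable_std_normal_distribution_moment)
  have m2: "(\<integral>x. x ^ 2 \<partial>std_normal_distribution) = 1"
    using std_normal_distribution_even_moments(1)[of 1] by (simp add: fact_numeral)
  have int: "integrable std_normal_distribution (g k)" for k
    using i2 unfolding g_def by (cases "k = i") simp_all
  have e: "(\<Prod>k\<in>I. g k (x k)) = (x i)\<^sup>2" for x
    unfolding g_def using I by simp
  show "integrable (gauss_space I) (\<lambda>x. (x i)\<^sup>2)"
    using gauss_space_integral_prod(2)[of I g, OF I(1) int] unfolding e .
  have "(\<integral>x. g k x \<partial>std_normal_distribution) = 1" for k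
    using m2 N.prob_space unfolding g_def by (cases "k = i") simp_all
  thus "(\<integral>x. (x i)\<^sup>2 \<partial>gauss_space I) = 1"
    using gauss_space_integral_prod(1)[of I g, OF I(1) int] unfolding e by simp
qed

text \<open>
The variance of a chi-squared variable with \<open>card S\<close> degrees of freedom.
\<close>

lemma gauss_space_chi_square_var:
  assumes I: "finite I" "S \<subseteq> I"
  shows "integrable (gauss_space I) (\<lambda>x. ((\<Sum>i\<in>S. (x i)\<^sup>2) - real (card S))\<^sup>2)"
    "(\<integral>x. ((\<Sum>i\<in>S. (x i)\<^sup>2) - real (card S))\<^sup>2 \<partial>gauss_space I) = 2 * real (card S)"
proof -
  have fS: "finite S" using I finite_subset by auto
  have e: "((\<Sum>i\<in>S. (x i)\<^sup>2) - real (card S))\<^sup>2 = (\<Sum>i\<in>S. \<Sum>j\<in>S. ((x i)\<^sup>2 - 1) * ((x j)\<^sup>2 - 1))" for x :: "'a \<Rightarrow> real"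
  proof -
    have "(\<Sum>i\<in>S. (x i)\<^sup>2) - real (card S) = (\<Sum>i\<in>S. (x i)\<^sup>2 - 1)" by (simp add: sum_subtractf)
    thus ?thesis by (simp only: power2_eq_square[of "sum _ _"] sum_product)
  qed
  note c = gauss_space_sq_cov[OF I(1)]
  have int: "integrable (gauss_space I) (\<lambda>x. ((x i)\<^sup>2 - 1) * ((x j)\<^sup>2 - 1))" if "i \<in> S" "j \<in> S" for i j
    using c(1) that I(2) by blast
  show "integrable (gauss_space I) (\<lambda>x. ((\<Sum>i\<in>S. (x i)\<^sup>2) - real (card S))\<^sup>2)"
    unfolding e using int by (intro Bochner_Integration.integrable_sum)
  have "(\<integral>x. ((\<Sum>i\<in>S. (x i)\<^sup>2) - real (card S))\<^sup>2 \<partial>gauss_space I)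
      = (\<Sum>i\<in>S. \<Sum>j\<in>S. \<integral>x. ((x i)\<^sup>2 - 1) * ((x j)\<^sup>2 - 1) \<partial>gauss_space I)"
    unfolding e using int by (subst Bochner_Integration.integral_sum; (intro Bochner_Integration.integrable_sum sum.cong refl Bochner_Integration.integral_sum)?) auto
  also have "\<dots> = (\<Sum>i\<in>S. \<Sum>j\<in>S. if i = j then 2 else 0)"
    by (intro sum.cong refl c(2)) (use I(2) in auto)
  also have "\<dots> = 2 * real (card S)" using fS by simp
  finally show "(\<integral>x. ((\<Sum>i\<in>S. (x i)\<^sup>2) - real (card S))\<^sup>2 \<partial>gauss_space I) = 2 * real (card S)" .
qed

lemma two_abs_le: "2 * \<bar>z\<bar> \<le> 1 + z\<^sup>2" for z :: real
  using zero_le_power2[of "\<bar>z\<bar> - 1"] by (simp add: power2_diff)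

lemma sqrt2_abs_le: "sqrt 2 * \<bar>z\<bar> \<le> 1 + z\<^sup>2" for z :: real
  using zero_le_power2[of "\<bar>z\<bar> - sqrt 2 / 2"] by (simp add: power2_diff power_divide algebra_simps)

text \<open>
For \<open>q\<close> chi-squared with \<open>m\<close> degrees of freedom the right-hand side has mean 3: the norm of a Gaussian
vector fluctuates by \<open>O(1)\<close> in every dimension.
\<close>

lemma sqrt_diff_le:
  fixes q m :: real
  assumes "q \<ge> 0" "m > 0"
  shows "2 * \<bar>sqrt q - sqrt m\<bar> \<le> 1 + (q - m)\<^sup>2 / m"
proof -
  define u where "u = sqrt q - sqrt m"
  have "\<bar>u\<bar> * sqrt m \<le> \<bar>u\<bar> * (sqrt q + sqrt m)" using assms by (intro mult_left_mono) auto
  also have "\<dots> = \<bar>(sqrt q - sqrt m) * (sqrt q + sqrt m)\<bar>" using assms by (simp add: u_def abs_mult)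
  also have "(sqrt q - sqrt m) * (sqrt q + sqrt m) = q - m"
    using assms by (simp add: algebra_simps)
  finally have "(\<bar>u\<bar> * sqrt m)\<^sup>2 \<le> \<bar>q - m\<bar>\<^sup>2" using assms by (intro power_mono) auto
  hence "u\<^sup>2 * m \<le> (q - m)\<^sup>2" using assms by (simp add: power_mult_distrib)
  hence "u\<^sup>2 \<le> (q - m)\<^sup>2 / m" using assms by (simp add: pos_le_divide_eq)
  thus ?thesis using two_abs_le[of u] by (simp add: u_def)
qed

lemma arrow_measurable:
  assumes f: "L-lipschitz_on UNIV f" and p: "p < n"
  shows "(\<lambda>w. spec_sum n f (\<lambda>i j. \<kappa> * arrow p a (fst w) (snd w) i j))
    \<in> borel_measurable (gauss_space {..<n} \<Otimes>\<^sub>M gauss_space (sq n))"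
proof (rule spec_sum_measurable[OF _ _ f])
  let ?N = "gauss_space {..<n} \<Otimes>\<^sub>M gauss_space (sq n)"
  show "sym_on n (\<lambda>i j. \<kappa> * arrow p a (fst w) (snd w) i j)" for w
    by (simp add: sym_on_def arrow_sym[of p a "fst w"])
  have y: "(\<lambda>w. fst w i) \<in> borel_measurable ?N" if "i < n" for i
    by (rule measurable_compose[OF measurable_fst measurable_gauss_space_coord]) (use that in simp)
  have x: "(\<lambda>w. snd w q) \<in> borel_measurable ?N" if "q \<in> sq n" for q
    by (rule measurable_compose[OF measurable_snd measurable_gauss_space_coord[OF that]])
  show "(\<lambda>w. \<kappa> * arrow p a (fst w) (snd w) i j) \<in> borel_measurable ?N" if "i < n" "j < n" for i j
    unfolding arrow_def symm_def using y[of i] y[of j] y[OF p] x[of "(i, j)"] x[of "(j, i)"] that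
    by (cases "p < i \<and> p < j"; cases "i = p"; cases "j = p"; cases "p < j"; cases "p < i") simp_all
qed

text \<open>
With the row \<open>y\<close> fixed, the reflection is a fixed orthogonal matrix. It leaves the spectral sum unchanged
and preserves the law of the noise \<open>x\<close>, so in the mean only the length of the row matters.
\<close>

lemma arrow_mean_rotate:
  fixes y :: "nat \<Rightarrow> real" and n p :: nat
  defines "av \<equiv> \<lambda>j. if p < j then y j else 0"
  defines "nb \<equiv> sqrt (\<Sum>k<n. (av k)\<^sup>2)"
  defines "y' \<equiv> \<lambda>j. if p < j then (if j = Suc p then nb else 0) else y j"
  assumes f: "L-lipschitz_on UNIV f" and p: "Suc p < n"
  shows "(\<integral>x. spec_sum n f (\<lambda>i j. \<kappa> * arrow p a y x i j) \<partial>gauss_space (sq n))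
       = (\<integral>x. spec_sum n f (\<lambda>i j. \<kappa> * arrow p a y' x i j) \<partial>gauss_space (sq n))"
proof -
  let ?X = "gauss_space (sq n)"
  have gx: "gauss_fam ?X (sq n) (\<lambda>q x. x q) (\<lambda>i j. of_bool (i = j))"
    by (rule gauss_fam_gauss_space) simp
  define R where "R = householder n (\<lambda>k. av k - (if k = Suc p then nb else 0))"
  have R: "orth_on n R" unfolding R_def by (rule orth_householder)
  have "spec_sum n f (\<lambda>i j. \<kappa> * arrow p a y x i j) = spec_sum n f (\<lambda>i j. \<kappa> * arrow p a y' (rot n R x) i j)" for x
  proof -
    have "spec_sum n f (\<lambda>i j. \<kappa> * arrow p a y x i j)
        = spec_sum n f (\<lambda>i j. \<Sum>k<n. \<Sum>l<n. R i k * (\<kappa> * arrow p a y x k l) * R j l)"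
      by (simp add: spec_sum_conj[OF R])
    also have "\<dots> = spec_sum n f (\<lambda>i j. \<kappa> * arrow p a y' (rot n R x) i j)"
    proof (rule spec_sum_cong)
      fix i j assume ij: "i < n" "j < n"
      have "(\<Sum>k<n. \<Sum>l<n. R i k * (\<kappa> * arrow p a y x k l) * R j l)
          = \<kappa> * (\<Sum>k<n. \<Sum>l<n. R i k * arrow p a y x k l * R j l)"
        by (simp add: sum_distrib_left ac_simps)
      also have "(\<Sum>k<n. \<Sum>l<n. R i k * arrow p a y x k l * R j l) = arrow p a y' (rot n R x) i j"
        using arrow_rotate[OF p ij, of y a x] unfolding R_def y'_def nb_def av_def .
      finally show "(\<Sum>k<n. \<Sum>l<n. R i k * (\<kappa> * arrow p a y x k l) * R j l)
          = \<kappa> * arrow p a y' (rot n R x) i j" .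
    qed
    finally show ?thesis .
  qed
  hence "(\<integral>x. spec_sum n f (\<lambda>i j. \<kappa> * arrow p a y x i j) \<partial>?X)
      = (\<integral>x. spec_sum n f (\<lambda>i j. \<kappa> * arrow p a y' (rot n R x) i j) \<partial>?X)" by simp
  also have "\<dots> = (\<integral>x. spec_sum n f (\<lambda>i j. \<kappa> * arrow p a y' x i j) \<partial>?X)"
  proof -
    define Q where "Q i j \<longleftrightarrow> p < i \<and> p < j" for i j :: nat
    define Z where "Z x i j = of_bool (Q i j) * symm x i j" for x i j
    define B where "B i j = \<kappa> * (if Q i j then 0 else arrow p a y' (\<lambda>_. 0) i j)" for i j
    have e: "\<kappa> * arrow p a y' x i j = B i j + \<kappa> * Z x i j" for x i j
      by (auto simp: arrow_def B_def Z_def Q_def)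
    show ?thesis unfolding e
    proof (rule gauss_fam_spec_sum_eq[OF _ _ refl _ _ _ f])
      show "gauss_fam ?X (sq n) (\<lambda>q x. Z (rot n R x) (fst q) (snd q))
        (\<lambda>q r. of_bool (Q (fst q) (snd q) \<and> Q (fst r) (snd r)) * goe_cov (fst q) (snd q) (fst r) (snd r))"
        unfolding Z_def by (rule gauss_fam_symm[OF gauss_fam_rot[OF gx R]])
      show "gauss_fam ?X (sq n) (\<lambda>q x. Z x (fst q) (snd q))
        (\<lambda>q r. of_bool (Q (fst q) (snd q) \<and> Q (fst r) (snd r)) * goe_cov (fst q) (snd q) (fst r) (snd r))"
        unfolding Z_def by (rule gauss_fam_symm[OF gx])
      show "sym_on n (Z x)" "sym_on n (Z (rot n R x))" for x
        by (auto simp: sym_on_def Z_def Q_def symm_sym)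
      show "sym_on n B" by (auto simp: sym_on_def B_def Q_def arrow_sym[of p a y'])
    qed
  qed
  finally show ?thesis .
qed

text \<open>
By \<open>arrow_mean_rotate\<close>, row \<open>p\<close> may be taken to have only its diagonal entry \<open>sqrt 2 * y p\<close> and one
further entry, the norm of its tail. The next hybrid matrix has \<open>0\<close> and \<open>a\<close> in
their places. The expected error is bounded by a constant because \<open>a\<close> is within 1 of \<open>sqrt m\<close> for the
number \<open>m\<close> of tail entries, and the norm of a Gaussian vector in dimension \<open>m\<close> is within \<open>O(1)\<close> of
\<open>sqrt m\<close>. The constant 21 is 3 times the sum of the mean bounds 2 for the diagonal entry and 5 for the tail.
\<close>

lemma hybrid_step:
  assumes f: "1-lipschitz_on UNIV f" "\<And>x. \<bar>f x\<bar> \<le> 1" and p: "p < n" and \<kappa>: "\<kappa> \<ge> 0"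
    and m: "Suc p < n \<Longrightarrow> \<bar>sqrt (real (n - Suc p)) - a\<bar> \<le> 1"
  shows "\<bar>(\<integral>x. spec_sum n f (\<lambda>i j. \<kappa> * hybrid p a x i j) \<partial>gauss_space (sq n))
       - (\<integral>x. spec_sum n f (\<lambda>i j. \<kappa> * hybrid (Suc p) a x i j) \<partial>gauss_space (sq n))\<bar> \<le> 21 * \<kappa>"
proof -
  let ?Y = "gauss_space {..<n}" and ?X = "gauss_space (sq n)"
  interpret Y: prob_space ?Y by (rule prob_space_gauss_space)
  interpret X: prob_space ?X by (rule prob_space_gauss_space)
  interpret P: pair_prob_space ?Y ?X ..
  define \<Phi> where "\<Phi> w = spec_sum n f (\<lambda>i j. \<kappa> * arrow p a (fst w) (snd w) i j)" for w
  define c where "c = (\<integral>x. spec_sum n f (\<lambda>i j. \<kappa> * hybrid (Suc p) a x i j) \<partial>?X)"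
  have asym: "sym_on n (\<lambda>i j. \<kappa> * arrow p a y x i j)" for y x
    by (simp add: sym_on_def arrow_sym[of p a y])
  have hsym: "sym_on n (\<lambda>i j. \<kappa> * hybrid q a x i j)" for q x
    by (simp add: sym_on_def hybrid_sym[of q a x])
  have \<Phi>m: "\<Phi> \<in> borel_measurable (?Y \<Otimes>\<^sub>M ?X)" unfolding \<Phi>_def by (rule arrow_measurable[OF f(1) p])
  have \<Phi>b: "\<bar>\<Phi> w\<bar> \<le> real n" for w
    unfolding \<Phi>_def using spec_sum_bound[OF asym f(2)] by simp
  have \<Phi>i: "integrable (?Y \<Otimes>\<^sub>M ?X) \<Phi>"
    using \<Phi>m \<Phi>b by (intro P.integrable_const_bound[where B = "real n"]) auto
  have xm: "(\<lambda>x. spec_sum n f (\<lambda>i j. \<kappa> * hybrid (Suc p) a x i j)) \<in> borel_measurable ?X"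
  proof (rule spec_sum_measurable[OF _ hsym f(1)])
    show "(\<lambda>x. \<kappa> * hybrid (Suc p) a x i j) \<in> borel_measurable ?X" if "i < n" "j < n" for i j
      unfolding hybrid_def symm_def
      using measurable_gauss_space_coord[of "(i, j)" "sq n"] measurable_gauss_space_coord[of "(j, i)" "sq n"] that
      by (cases "Suc p \<le> i \<and> Suc p \<le> j") simp_all
  qed
  have xi: "integrable ?X (\<lambda>x. spec_sum n f (\<lambda>i j. \<kappa> * hybrid (Suc p) a x i j))"
    using xm spec_sum_bound[OF hsym f(2)] by (intro X.integrable_const_bound[where B = "real n"]) auto
  define m where "m = real (n - Suc p)"
  define S where "S = {Suc p..<n}"
  define av where "av y j = (if p < j then y j else 0)" for y :: "nat \<Rightarrow> real" and j
  define nb where "nb y = sqrt (\<Sum>k<n. (av y k)\<^sup>2)" for y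
  define y' where "y' y j = (if p < j then (if j = Suc p then nb y else 0) else y j)" for y j
  define d where "d y = (if Suc p < n then \<bar>nb y - a\<bar> else 0)" for y
  \<comment> \<open>An integrable bound in terms of squares only, obtained from \<open>2 * \<bar>u\<bar> \<le> 1 + u\<^sup>2\<close>.\<close>
  define bd where "bd y = 3 * \<kappa> * ((1 + (y p)\<^sup>2) + (3 + ((\<Sum>i\<in>S. (y i)\<^sup>2) - m)\<^sup>2 / m))" for y :: "nat \<Rightarrow> real"
  have inner: "(\<integral>x. \<Phi> (y, x) \<partial>?X) = (\<integral>x. \<Phi> (y' y, x) \<partial>?X)" if "Suc p < n" for y
    using arrow_mean_rotate[OF f(1) that, of \<kappa> a y] unfolding \<Phi>_def fst_conv snd_conv y'_def nb_def av_def .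
  have near: "\<bar>(\<integral>x. \<Phi> (y, x) \<partial>?X) - c\<bar> \<le> 3 * \<kappa> * (sqrt 2 * \<bar>y p\<bar> + 2 * d y)"
    if "y \<in> space ?Y" for y
  proof -
    \<comment> \<open>At the last index the row has no tail, and there is nothing to rotate.\<close>
    define z where "z = (if Suc p < n then y' y else y)"
    have zi: "(\<integral>x. \<Phi> (y, x) \<partial>?X) = (\<integral>x. \<Phi> (z, x) \<partial>?X)" using inner[of y] by (simp add: z_def)
    have zp: "z p = y p" by (simp add: z_def y'_def)
    have ptw: "\<bar>\<Phi> (z, x) - spec_sum n f (\<lambda>i j. \<kappa> * hybrid (Suc p) a x i j)\<bar> \<le> 3 * \<kappa> * (sqrt 2 * \<bar>y p\<bar> + 2 * d y)" for x
    proof -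
      define D where "D i j = \<bar>\<kappa> * arrow p a z x i j - \<kappa> * hybrid (Suc p) a x i j\<bar>" for i j
      have "\<bar>\<Phi> (z, x) - spec_sum n f (\<lambda>i j. \<kappa> * hybrid (Suc p) a x i j)\<bar> \<le> 3 * 1 * (\<Sum>i<n. \<Sum>j<n. D i j)"
        unfolding \<Phi>_def D_def fst_conv snd_conv by (rule spec_sum_entrywise[OF hsym asym f(1)])
      also have "(\<Sum>i<n. \<Sum>j<n. D i j) \<le> (\<Sum>i<n. \<Sum>j<n. \<kappa> * (of_bool (p = i) * of_bool (p = j) * (sqrt 2 * \<bar>y p\<bar>)
          + of_bool (p = i) * of_bool (Suc p = j) * d y + of_bool (Suc p = i) * of_bool (p = j) * d y))"
      proof (intro sum_mono)
        fix i j assume "i \<in> {..<n}" "j \<in> {..<n}"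
        have "D i j = \<kappa> * \<bar>arrow p a z x i j - hybrid (Suc p) a x i j\<bar>"
          using \<kappa> by (simp add: D_def abs_mult flip: right_diff_distrib)
        also have "\<bar>arrow p a z x i j - hybrid (Suc p) a x i j\<bar> \<le> of_bool (p = i) * of_bool (p = j) * (sqrt 2 * \<bar>y p\<bar>)
          + of_bool (p = i) * of_bool (Suc p = j) * d y + of_bool (Suc p = i) * of_bool (p = j) * d y"
          using \<open>i \<in> {..<n}\<close> \<open>j \<in> {..<n}\<close>
          by (auto simp: arrow_def hybrid_def z_def y'_def d_def tridiag_def abs_mult)
        finally show "D i j \<le> \<kappa> * (of_bool (p = i) * of_bool (p = j) * (sqrt 2 * \<bar>y p\<bar>)
          + of_bool (p = i) * of_bool (Suc p = j) * d y + of_bool (Suc p = i) * of_bool (p = j) * d y)"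
          using \<kappa> by (simp add: mult_left_mono)
      qed
      also have "\<dots> = \<kappa> * ((\<Sum>i<n. of_bool (p = i) * (\<Sum>j<n. of_bool (p = j) * (sqrt 2 * \<bar>y p\<bar>)))
           + (\<Sum>i<n. of_bool (p = i) * (\<Sum>j<n. of_bool (Suc p = j) * d y))
           + (\<Sum>j<n. of_bool (p = j) * (\<Sum>i<n. of_bool (Suc p = i) * d y)))"
      proof -
        have "(\<Sum>i<n. \<Sum>j<n. of_bool (Suc p = i) * of_bool (p = j) * d y) = (\<Sum>j<n. of_bool (p = j) * (\<Sum>i<n. of_bool (Suc p = i) * d y))"
          by (subst sum.swap) (simp only: sum_distrib_left ac_simps)
        moreover have "(\<Sum>i<n. \<Sum>j<n. of_bool (p = i) * of_bool (Suc p = j) * d y) = (\<Sum>i<n. of_bool (p = i) * (\<Sum>j<n. of_bool (Suc p = j) * d y))"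
          by (simp only: sum_distrib_left mult.assoc)
        moreover have "(\<Sum>i<n. \<Sum>j<n. of_bool (p = i) * of_bool (p = j) * (sqrt 2 * \<bar>y p\<bar>)) = (\<Sum>i<n. of_bool (p = i) * (\<Sum>j<n. of_bool (p = j) * (sqrt 2 * \<bar>y p\<bar>)))"
          by (simp only: sum_distrib_left mult.assoc)
        ultimately show ?thesis by (simp only: sum_distrib_left[symmetric] sum.distrib)
      qed
      also have "\<dots> = \<kappa> * (sqrt 2 * \<bar>y p\<bar> + (\<Sum>j<n. of_bool (Suc p = j) * d y) + (\<Sum>j<n. of_bool (Suc p = j) * d y))"
        using p by (simp only: sum_of_bool_eq)
      also have "(\<Sum>j<n. of_bool (Suc p = j) * d y) = d y"
      proof (cases "Suc p < n")
        case True
        thus ?thesis by (rule sum_of_bool_eq)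
      qed (simp add: d_def)
      finally show ?thesis by (simp add: algebra_simps)
    qed
    have xi': "integrable ?X (\<lambda>x. \<Phi> (z, x))"
    proof -
      have "(\<lambda>x. \<Phi> (z, x)) \<in> borel_measurable ?X"
        unfolding \<Phi>_def fst_conv snd_conv
      proof (rule spec_sum_measurable[OF _ asym f(1)])
        show "(\<lambda>x. \<kappa> * arrow p a z x i j) \<in> borel_measurable ?X" if "i < n" "j < n" for i j
          unfolding arrow_def symm_def
          using measurable_gauss_space_coord[of "(i, j)" "sq n"] measurable_gauss_space_coord[of "(j, i)" "sq n"] that
          by (cases "p < i \<and> p < j") simp_all
      qed
      thus ?thesis using \<Phi>b by (intro X.integrable_const_bound[where B = "real n"]) auto
    qed
    have "\<bar>(\<integral>x. \<Phi> (z, x) \<partial>?X) - c\<bar> = \<bar>\<integral>x. \<Phi> (z, x) - spec_sum n f (\<lambda>i j. \<kappa> * hybrid (Suc p) a x i j) \<partial>?X\<bar>"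
      unfolding c_def using xi xi' by simp
    also have "\<dots> \<le> (\<integral>x. \<bar>\<Phi> (z, x) - spec_sum n f (\<lambda>i j. \<kappa> * hybrid (Suc p) a x i j)\<bar> \<partial>?X)"
      by (rule integral_abs_bound)
    also have "\<dots> \<le> (\<integral>x. 3 * \<kappa> * (sqrt 2 * \<bar>y p\<bar> + 2 * d y) \<partial>?X)"
      using xi xi' ptw by (intro integral_mono) auto
    also have "\<dots> = 3 * \<kappa> * (sqrt 2 * \<bar>y p\<bar> + 2 * d y)" using X.prob_space by simp
    finally show ?thesis unfolding zi .
  qed
  have bound: "3 * \<kappa> * (sqrt 2 * \<bar>y p\<bar> + 2 * d y) \<le> bd y" for y
  proof -
    note 1 = sqrt2_abs_le[of "y p"]
    have 2: "2 * d y \<le> 3 + ((\<Sum>i\<in>S. (y i)\<^sup>2) - m)\<^sup>2 / m"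
    proof (cases "Suc p < n")
      case True
      hence m0: "m > 0" by (simp add: m_def)
      have "(\<Sum>k<n. (av y k)\<^sup>2) = (\<Sum>i\<in>S. (y i)\<^sup>2)"
        unfolding av_def S_def by (intro sum.mono_neutral_cong_right) auto
      hence nb: "nb y = sqrt (\<Sum>i\<in>S. (y i)\<^sup>2)" by (simp add: nb_def)
      have "d y \<le> \<bar>nb y - sqrt m\<bar> + 1"
        using assms(5)[OF True] True by (simp add: d_def m_def)
      thus ?thesis
        using sqrt_diff_le[of "\<Sum>i\<in>S. (y i)\<^sup>2" m] m0 by (simp add: nb sum_nonneg)
    next
      case False
      have "0 \<le> ((\<Sum>i\<in>S. (y i)\<^sup>2) - m)\<^sup>2 / m" by (simp add: m_def)
      thus ?thesis using False by (simp add: d_def)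
    qed
    show ?thesis unfolding bd_def using 1 2 \<kappa> by (intro mult_left_mono) auto
  qed
  have S: "S \<subseteq> {..<n}" "real (card S) = m" by (auto simp: S_def m_def)
  note chi = gauss_space_chi_square_var[OF finite_lessThan S(1), unfolded S(2)]
  note yp = gauss_space_sq_mean[OF finite_lessThan, of p n]
  have bdi: "integrable ?Y bd"
    unfolding bd_def using chi(1) yp(1) p by simp
  have bdint: "(\<integral>y. bd y \<partial>?Y) \<le> 21 * \<kappa>"
  proof -
    have "(\<integral>y. bd y \<partial>?Y) = 3 * \<kappa> * ((1 + 1) + (3 + 2 * m / m))"
      unfolding bd_def using chi yp p Y.prob_space by simp
    also have "\<dots> \<le> 3 * \<kappa> * 7" using \<kappa> by (intro mult_left_mono) auto
    finally show ?thesis by simp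
  qed
  have yi: "integrable ?Y (\<lambda>y. \<integral>x. \<Phi> (y, x) \<partial>?X)" by (rule P.integrable_fst'[OF \<Phi>i])
  have "(\<integral>x. spec_sum n f (\<lambda>i j. \<kappa> * hybrid p a x i j) \<partial>?X) = (\<integral>w. \<Phi> w \<partial>(?Y \<Otimes>\<^sub>M ?X))"
    unfolding \<Phi>_def by (rule hybrid_arrow_mean[OF f(1) p])
  also have "\<dots> = (\<integral>y. \<integral>x. \<Phi> (y, x) \<partial>?X \<partial>?Y)" by (rule P.integral_fst'[OF \<Phi>i, symmetric])
  finally have "\<bar>(\<integral>x. spec_sum n f (\<lambda>i j. \<kappa> * hybrid p a x i j) \<partial>?X) - c\<bar>
      = \<bar>\<integral>y. (\<integral>x. \<Phi> (y, x) \<partial>?X) - c \<partial>?Y\<bar>"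
    using yi Y.prob_space by simp
  also have "\<dots> \<le> (\<integral>y. \<bar>(\<integral>x. \<Phi> (y, x) \<partial>?X) - c\<bar> \<partial>?Y)" by (rule integral_abs_bound)
  also have "\<dots> \<le> (\<integral>y. bd y \<partial>?Y)"
    using yi bdi near bound by (intro integral_mono) (auto intro: order_trans)
  also have "\<dots> \<le> 21 * \<kappa>" by (rule bdint)
  finally show ?thesis unfolding c_def .
qed

section \<open>Blocks of constant coefficient and the arcsine law\<close>

definition goe_mean :: "nat \<Rightarrow> real \<Rightarrow> (real \<Rightarrow> real) \<Rightarrow> real" where
  "goe_mean n \<kappa> f = (\<integral>x. spec_sum n f (\<lambda>i j. \<kappa> * symm x i j) \<partial>gauss_space (sq n))"

lemma symm_measurable:
  assumes "i < n" "j < n" shows "(\<lambda>x. \<kappa> * symm x i j) \<in> borel_measurable (gauss_space (sq n))"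
  unfolding symm_def
  using measurable_gauss_space_coord[of "(i, j)" "sq n"] measurable_gauss_space_coord[of "(j, i)" "sq n"] assms
  by simp

lemma goe_mean_bound:
  assumes f: "1-lipschitz_on UNIV f" "\<And>x. \<bar>f x\<bar> \<le> 1"
  shows "\<bar>goe_mean n \<kappa> f\<bar> \<le> real n"
proof -
  interpret X: prob_space "gauss_space (sq n)" by (rule prob_space_gauss_space)
  have sym: "sym_on n (\<lambda>i j. \<kappa> * symm x i j)" for x by (simp add: sym_on_def symm_sym[of x])
  have m: "(\<lambda>x. spec_sum n f (\<lambda>i j. \<kappa> * symm x i j)) \<in> borel_measurable (gauss_space (sq n))"
    by (rule spec_sum_measurable[OF symm_measurable sym f(1)])
  have b: "\<bar>spec_sum n f (\<lambda>i j. \<kappa> * symm x i j)\<bar> \<le> real n" for x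
    using spec_sum_bound[OF sym f(2)] by simp
  have "\<bar>goe_mean n \<kappa> f\<bar> \<le> (\<integral>x. \<bar>spec_sum n f (\<lambda>i j. \<kappa> * symm x i j)\<bar> \<partial>gauss_space (sq n))"
    unfolding goe_mean_def by (rule integral_abs_bound)
  also have "\<dots> \<le> (\<integral>x. real n \<partial>gauss_space (sq n))"
    using m b by (intro integral_mono X.integrable_const_bound[where B = "real n"]) auto
  finally show ?thesis using X.prob_space by simp
qed

lemma hybrid_chain:
  assumes f: "1-lipschitz_on UNIV f" "\<And>x. \<bar>f x\<bar> \<le> 1" and \<kappa>: "\<kappa> \<ge> 0"
    and q: "q \<le> n" and m: "\<And>p. p < q \<Longrightarrow> Suc p < n \<Longrightarrow> \<bar>sqrt (real (n - Suc p)) - a\<bar> \<le> 1"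
  shows "\<bar>goe_mean n \<kappa> f - (\<integral>x. spec_sum n f (\<lambda>i j. \<kappa> * hybrid q a x i j) \<partial>gauss_space (sq n))\<bar> \<le> 21 * \<kappa> * real q"
  using q m
proof (induction q)
  case 0
  have "hybrid 0 a x i j = symm x i j" for x i j by (simp add: hybrid_def)
  thus ?case by (simp add: goe_mean_def)
next
  case (Suc q)
  have "\<bar>goe_mean n \<kappa> f - (\<integral>x. spec_sum n f (\<lambda>i j. \<kappa> * hybrid q a x i j) \<partial>gauss_space (sq n))\<bar> \<le> 21 * \<kappa> * real q"
    by (rule Suc.IH) (use Suc.prems in auto)
  moreover have "\<bar>(\<integral>x. spec_sum n f (\<lambda>i j. \<kappa> * hybrid q a x i j) \<partial>gauss_space (sq n))
      - (\<integral>x. spec_sum n f (\<lambda>i j. \<kappa> * hybrid (Suc q) a x i j) \<partial>gauss_space (sq n))\<bar> \<le> 21 * \<kappa>"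
    by (rule hybrid_step[OF f _ \<kappa>]) (use Suc.prems in auto)
  moreover have "21 * \<kappa> * real (Suc q) = 21 * \<kappa> * real q + 21 * \<kappa>" by (simp add: algebra_simps)
  ultimately show ?case by linarith
qed

text \<open>
When \<open>n - m\<close> rows have been tridiagonalised, the only connection to the remaining block is one pair of
entries \<open>\<kappa> * t\<close>. Deleting it splits the matrix into a Toeplitz block and a smaller Gaussian ensemble. The bounds
on \<open>m\<close> and \<open>n\<close> by consecutive squares ensure that \<open>t\<close> approximates all norms that occur in the block.
\<close>

lemma goe_block:
  assumes f: "1-lipschitz_on UNIV f" "\<And>x. \<bar>f x\<bar> \<le> 1" and \<kappa>: "\<kappa> \<ge> 0"
    and t: "t > 0" "t\<^sup>2 \<le> m" "m \<le> n" "n \<le> (Suc t)\<^sup>2"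
  shows "\<bar>goe_mean n \<kappa> f - (spec_sum (n - m) f (tridiag (\<kappa> * real t)) + goe_mean m \<kappa> f)\<bar>
    \<le> 21 * \<kappa> * real (n - m) + 6 * \<kappa> * real t"
proof -
  let ?X = "gauss_space (sq n)"
  interpret X: prob_space ?X by (rule prob_space_gauss_space)
  define q where "q = n - m"
  define a where "a = real t"
  have m0: "m > 0" using t by (metis gr0I le_zero_eq power_eq_0_iff neq0_conv)
  have nq: "n = q + m" "q < n" using t m0 by (auto simp: q_def)
  define H where "H x i j = \<kappa> * hybrid q a x i j" for x i j
  \<comment> \<open>The hybrid matrix without its link between the indices \<open>q - 1\<close> and \<open>q\<close>.\<close>
  define C where "C x i j = (if (i < q) = (j < q) then H x i j else 0)" for x i j
  have Hs: "sym_on n (H x)" for x by (simp add: sym_on_def H_def hybrid_sym[of q a x])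
  have Cs: "sym_on n (C x)" for x using Hs[of x] by (auto simp: sym_on_def C_def)
  have Hm: "(\<lambda>x. H x i j) \<in> borel_measurable ?X" if "i < n" "j < n" for i j
    unfolding H_def hybrid_def using symm_measurable[of i n j \<kappa>] that by (cases "q \<le> i"; cases "q \<le> j") simp_all
  have Cm: "(\<lambda>x. C x i j) \<in> borel_measurable ?X" if "i < n" "j < n" for i j
    unfolding C_def using Hm[OF that] by (cases "(i < q) = (j < q)") simp_all
  have Hi: "integrable ?X (\<lambda>x. spec_sum n f (H x))"
    using spec_sum_measurable[OF Hm Hs f(1)] spec_sum_bound[OF Hs f(2)]
    by (intro X.integrable_const_bound[where B = "real n"]) auto
  have Ci: "integrable ?X (\<lambda>x. spec_sum n f (C x))"
    using spec_sum_measurable[OF Cm Cs f(1)] spec_sum_bound[OF Cs f(2)]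
    by (intro X.integrable_const_bound[where B = "real n"]) auto
  have chain: "\<bar>goe_mean n \<kappa> f - (\<integral>x. spec_sum n f (H x) \<partial>?X)\<bar> \<le> 21 * \<kappa> * real q"
    unfolding H_def
  proof (rule hybrid_chain[OF f \<kappa>])
    show "q \<le> n" using nq by simp
    fix p assume "p < q" "Suc p < n"
    hence "t\<^sup>2 \<le> n - Suc p" "n - Suc p \<le> (Suc t)\<^sup>2" using t q_def by auto
    hence "(real t)\<^sup>2 \<le> real (n - Suc p)" "real (n - Suc p) \<le> (real t + 1)\<^sup>2"
      by (metis of_nat_le_iff of_nat_power, metis of_nat_le_iff of_nat_power of_nat_Suc add.commute)
    hence "real t \<le> sqrt (real (n - Suc p))" "sqrt (real (n - Suc p)) \<le> real t + 1"
      by (auto intro: real_le_rsqrt real_le_lsqrt)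
    thus "\<bar>sqrt (real (n - Suc p)) - a\<bar> \<le> 1" by (simp add: a_def)
  qed
  have cut: "\<bar>spec_sum n f (H x) - spec_sum n f (C x)\<bar> \<le> 6 * \<kappa> * real t" for x
  proof -
    have "\<bar>spec_sum n f (H x) - spec_sum n f (C x)\<bar> \<le> 3 * 1 * (\<Sum>i<n. \<Sum>j<n. \<bar>H x i j - C x i j\<bar>)"
      by (rule spec_sum_entrywise[OF Cs Hs f(1)])
    also have "(\<Sum>i<n. \<Sum>j<n. \<bar>H x i j - C x i j\<bar>)
        \<le> (\<Sum>i<n. \<Sum>j<n. of_bool (q - 1 = i) * (of_bool (q = j) * (\<kappa> * a)) + of_bool (q = i) * (of_bool (q - 1 = j) * (\<kappa> * a)))"
      using \<kappa> by (intro sum_mono) (auto simp: C_def H_def hybrid_def tridiag_def a_def)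
    also have "\<dots> = (\<Sum>i<n. of_bool (q - 1 = i) * (\<Sum>j<n. of_bool (q = j) * (\<kappa> * a)))
        + (\<Sum>i<n. of_bool (q = i) * (\<Sum>j<n. of_bool (q - 1 = j) * (\<kappa> * a)))"
      by (simp only: sum.distrib sum_distrib_left)
    also have "\<dots> = \<kappa> * a + \<kappa> * a"
      using nq(2) by (simp only: sum_of_bool_eq less_imp_diff_less)
    finally show ?thesis by (simp add: a_def)
  qed
  have block: "spec_sum n f (C x) = spec_sum q f (tridiag (\<kappa> * real t)) + spec_sum m f (\<lambda>i j. \<kappa> * symm x (q + i) (q + j))" for x
  proof -
    have "spec_sum (q + m) f (C x) = spec_sum q f (C x) + spec_sum m f (\<lambda>i j. C x (q + i) (q + j))"
      by (rule spec_sum_block) (use Cs[of x] nq in \<open>auto simp: C_def\<close>)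
    also have "spec_sum q f (C x) = spec_sum q f (tridiag (\<kappa> * real t))"
      by (rule spec_sum_cong) (auto simp: C_def H_def hybrid_def tridiag_def a_def)
    also have "spec_sum m f (\<lambda>i j. C x (q + i) (q + j)) = spec_sum m f (\<lambda>i j. \<kappa> * symm x (q + i) (q + j))"
      by (rule spec_sum_cong) (auto simp: C_def H_def hybrid_def)
    finally show ?thesis using nq(1) by simp
  qed
  have shift: "(\<integral>x. spec_sum m f (\<lambda>i j. \<kappa> * symm x (q + i) (q + j)) \<partial>?X) = goe_mean m \<kappa> f"
  proof -
    have gn: "gauss_fam ?X (sq n) (\<lambda>q x. x q) (\<lambda>i j. of_bool (i = j))"
      and gm: "gauss_fam (gauss_space (sq m)) (sq m) (\<lambda>q x. x q) (\<lambda>i j. of_bool (i = j))"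
      by (rule gauss_fam_gauss_space; simp)+
    have gs: "gauss_fam ?X (sq m) (\<lambda>r x. x (q + fst r, q + snd r)) (\<lambda>i j. of_bool (i = j))"
    proof (rule gauss_fam_white_linearI[OF gn, where L = "\<lambda>r s. of_bool ((q + fst r, q + snd r) = s)"])
      show "x (q + fst r, q + snd r) = (\<Sum>s\<in>sq n. of_bool ((q + fst r, q + snd r) = s) * x s)"
        if "r \<in> sq m" for r and x :: "nat \<times> nat \<Rightarrow> real"
        using that nq by (subst sum_of_bool_finite[of "sq n" "(q + fst r, q + snd r)" x]) auto
      show "(of_bool (r = r') :: real) = (\<Sum>s\<in>sq n. of_bool ((q + fst r, q + snd r) = s) * of_bool ((q + fst r', q + snd r') = s))"
        if "r \<in> sq m" "r' \<in> sq m" for r r'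
        using that nq by (subst sum_of_bool_finite[of "sq n" "(q + fst r, q + snd r)" "\<lambda>s. of_bool ((q + fst r', q + snd r') = s)"]) (auto simp: prod_eq_iff)
    qed simp
    note s1 = gauss_fam_symm[OF gs, of "\<lambda>_ _. True"] and s2 = gauss_fam_symm[OF gm, of "\<lambda>_ _. True"]
    have "(\<integral>x. spec_sum m f (\<lambda>i j. 0 + \<kappa> * symm x (q + i) (q + j)) \<partial>?X)
        = (\<integral>x. spec_sum m f (\<lambda>i j. 0 + \<kappa> * symm x i j) \<partial>gauss_space (sq m))"
    proof (rule gauss_fam_spec_sum_eq[OF _ _ refl _ _ _ f(1)])
      show "gauss_fam ?X (sq m) (\<lambda>p x. symm x (q + fst p) (q + snd p)) (\<lambda>p r. goe_cov (fst p) (snd p) (fst r) (snd r))"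
        using s1 by (simp add: symm_def)
      show "gauss_fam (gauss_space (sq m)) (sq m) (\<lambda>p x. symm x (fst p) (snd p)) (\<lambda>p r. goe_cov (fst p) (snd p) (fst r) (snd r))"
        using s2 by simp
    qed (simp_all add: sym_on_def symm_sym)
    thus ?thesis by (simp add: goe_mean_def)
  qed
  have Si: "integrable ?X (\<lambda>x. spec_sum m f (\<lambda>i j. \<kappa> * symm x (q + i) (q + j)))"
  proof -
    have "spec_sum m f (\<lambda>i j. \<kappa> * symm x (q + i) (q + j)) = spec_sum n f (C x) - spec_sum q f (tridiag (\<kappa> * real t))" for x
      using block[of x] by simp
    thus ?thesis using Ci by simp
  qed
  have "(\<integral>x. spec_sum n f (C x) \<partial>?X) = spec_sum q f (tridiag (\<kappa> * real t)) + goe_mean m \<kappa> f"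
    unfolding block using Si X.prob_space by (simp add: shift)
  moreover have "\<bar>(\<integral>x. spec_sum n f (H x) \<partial>?X) - (\<integral>x. spec_sum n f (C x) \<partial>?X)\<bar> \<le> 6 * \<kappa> * real t"
  proof -
    have "\<bar>(\<integral>x. spec_sum n f (H x) \<partial>?X) - (\<integral>x. spec_sum n f (C x) \<partial>?X)\<bar>
        = \<bar>\<integral>x. spec_sum n f (H x) - spec_sum n f (C x) \<partial>?X\<bar>" using Hi Ci by simp
    also have "\<dots> \<le> (\<integral>x. \<bar>spec_sum n f (H x) - spec_sum n f (C x)\<bar> \<partial>?X)" by (rule integral_abs_bound)
    also have "\<dots> \<le> (\<integral>x. 6 * \<kappa> * real t \<partial>?X)"
      using Hi Ci cut by (intro integral_mono) auto
    finally show ?thesis using X.prob_space by simp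
  qed
  ultimately show ?thesis using chain by (simp add: q_def)
qed

text \<open>
The mean of \<open>f\<close> under the arcsine law on \<open>[- 2 * b, 2 * b]\<close>.
\<close>

definition arcsine_mean :: "(real \<Rightarrow> real) \<Rightarrow> real \<Rightarrow> real" where
  "arcsine_mean f b = integral {0..pi} (\<lambda>\<theta>. f (2 * b * cos \<theta>)) / pi"

lemma abs_cos_diff_le: "\<bar>cos x - cos y\<bar> \<le> \<bar>x - y\<bar>" for x y :: real
proof -
  have "norm (cos x - cos y) \<le> 1 * norm (x - y)"
    by (rule field_differentiable_bound[of UNIV cos "\<lambda>x. - sin x"]) (auto intro!: derivative_eq_intros)
  thus ?thesis by simp
qed

lemma lipschitz_abs: "L-lipschitz_on UNIV f \<Longrightarrow> \<bar>f x - f y\<bar> \<le> L * \<bar>x - y\<bar>" for f :: "real \<Rightarrow> real"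
  using lipschitz_onD[of L UNIV f x y] by (simp add: dist_real_def)

lemma lipschitz_cont: "L-lipschitz_on UNIV f \<Longrightarrow> continuous_on S f" for f :: "real \<Rightarrow> real"
  using lipschitz_on_continuous_on continuous_on_subset by blast

lemma arcsine_mean_integrable:
  fixes f :: "real \<Rightarrow> real"
  assumes f: "1-lipschitz_on UNIV f" shows "(\<lambda>\<theta>. f (2 * b * cos \<theta>)) integrable_on {c..d}"
  by (intro integrable_continuous_interval continuous_on_compose2[OF lipschitz_cont[OF f]] continuous_intros) auto

lemma arcsine_mean_bound:
  assumes f: "1-lipschitz_on UNIV f" "\<And>x. \<bar>f x\<bar> \<le> 1" shows "\<bar>arcsine_mean f b\<bar> \<le> 1"
proof -
  have "norm (integral {0..pi} (\<lambda>\<theta>. f (2 * b * cos \<theta>))) \<le> 1 * (pi - 0)"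
    by (rule integral_bound) (use f(2) in \<open>auto intro!: continuous_on_compose2[OF lipschitz_cont[OF f(1)]] continuous_intros\<close>)
  thus ?thesis by (simp add: arcsine_mean_def)
qed

lemma arcsine_mean_lipschitz:
  assumes f: "1-lipschitz_on UNIV f" shows "\<bar>arcsine_mean f b - arcsine_mean f b'\<bar> \<le> 2 * \<bar>b - b'\<bar>"
proof -
  have "norm (integral {0..pi} (\<lambda>\<theta>. f (2 * b * cos \<theta>) - f (2 * b' * cos \<theta>))) \<le> (2 * \<bar>b - b'\<bar>) * (pi - 0)"
  proof (rule integral_bound)
    show "continuous_on {0..pi} (\<lambda>\<theta>. f (2 * b * cos \<theta>) - f (2 * b' * cos \<theta>))"
      by (intro continuous_intros continuous_on_compose2[OF lipschitz_cont[OF f]]) auto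
    fix \<theta>
    have "\<bar>f (2 * b * cos \<theta>) - f (2 * b' * cos \<theta>)\<bar> \<le> 1 * \<bar>2 * b * cos \<theta> - 2 * b' * cos \<theta>\<bar>"
      by (rule lipschitz_abs[OF f])
    also have "\<bar>2 * b * cos \<theta> - 2 * b' * cos \<theta>\<bar> = 2 * \<bar>b - b'\<bar> * \<bar>cos \<theta>\<bar>"
    proof -
      have "2 * b * cos \<theta> - 2 * b' * cos \<theta> = 2 * (b - b') * cos \<theta>" by (simp add: algebra_simps)
      thus ?thesis by (simp only: abs_mult abs_numeral)
    qed
    also have "1 * (2 * \<bar>b - b'\<bar> * \<bar>cos \<theta>\<bar>) \<le> 2 * \<bar>b - b'\<bar>"
      using mult_left_mono[OF abs_cos_le_one[of \<theta>], of "2 * \<bar>b - b'\<bar>"] by simp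
    finally show "norm (f (2 * b * cos \<theta>) - f (2 * b' * cos \<theta>)) \<le> 2 * \<bar>b - b'\<bar>" by simp
  qed simp
  hence "\<bar>integral {0..pi} (\<lambda>\<theta>. f (2 * b * cos \<theta>)) - integral {0..pi} (\<lambda>\<theta>. f (2 * b' * cos \<theta>))\<bar> \<le> 2 * \<bar>b - b'\<bar> * pi"
    by (simp add: Henstock_Kurzweil_Integration.integral_diff[OF arcsine_mean_integrable[OF f] arcsine_mean_integrable[OF f]])
  hence "\<bar>integral {0..pi} (\<lambda>\<theta>. f (2 * b * cos \<theta>)) - integral {0..pi} (\<lambda>\<theta>. f (2 * b' * cos \<theta>))\<bar> / pi \<le> 2 * \<bar>b - b'\<bar>"
    by (simp only: pos_divide_le_eq[OF pi_gt_zero])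
  thus ?thesis by (simp add: arcsine_mean_def flip: diff_divide_distrib)
qed

lemma riemann_sum_lipschitz:
  fixes g :: "real \<Rightarrow> real"
  assumes g: "\<And>x y. \<bar>g x - g y\<bar> \<le> B * \<bar>x - y\<bar>" and cont: "continuous_on UNIV g" and h: "h \<ge> 0" and B: "B \<ge> 0"
  shows "\<bar>integral {0..h * real J} g - h * (\<Sum>j<J. g (h * real (Suc j)))\<bar> \<le> real J * (B * h\<^sup>2)"
proof (induction J)
  case (Suc J)
  have int: "g integrable_on {c..d}" for c d
    by (intro integrable_continuous_interval continuous_on_subset[OF cont]) auto
  have le: "0 \<le> h * real J" "h * real J \<le> h * real (Suc J)" using h by (auto simp: algebra_simps)
  have comb: "integral {0..h * real J} g + integral {h * real J..h * real (Suc J)} g = integral {0..h * real (Suc J)} g"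
    by (rule Henstock_Kurzweil_Integration.integral_combine[OF le int])
  have "norm (integral {h * real J..h * real (Suc J)} (\<lambda>x. g x - g (h * real (Suc J)))) \<le> (B * h) * (h * real (Suc J) - h * real J)"
  proof (rule integral_bound[OF le(2)])
    show "continuous_on {h * real J..h * real (Suc J)} (\<lambda>x. g x - g (h * real (Suc J)))"
      by (intro continuous_intros continuous_on_subset[OF cont]) auto
    fix x assume x: "x \<in> {h * real J..h * real (Suc J)}"
    have "\<bar>g x - g (h * real (Suc J))\<bar> \<le> B * \<bar>x - h * real (Suc J)\<bar>" by (rule g)
    also have "\<dots> \<le> B * h" using x B by (intro mult_left_mono) (auto simp: algebra_simps)
    finally show "norm (g x - g (h * real (Suc J))) \<le> B * h" by simp
  qed
  moreover have "integral {h * real J..h * real (Suc J)} (\<lambda>x. g x - g (h * real (Suc J)))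
      = integral {h * real J..h * real (Suc J)} g - h * g (h * real (Suc J))"
    using le(2) by (subst Henstock_Kurzweil_Integration.integral_diff[OF int integrable_const_ivl]) (simp add: algebra_simps)
  ultimately have "\<bar>integral {h * real J..h * real (Suc J)} g - h * g (h * real (Suc J))\<bar> \<le> B * h\<^sup>2"
    by (simp add: algebra_simps power2_eq_square)
  moreover have "real (Suc J) * (B * h\<^sup>2) = real J * (B * h\<^sup>2) + B * h\<^sup>2" by (simp add: algebra_simps)
  moreover have "h * (\<Sum>j<Suc J. g (h * real (Suc j))) = h * (\<Sum>j<J. g (h * real (Suc j))) + h * g (h * real (Suc J))"
    by (simp add: distrib_left)
  ultimately show ?case using Suc.IH comb by linarith
qed simp

text \<open>
The eigenvalues are the values of \<open>2 * b * cos\<close> at \<open>k\<close> equidistant points of \<open>[0, pi]\<close>; one more point at the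
end of the interval makes this a Riemann sum.
\<close>

lemma tridiag_arcsine:
  assumes f: "1-lipschitz_on UNIV f" "\<And>x. \<bar>f x\<bar> \<le> 1" and b: "b > 0"
  shows "\<bar>spec_sum k f (tridiag b) - real k * arcsine_mean f b\<bar> \<le> 8 * b + 2"
proof -
  define N where "N = real (Suc k)"
  define g where "g \<theta> = f (2 * b * cos \<theta>)" for \<theta>
  have N: "N > 0" by (simp add: N_def)
  have "\<bar>integral {0..pi / N * real (Suc k)} g - pi / N * (\<Sum>j<Suc k. g (pi / N * real (Suc j)))\<bar> \<le> real (Suc k) * (2 * b * (pi / N)\<^sup>2)"
  proof (rule riemann_sum_lipschitz)
    show "\<bar>g x - g y\<bar> \<le> 2 * b * \<bar>x - y\<bar>" for x y
    proof -
      have "\<bar>g x - g y\<bar> \<le> 1 * \<bar>2 * b * cos x - 2 * b * cos y\<bar>" unfolding g_def by (rule lipschitz_abs[OF f(1)])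
      also have "\<dots> = 2 * b * \<bar>cos x - cos y\<bar>" 
      proof -
        have "2 * b * cos x - 2 * b * cos y = 2 * b * (cos x - cos y)" by (simp add: algebra_simps)
        thus ?thesis using b by (simp add: abs_mult)
      qed
      also have "\<dots> \<le> 2 * b * \<bar>x - y\<bar>" using b abs_cos_diff_le[of x y] by (intro mult_left_mono) auto
      finally show ?thesis .
    qed
    show "continuous_on UNIV g" unfolding g_def
      by (intro continuous_on_compose2[OF lipschitz_cont[OF f(1)]] continuous_intros) auto
  qed (use b N in auto)
  hence "\<bar>integral {0..pi} g - pi / N * (\<Sum>j<Suc k. g (pi / N * real (Suc j)))\<bar> \<le> N * (2 * b * (pi / N)\<^sup>2)"
    using N by (simp add: N_def)
  hence "N / pi * \<bar>integral {0..pi} g - pi / N * (\<Sum>j<Suc k. g (pi / N * real (Suc j)))\<bar> \<le> N / pi * (N * (2 * b * (pi / N)\<^sup>2))"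
    using N by (intro mult_left_mono) auto
  also have "N / pi * \<bar>integral {0..pi} g - pi / N * (\<Sum>j<Suc k. g (pi / N * real (Suc j)))\<bar>
      = \<bar>N / pi * (integral {0..pi} g - pi / N * (\<Sum>j<Suc k. g (pi / N * real (Suc j))))\<bar>"
    using N by (simp add: abs_mult)
  also have "N / pi * (integral {0..pi} g - pi / N * (\<Sum>j<Suc k. g (pi / N * real (Suc j))))
      = N * arcsine_mean f b - (\<Sum>j<Suc k. g (pi / N * real (Suc j)))"
  proof -
    have "g = (\<lambda>\<theta>. f (2 * b * cos \<theta>))" by (rule ext) (simp add: g_def)
    thus ?thesis using N by (simp add: arcsine_mean_def right_diff_distrib)
  qed
  also have "N / pi * (N * (2 * b * (pi / N)\<^sup>2)) = 2 * b * pi"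
    using N by (simp add: power2_eq_square field_simps)
  finally have 1: "\<bar>N * arcsine_mean f b - (\<Sum>j<Suc k. g (pi / N * real (Suc j)))\<bar> \<le> 2 * b * pi" .
  have 2: "spec_sum k f (tridiag b) = (\<Sum>j<k. g (pi / N * real (Suc j)))"
    unfolding spec_sum_tridiag[OF b] by (intro sum.cong refl) (simp add: g_def N_def)
  have 3: "\<bar>g x\<bar> \<le> 1" for x unfolding g_def by (rule f(2))
  have "2 * b * pi \<le> 8 * b" using b pi_less_4 by simp
  moreover have "N * arcsine_mean f b = real k * arcsine_mean f b + arcsine_mean f b" by (simp add: N_def algebra_simps)
  moreover have "(\<Sum>j<Suc k. g (pi / N * real (Suc j))) = (\<Sum>j<k. g (pi / N * real (Suc j))) + g (pi / N * real (Suc k))" by simp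
  ultimately show ?thesis using 1 2 3[of "pi / N * real (Suc k)"] arcsine_mean_bound[OF f, of b] by linarith
qed

definition isqrt :: "nat \<Rightarrow> nat" where "isqrt k = nat \<lfloor>sqrt (real k)\<rfloor>"

lemma isqrt_eqI: "t\<^sup>2 \<le> k \<Longrightarrow> k < (Suc t)\<^sup>2 \<Longrightarrow> isqrt k = t"
proof -
  assume a: "t\<^sup>2 \<le> k" "k < (Suc t)\<^sup>2"
  have "(real t)\<^sup>2 \<le> real k" "real k < (real t + 1)\<^sup>2"
    using a by (metis of_nat_le_iff of_nat_power, metis a(2) of_nat_less_iff of_nat_power of_nat_Suc add.commute)
  hence "real t \<le> sqrt (real k)" "sqrt (real k) < real t + 1"
    by (auto intro: real_le_rsqrt real_less_lsqrt)
  hence "\<lfloor>sqrt (real k)\<rfloor> = int t" by (intro floor_unique) auto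
  thus ?thesis by (simp add: isqrt_def)
qed

lemma isqrt_bounds: "real (isqrt k) \<le> sqrt (real k)" "sqrt (real (Suc k)) \<le> real (isqrt k) + 1"
proof -
  define t where "t = isqrt k"
  have fl: "real t = of_int \<lfloor>sqrt (real k)\<rfloor>" unfolding t_def isqrt_def by simp
  show "real (isqrt k) \<le> sqrt (real k)" using fl unfolding t_def[symmetric] by linarith
  have "sqrt (real k) < real t + 1" using fl by linarith
  hence "(sqrt (real k))\<^sup>2 < (real t + 1)\<^sup>2" by (intro power_strict_mono) auto
  hence "real k < real ((t + 1)\<^sup>2)" by (simp add: add.commute)
  hence "Suc k \<le> (t + 1)\<^sup>2" by (simp only: of_nat_less_iff Suc_le_eq)
  hence "real (Suc k) \<le> real ((t + 1)\<^sup>2)" by (simp only: of_nat_le_iff)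
  hence "sqrt (real (Suc k)) \<le> real t + 1" by (intro real_le_lsqrt) (auto simp: power2_eq_square algebra_simps)
  thus "sqrt (real (Suc k)) \<le> real (isqrt k) + 1" by (simp add: t_def)
qed

text \<open>
The constant 14 consists of 6 for the link that is cut and 8 for the Riemann sum; 21 is the cost of a row.
\<close>

lemma goe_block_arcsine:
  assumes f: "1-lipschitz_on UNIV f" "\<And>x. \<bar>f x\<bar> \<le> 1" and \<kappa>: "\<kappa> > 0"
    and t: "t > 0" "t\<^sup>2 \<le> n" "n \<le> (Suc t)\<^sup>2"
    and D: "\<bar>goe_mean (t\<^sup>2) \<kappa> f - (\<Sum>k<t\<^sup>2. arcsine_mean f (\<kappa> * real (isqrt k)))\<bar> \<le> E"
  shows "\<bar>goe_mean n \<kappa> f - (\<Sum>k<n. arcsine_mean f (\<kappa> * real (isqrt k)))\<bar> \<le> E + 21 * \<kappa> * (real n - (real t)\<^sup>2) + 14 * \<kappa> * real t + 2"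
proof -
  have "\<bar>goe_mean n \<kappa> f - (spec_sum (n - t\<^sup>2) f (tridiag (\<kappa> * real t)) + goe_mean (t\<^sup>2) \<kappa> f)\<bar>
    \<le> 21 * \<kappa> * real (n - t\<^sup>2) + 6 * \<kappa> * real t"
    by (rule goe_block[OF f]) (use \<kappa> t in auto)
  moreover have "\<bar>spec_sum (n - t\<^sup>2) f (tridiag (\<kappa> * real t)) - real (n - t\<^sup>2) * arcsine_mean f (\<kappa> * real t)\<bar> \<le> 8 * (\<kappa> * real t) + 2"
    by (rule tridiag_arcsine[OF f]) (use \<kappa> t in auto)
  moreover have "(\<Sum>k<n. arcsine_mean f (\<kappa> * real (isqrt k))) = (\<Sum>k<t\<^sup>2. arcsine_mean f (\<kappa> * real (isqrt k))) + real (n - t\<^sup>2) * arcsine_mean f (\<kappa> * real t)"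
  proof -
    have "(\<Sum>k<n. arcsine_mean f (\<kappa> * real (isqrt k))) = (\<Sum>k<t\<^sup>2. arcsine_mean f (\<kappa> * real (isqrt k))) + (\<Sum>k=t\<^sup>2..<n. arcsine_mean f (\<kappa> * real (isqrt k)))"
      using t(2) by (metis sum.atLeastLessThan_concat atLeast0LessThan le0)
    also have "(\<Sum>k=t\<^sup>2..<n. arcsine_mean f (\<kappa> * real (isqrt k))) = (\<Sum>k=t\<^sup>2..<n. arcsine_mean f (\<kappa> * real t))"
    proof (intro sum.cong refl)
      fix k assume "k \<in> {t\<^sup>2..<n}"
      hence "isqrt k = t" using t by (intro isqrt_eqI) auto
      thus "arcsine_mean f (\<kappa> * real (isqrt k)) = arcsine_mean f (\<kappa> * real t)" by simp
    qed
    finally show ?thesis by simp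
  qed
  moreover have "real (n - t\<^sup>2) = real n - (real t)\<^sup>2" using t(2) by (simp add: of_nat_diff)
  ultimately show ?thesis using D by simp
qed

text \<open>
Induction over the squares up to \<open>n\<close>, followed by one incomplete block. The costs \<open>O(\<kappa> * t)\<close> per block sum to
\<open>O(\<kappa> * n)\<close>, and the constant costs to \<open>O(sqrt n)\<close>, since there are at most \<open>sqrt n\<close> blocks.
\<close>

lemma goe_mean_arcsine:
  assumes f: "1-lipschitz_on UNIV f" "\<And>x. \<bar>f x\<bar> \<le> 1" and \<kappa>: "\<kappa> > 0" and n: "n > 0"
  shows "\<bar>goe_mean n \<kappa> f - (\<Sum>k<n. arcsine_mean f (\<kappa> * real (isqrt k)))\<bar> \<le> 49 * \<kappa> * real n + 4 * sqrt (real n)"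
proof -
  have sq: "\<bar>goe_mean (t\<^sup>2) \<kappa> f - (\<Sum>k<t\<^sup>2. arcsine_mean f (\<kappa> * real (isqrt k)))\<bar> \<le> 35 * \<kappa> * (real t)\<^sup>2 + 2 * real t"
    if "t > 0" for t
    using that
  proof (induction t rule: nat_induct_non_zero)
    case 1
    have "\<bar>goe_mean 1 \<kappa> f\<bar> \<le> 1" using goe_mean_bound[OF f, of 1 \<kappa>] by simp
    moreover have "\<bar>arcsine_mean f (\<kappa> * real (isqrt 0))\<bar> \<le> 1" by (rule arcsine_mean_bound[OF f])
    ultimately show ?case using \<kappa> by simp
  next
    case (Suc t)
    have "\<bar>goe_mean ((Suc t)\<^sup>2) \<kappa> f - (\<Sum>k<(Suc t)\<^sup>2. arcsine_mean f (\<kappa> * real (isqrt k)))\<bar>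
        \<le> (35 * \<kappa> * (real t)\<^sup>2 + 2 * real t) + 21 * \<kappa> * (real ((Suc t)\<^sup>2) - (real t)\<^sup>2) + 14 * \<kappa> * real t + 2"
      by (rule goe_block_arcsine[OF f \<kappa> _ _ _ Suc.IH]) (use Suc.hyps in \<open>auto intro: power_mono\<close>)
    also have "\<dots> = (35 * \<kappa> * (real t)\<^sup>2 + 2 * real t) + 21 * \<kappa> * (2 * real t + 1) + 14 * \<kappa> * real t + 2"
      by (simp add: power2_eq_square algebra_simps)
    also have "\<dots> \<le> 35 * \<kappa> * (real (Suc t))\<^sup>2 + 2 * real (Suc t)"
      using \<kappa> by (simp add: power2_eq_square algebra_simps)
    finally show ?case .
  qed
  define t where "t = isqrt n"
  have tb: "real t \<le> sqrt (real n)" "sqrt (real (Suc n)) \<le> real t + 1" using isqrt_bounds[of n] by (simp_all add: t_def)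
  have "sqrt (real (Suc n)) > 1" using n by simp
  hence "real t > 0" using tb(2) by linarith
  hence t0: "t > 0" "real t \<ge> 1" by auto
  have "(real t)\<^sup>2 \<le> (sqrt (real n))\<^sup>2" using tb(1) by (intro power_mono) auto
  hence tn: "(real t)\<^sup>2 \<le> real n" by simp
  hence 1: "t\<^sup>2 \<le> n" by (metis of_nat_le_iff of_nat_power)
  have "(sqrt (real (Suc n)))\<^sup>2 \<le> (real t + 1)\<^sup>2" using tb(2) by (intro power_mono) auto
  hence "real n \<le> real ((Suc t)\<^sup>2)" by (simp add: add.commute)
  hence 2: "n \<le> (Suc t)\<^sup>2" by (simp only: of_nat_le_iff)
  have "\<bar>goe_mean n \<kappa> f - (\<Sum>k<n. arcsine_mean f (\<kappa> * real (isqrt k)))\<bar>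
      \<le> (35 * \<kappa> * (real t)\<^sup>2 + 2 * real t) + 21 * \<kappa> * (real n - (real t)\<^sup>2) + 14 * \<kappa> * real t + 2"
    by (rule goe_block_arcsine[OF f \<kappa> t0(1) 1 2 sq[OF t0(1)]])
  also have "\<dots> = 21 * \<kappa> * real n + 14 * \<kappa> * (real t)\<^sup>2 + 14 * \<kappa> * real t + 2 * real t + 2"
    by (simp add: algebra_simps)
  also have "\<dots> \<le> 21 * \<kappa> * real n + 14 * \<kappa> * real n + 14 * \<kappa> * real n + 2 * sqrt (real n) + 2 * sqrt (real n)"
  proof (intro add_mono mult_left_mono order_refl)
    have "real t * 1 \<le> real t * real t" using t0 by (intro mult_left_mono) auto
    thus "real t \<le> real n" using tn by (simp add: power2_eq_square)
    show "2 \<le> 2 * sqrt (real n)" using n by simp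
  qed (use \<kappa> tn tb in auto)
  finally show ?thesis by (simp add: algebra_simps)
qed

section \<open>The semicircle law as the shadow of a disc\<close>

lemma arcsine_mean_continuous:
  assumes f: "1-lipschitz_on UNIV f" shows "continuous_on S (arcsine_mean f)"
proof -
  have "2-lipschitz_on UNIV (arcsine_mean f)"
    by (rule lipschitz_onI) (use arcsine_mean_lipschitz[OF f] in \<open>auto simp: dist_real_def\<close>)
  thus ?thesis by (rule lipschitz_cont)
qed

text \<open>
The mean of \<open>f\<close> at the first coordinate of a uniform point in the disc of radius \<open>2 * s\<close>: the distance
from the centre is \<open>2 * s * \<rho>\<close>, where \<open>\<rho>\<close> has density \<open>2 * \<rho>\<close>.
\<close>

definition radial_mean :: "(real \<Rightarrow> real) \<Rightarrow> real \<Rightarrow> real" where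
  "radial_mean f s = integral {0..1} (\<lambda>\<rho>. arcsine_mean f (s * \<rho>) * (2 * \<rho>))"

lemma has_integral_linear_weight:
  assumes "a \<le> b" shows "((\<lambda>\<rho>. c * (2 * \<rho>)) has_integral c * (b\<^sup>2 - a\<^sup>2)) {a..b :: real}"
proof -
  have "((\<lambda>\<rho>. c * (2 * \<rho>)) has_integral (c * b\<^sup>2 - c * a\<^sup>2)) {a..b}"
  proof (rule fundamental_theorem_of_calculus[OF assms])
    fix x
    have "((\<lambda>\<rho>. c * \<rho>\<^sup>2) has_real_derivative c * (2 * x)) (at x within {a..b})"
      by (auto intro!: derivative_eq_intros)
    thus "((\<lambda>\<rho>. c * \<rho>\<^sup>2) has_vector_derivative c * (2 * x)) (at x within {a..b})"
      by (simp add: has_real_derivative_iff_has_vector_derivative)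
  qed
  thus ?thesis by (simp add: right_diff_distrib)
qed

text \<open>
The interval from \<open>sqrt (k / n)\<close> to \<open>sqrt ((k+1) / n)\<close> has weight \<open>1 / n\<close> under the density \<open>2 * \<rho>\<close>, and on it
\<open>\<rho>\<close> differs from \<open>isqrt k / sqrt n\<close> by at most \<open>1 / sqrt n\<close>.
\<close>

lemma radial_riemann:
  assumes f: "1-lipschitz_on UNIV f" and \<gamma>: "0 \<le> \<gamma>" "\<gamma> \<le> 1" and n: "n > 0"
  shows "\<bar>radial_mean f s - (\<Sum>k<n. arcsine_mean f (\<gamma> / sqrt (real n) * real (isqrt k))) / real n\<bar>
    \<le> 2 * (\<bar>s - \<gamma>\<bar> + 1 / sqrt (real n))"
proof -
  define \<epsilon> where "\<epsilon> = 2 * (\<bar>s - \<gamma>\<bar> + 1 / sqrt (real n))"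
  define N where "N = real n"
  have N: "N > 0" using n by (simp add: N_def)
  define c where "c k = arcsine_mean f (\<gamma> / sqrt N * real (isqrt k))" for k
  define F where "F \<rho> = arcsine_mean f (s * \<rho>) * (2 * \<rho>)" for \<rho>
  have contF: "continuous_on S F" for S unfolding F_def
    by (intro continuous_intros continuous_on_compose2[OF arcsine_mean_continuous[OF f, of UNIV]]) auto
  have intF: "F integrable_on {a..b}" for a b
    by (intro integrable_continuous_interval contF)
  have "\<bar>integral {0..sqrt (real J / N)} F - (\<Sum>k<J. c k) / N\<bar> \<le> real J / N * \<epsilon>" if "J \<le> n" for J
    using that
  proof (induction J)
    case (Suc J)
    define a b where "a = sqrt (real J / N)" and "b = sqrt (real (Suc J) / N)"
    have ab: "0 \<le> a" "a \<le> b" "b \<le> 1" "b\<^sup>2 - a\<^sup>2 = 1 / N"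
      using N Suc.prems by (auto simp: a_def b_def N_def divide_right_mono field_simps)
    have comb: "integral {0..a} F + integral {a..b} F = integral {0..b} F"
      by (rule Henstock_Kurzweil_Integration.integral_combine[OF ab(1,2) intF])
    have w: "((\<lambda>\<rho>. K * (2 * \<rho>)) has_integral K / N) {a..b}" for K
      using has_integral_linear_weight[OF ab(2), of K] ab(4) by simp
    have "norm (integral {a..b} (\<lambda>\<rho>. F \<rho> - c J * (2 * \<rho>))) \<le> integral {a..b} (\<lambda>\<rho>. \<epsilon> * (2 * \<rho>))"
    proof (rule integral_norm_bound_integral)
      show "(\<lambda>\<rho>. F \<rho> - c J * (2 * \<rho>)) integrable_on {a..b}"
        by (intro integrable_continuous_interval continuous_intros contF)
      show "(\<lambda>\<rho>. \<epsilon> * (2 * \<rho>)) integrable_on {a..b}" using w by (rule has_integral_integrable)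
      fix \<rho> assume \<rho>: "\<rho> \<in> {a..b}"
      hence \<rho>01: "0 \<le> \<rho>" "\<rho> \<le> 1" using ab by auto
      define i where "i = real (isqrt J) / sqrt N"
      have "i \<le> a" "b \<le> i + 1 / sqrt N"
        using isqrt_bounds[of J] N
        by (simp_all add: i_def a_def b_def real_sqrt_divide divide_right_mono flip: add_divide_distrib)
      hence di: "\<bar>\<rho> - i\<bar> \<le> 1 / sqrt N" using \<rho> by auto
      have "\<bar>s * \<rho> - \<gamma> * i\<bar> = \<bar>(s - \<gamma>) * \<rho> + \<gamma> * (\<rho> - i)\<bar>" by (simp add: algebra_simps)
      also have "\<dots> \<le> \<bar>s - \<gamma>\<bar> * \<rho> + \<gamma> * \<bar>\<rho> - i\<bar>"
        using \<rho>01 \<gamma> by (intro order_trans[OF abs_triangle_ineq]) (simp add: abs_mult)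
      also have "\<dots> \<le> \<bar>s - \<gamma>\<bar> * 1 + 1 * (1 / sqrt N)"
        using \<rho>01 \<gamma> di by (intro add_mono mult_mono) auto
      finally have d: "2 * \<bar>s * \<rho> - \<gamma> * i\<bar> \<le> \<epsilon>" by (simp add: \<epsilon>_def N_def)
      have "c J = arcsine_mean f (\<gamma> * i)" by (simp add: c_def i_def)
      hence "\<bar>arcsine_mean f (s * \<rho>) - c J\<bar> \<le> \<epsilon>" using arcsine_mean_lipschitz[OF f, of "s * \<rho>" "\<gamma> * i"] d by simp
      hence "\<bar>arcsine_mean f (s * \<rho>) - c J\<bar> * (2 * \<rho>) \<le> \<epsilon> * (2 * \<rho>)" using \<rho>01 by (intro mult_right_mono) auto
      moreover have "F \<rho> - c J * (2 * \<rho>) = (arcsine_mean f (s * \<rho>) - c J) * (2 * \<rho>)" by (simp add: F_def left_diff_distrib)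
      ultimately show "norm (F \<rho> - c J * (2 * \<rho>)) \<le> \<epsilon> * (2 * \<rho>)" using \<rho>01 by (simp add: abs_mult)
    qed
    moreover have "integral {a..b} (\<lambda>\<rho>. F \<rho> - c J * (2 * \<rho>)) = integral {a..b} F - c J / N"
      using Henstock_Kurzweil_Integration.integral_diff[OF intF has_integral_integrable[OF w]] integral_unique[OF w] by simp
    moreover have "integral {a..b} (\<lambda>\<rho>. \<epsilon> * (2 * \<rho>)) = \<epsilon> / N" by (rule integral_unique[OF w])
    moreover have "\<bar>integral {0..a} F - (\<Sum>k<J. c k) / N\<bar> \<le> real J / N * \<epsilon>"
      using Suc by (simp add: a_def)
    moreover have "real (Suc J) / N * \<epsilon> = real J / N * \<epsilon> + \<epsilon> / N" by (simp add: add_divide_distrib distrib_right)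
    moreover have "(\<Sum>k<Suc J. c k) / N = (\<Sum>k<J. c k) / N + c J / N" by (simp add: add_divide_distrib)
    ultimately show ?case using comb unfolding b_def[symmetric] real_norm_def by linarith
  qed simp
  from this[of n] N show ?thesis
    by (simp add: radial_mean_def F_def[abs_def] c_def N_def \<epsilon>_def)
qed

text \<open>
For given \<open>\<theta>\<close> the substitution \<open>x = 2 * s * \<rho> * cos \<theta>\<close> turns the joint density of \<open>\<rho>\<close> and \<open>\<theta>\<close> into the
function \<open>h \<theta>\<close> of \<open>x\<close>. For given \<open>x\<close> it is a multiple of \<open>1 / (cos \<theta>)\<^sup>2\<close> on an interval of angles with one
end at \<open>arccos (x / (2 * s))\<close>, and the antiderivative \<open>tan\<close> produces the semicircle density.
\<close>

lemma semicircle_kernel: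
  fixes s x :: real
  assumes s: "s > 0" and x: "x \<noteq> 0"
  defines "h \<equiv> \<lambda>\<theta>. indicator {0..1} (x / (2 * s * cos \<theta>)) * (2 * (x / (2 * s * cos \<theta>)) / (\<bar>2 * s * cos \<theta>\<bar> * pi)) * indicator {0..pi} \<theta>"
  shows "(\<integral>\<^sup>+\<theta>. ennreal (h \<theta>) \<partial>lborel)
     = ennreal (1 / (2 * pi * s\<^sup>2) * sqrt (4 * s\<^sup>2 - x\<^sup>2) * indicator {-2 * s..2 * s} x)"
proof (cases "\<bar>x\<bar> \<le> 2 * s")
  case False
  have "h \<theta> = 0" for \<theta>
  proof (cases "x / (2 * s * cos \<theta>) \<in> {0..1} \<and> cos \<theta> \<noteq> 0")
    case True
    define c where "c = 2 * s * cos \<theta>"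
    have "c \<noteq> 0" using True s by (simp add: c_def)
    have "0 \<le> x / c" "x / c \<le> 1" using True by (simp_all add: c_def)
    hence "\<bar>x / c\<bar> \<le> 1" by (simp only: abs_of_nonneg)
    hence "\<bar>x\<bar> \<le> \<bar>c\<bar>" using \<open>c \<noteq> 0\<close> by (simp add: abs_divide divide_le_eq)
    also have "\<bar>c\<bar> \<le> 2 * s" using s abs_cos_le_one[of \<theta>] by (simp add: c_def abs_mult)
    finally show ?thesis using False by simp
  qed (auto simp: h_def)
  thus ?thesis using False by (auto simp: indicator_def)
next
  case le: True
  define y where "y = x / (2 * s)"
  have y: "-1 \<le> y" "y \<le> 1" "y \<noteq> 0" using le s x by (auto simp: y_def field_simps)
  have xy: "x = 2 * s * y" using s by (simp add: y_def)
  define A where "A = arccos y"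
  have A: "0 \<le> A" "A \<le> pi" "cos A = y" "sin A = sqrt (1 - y\<^sup>2)"
    using y by (auto simp: A_def arccos_lbound arccos_ubound sin_arccos)
  define K where "K = \<bar>x\<bar> / (2 * pi * s\<^sup>2)"
  have K: "K \<ge> 0" using s by (simp add: K_def)
  define a b where "a = (if y > 0 then 0 else A)" and "b = (if y > 0 then A else pi)"
  have ab: "a \<le> b" "0 \<le> a" "b \<le> pi" using A by (auto simp: a_def b_def)
  have cosle: "cos \<theta> \<le> y \<longleftrightarrow> A \<le> \<theta>" if "\<theta> \<in> {0..pi}" for \<theta>
    using cos_mono_le_eq[of \<theta> A] that A by auto
  have cosge: "y \<le> cos \<theta> \<longleftrightarrow> \<theta> \<le> A" if "\<theta> \<in> {0..pi}" for \<theta>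
    using cos_mono_le_eq[of A \<theta>] that A by auto
  have cosab: "cos \<theta> * y > 0 \<and> \<bar>y\<bar> \<le> \<bar>cos \<theta>\<bar>" if "a \<le> \<theta>" "\<theta> \<le> b" for \<theta>
  proof (cases "y > 0")
    case True
    hence "y \<le> cos \<theta>" using that cosge[of \<theta>] ab by (auto simp: a_def b_def)
    thus ?thesis using True by auto
  next
    case False
    hence "cos \<theta> \<le> y" "y < 0" using that cosle[of \<theta>] ab y by (auto simp: a_def b_def)
    thus ?thesis by (auto simp: mult_neg_neg)
  qed
  have h: "h \<theta> = K * inverse ((cos \<theta>)\<^sup>2) * indicator {a..b} \<theta>" for \<theta>
  proof (cases "\<theta> \<in> {0..pi}")
    case th: True
    have q: "x / (2 * s * cos \<theta>) = y / cos \<theta>" using s by (simp add: y_def)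
    show ?thesis
    proof (cases "\<theta> \<in> {a..b}")
      case True
      hence c: "cos \<theta> * y > 0" "\<bar>y\<bar> \<le> \<bar>cos \<theta>\<bar>" using cosab by auto
      hence "0 \<le> y / cos \<theta>" "y / cos \<theta> \<le> 1"
        by (auto simp: zero_less_mult_iff zero_le_divide_iff divide_le_eq_1)
      moreover have "2 * (y / cos \<theta>) / (\<bar>2 * s * cos \<theta>\<bar> * pi) = K * inverse ((cos \<theta>)\<^sup>2)"
        using c s by (auto simp: K_def xy abs_mult zero_less_mult_iff field_simps power2_eq_square)
      ultimately show ?thesis using True th unfolding h_def q by simp
    next
      case False
      have "\<not> (0 \<le> y / cos \<theta> \<and> y / cos \<theta> \<le> 1) \<or> cos \<theta> = 0"
      proof (cases "y > 0")
        case True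
        hence "\<not> \<theta> \<le> A" using False th by (auto simp: a_def b_def)
        hence "cos \<theta> < y" using cosge[OF th] by auto
        thus ?thesis using True by (auto simp: zero_le_divide_iff divide_le_eq_1)
      next
        case yn: False
        hence "\<not> A \<le> \<theta>" using False th by (auto simp: a_def b_def)
        hence "y < cos \<theta>" using cosle[OF th] by auto
        thus ?thesis using yn y by (auto simp: zero_le_divide_iff divide_le_eq_1)
      qed
      thus ?thesis using False unfolding h_def q by (auto simp: indicator_def)
    qed
  next
    case False
    thus ?thesis using ab by (auto simp: h_def indicator_def)
  qed
  have "(\<integral>\<^sup>+\<theta>. ennreal (h \<theta>) \<partial>lborel) = (\<integral>\<^sup>+\<theta>. ennreal (K * inverse ((cos \<theta>)\<^sup>2)) * indicator {a..b} \<theta> \<partial>lborel)"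
    by (intro nn_integral_cong) (auto simp: h indicator_def)
  also have "\<dots> = ennreal (K * tan b - K * tan a)"
  proof (rule nn_integral_FTC_Icc)
    show "((\<lambda>\<theta>. K * tan \<theta>) has_real_derivative K * inverse ((cos \<theta>)\<^sup>2)) (at \<theta>)"
      if "\<theta> \<in> {a..b}" for \<theta>
    proof -
      have "cos \<theta> \<noteq> 0" using cosab[of \<theta>] that by auto
      thus ?thesis by (intro DERIV_cmult DERIV_tan)
    qed
  qed (use K ab in auto)
  also have "K * tan b - K * tan a = K * (sqrt (1 - y\<^sup>2) / \<bar>y\<bar>)"
    using y A by (auto simp: a_def b_def tan_def)
  also have "\<dots> = 1 / (2 * pi * s\<^sup>2) * sqrt (4 * s\<^sup>2 - x\<^sup>2)"
  proof -
    have "4 * s\<^sup>2 - x\<^sup>2 = (2 * s)\<^sup>2 * (1 - y\<^sup>2)" by (simp add: xy power_mult_distrib right_diff_distrib)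
    hence "sqrt (4 * s\<^sup>2 - x\<^sup>2) = 2 * s * sqrt (1 - y\<^sup>2)" using s by (simp add: real_sqrt_mult)
    thus ?thesis using s y by (simp add: K_def xy abs_mult field_simps)
  qed
  finally show ?thesis using le by (simp add: indicator_def abs_le_iff)
qed

lemma nn_integral_semicircle:
  fixes g :: "real \<Rightarrow> ennreal"
  assumes s: "s > 0" and [measurable]: "g \<in> borel_measurable borel"
  shows "(\<integral>\<^sup>+x. g x \<partial>semicircle (s\<^sup>2))
    = (\<integral>\<^sup>+\<rho>. \<integral>\<^sup>+\<theta>. g (2 * s * \<rho> * cos \<theta>) * ennreal (2 * \<rho> / pi * indicator {0..1} \<rho> * indicator {0..pi} \<theta>) \<partial>lborel \<partial>lborel)"
proof -
  define h where "h \<theta> x = indicator {0..1} (x / (2 * s * cos \<theta>)) * (2 * (x / (2 * s * cos \<theta>)) / (\<bar>2 * s * cos \<theta>\<bar> * pi)) * indicator {0..pi} \<theta>"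
    for \<theta> x :: real
  have hm[measurable]: "case_prod h \<in> borel_measurable (lborel \<Otimes>\<^sub>M lborel)"
    unfolding h_def case_prod_beta by measurable
  have inner: "(\<integral>\<^sup>+\<rho>. g (2 * s * \<rho> * cos \<theta>) * ennreal (2 * \<rho> / pi * indicator {0..1} \<rho> * indicator {0..pi} \<theta>) \<partial>lborel)
      = (\<integral>\<^sup>+x. g x * ennreal (h \<theta> x) \<partial>lborel)" if "cos \<theta> \<noteq> 0" for \<theta>
  proof -
    define c where "c = 2 * s * cos \<theta>"
    have c: "c \<noteq> 0" using that s by (simp add: c_def)
    have [measurable]: "h \<theta> \<in> borel_measurable borel" unfolding h_def by measurable
    have "(\<integral>\<^sup>+x. g x * ennreal (h \<theta> x) \<partial>lborel) = ennreal \<bar>c\<bar> * (\<integral>\<^sup>+\<rho>. g (0 + c * \<rho>) * ennreal (h \<theta> (0 + c * \<rho>)) \<partial>lborel)"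
      by (rule nn_integral_real_affine[OF _ c]) measurable
    also have "\<dots> = (\<integral>\<^sup>+\<rho>. ennreal \<bar>c\<bar> * (g (0 + c * \<rho>) * ennreal (h \<theta> (0 + c * \<rho>))) \<partial>lborel)"
      by (rule nn_integral_cmult[symmetric]) measurable
    also have "\<dots> = (\<integral>\<^sup>+\<rho>. g (2 * s * \<rho> * cos \<theta>) * ennreal (2 * \<rho> / pi * indicator {0..1} \<rho> * indicator {0..pi} \<theta>) \<partial>lborel)"
    proof (intro nn_integral_cong)
      fix \<rho> :: real
      have "\<bar>c\<bar> * h \<theta> (c * \<rho>) = 2 * \<rho> / pi * indicator {0..1} \<rho> * indicator {0..pi} \<theta>"
        using c by (simp add: h_def flip: c_def)
      moreover have "ennreal \<bar>c\<bar> * ennreal (h \<theta> (c * \<rho>)) = ennreal (\<bar>c\<bar> * h \<theta> (c * \<rho>))"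
        by (simp add: ennreal_mult')
      moreover have "2 * s * \<rho> * cos \<theta> = c * \<rho>" by (simp add: c_def)
      moreover have "ennreal \<bar>c\<bar> * (g (c * \<rho>) * ennreal (h \<theta> (c * \<rho>))) = g (c * \<rho>) * (ennreal \<bar>c\<bar> * ennreal (h \<theta> (c * \<rho>)))"
        by (rule mult.left_commute)
      ultimately show "ennreal \<bar>c\<bar> * (g (0 + c * \<rho>) * ennreal (h \<theta> (0 + c * \<rho>)))
          = g (2 * s * \<rho> * cos \<theta>) * ennreal (2 * \<rho> / pi * indicator {0..1} \<rho> * indicator {0..pi} \<theta>)"
        by (simp only: add_0_left)
    qed
    finally show ?thesis by simp
  qed
  have "(\<integral>\<^sup>+\<rho>. \<integral>\<^sup>+\<theta>. g (2 * s * \<rho> * cos \<theta>) * ennreal (2 * \<rho> / pi * indicator {0..1} \<rho> * indicator {0..pi} \<theta>) \<partial>lborel \<partial>lborel)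
     = (\<integral>\<^sup>+\<theta>. \<integral>\<^sup>+\<rho>. g (2 * s * \<rho> * cos \<theta>) * ennreal (2 * \<rho> / pi * indicator {0..1} \<rho> * indicator {0..pi} \<theta>) \<partial>lborel \<partial>lborel)"
    by (rule lborel_pair.Fubini') measurable
  also have "\<dots> = (\<integral>\<^sup>+\<theta>. \<integral>\<^sup>+x. g x * ennreal (h \<theta> x) \<partial>lborel \<partial>lborel)"
  proof (intro nn_integral_cong_AE)
    have "AE \<theta> in lborel. \<theta> \<noteq> pi / 2" by (rule AE_lborel_singleton)
    thus "AE \<theta> in lborel. (\<integral>\<^sup>+\<rho>. g (2 * s * \<rho> * cos \<theta>) * ennreal (2 * \<rho> / pi * indicator {0..1} \<rho> * indicator {0..pi} \<theta>) \<partial>lborel)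
        = (\<integral>\<^sup>+x. g x * ennreal (h \<theta> x) \<partial>lborel)"
    proof eventually_elim
      case (elim \<theta>)
      show ?case
      proof (cases "\<theta> \<in> {0..pi}")
        case True
        have "cos \<theta> \<noteq> 0"
          using elim True cos_inj_pi[of \<theta> "pi / 2"] by auto
        thus ?thesis by (rule inner)
      qed (simp add: h_def)
    qed
  qed
  also have "\<dots> = (\<integral>\<^sup>+x. \<integral>\<^sup>+\<theta>. g x * ennreal (h \<theta> x) \<partial>lborel \<partial>lborel)"
    by (rule lborel_pair.Fubini'[symmetric]) (unfold h_def, measurable)
  also have "\<dots> = (\<integral>\<^sup>+x. ennreal (1 / (2 * pi * s\<^sup>2) * sqrt (4 * s\<^sup>2 - x\<^sup>2) * indicator {-2 * s..2 * s} x) * g x \<partial>lborel)"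
  proof (intro nn_integral_cong_AE)
    have "AE x in lborel. x \<noteq> (0 :: real)" by (rule AE_lborel_singleton)
    thus "AE x in lborel. (\<integral>\<^sup>+\<theta>. g x * ennreal (h \<theta> x) \<partial>lborel)
        = ennreal (1 / (2 * pi * s\<^sup>2) * sqrt (4 * s\<^sup>2 - x\<^sup>2) * indicator {-2 * s..2 * s} x) * g x"
    proof eventually_elim
      case (elim x)
      have [measurable]: "(\<lambda>\<theta>. h \<theta> x) \<in> borel_measurable borel" unfolding h_def by measurable
      have "(\<integral>\<^sup>+\<theta>. g x * ennreal (h \<theta> x) \<partial>lborel) = g x * (\<integral>\<^sup>+\<theta>. ennreal (h \<theta> x) \<partial>lborel)"
        by (rule nn_integral_cmult) measurable
      thus ?case using semicircle_kernel[OF s elim] by (simp add: h_def mult.commute)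
    qed
  qed
  also have "\<dots> = (\<integral>\<^sup>+x. g x \<partial>semicircle (s\<^sup>2))"
    unfolding semicircle_def using s by (subst nn_integral_density) auto
  finally show ?thesis by simp
qed

lemma nn_integral_interval:
  fixes g :: "real \<Rightarrow> real"
  assumes "continuous_on {a..b} g" "\<And>x. x \<in> {a..b} \<Longrightarrow> g x \<ge> 0"
  shows "(\<integral>\<^sup>+x. ennreal (g x * indicator {a..b} x) \<partial>lborel) = ennreal (integral {a..b} g)"
proof (rule nn_integral_has_integral_lborel)
  have "(\<lambda>x. indicator {a..b} x *\<^sub>R g x) \<in> borel_measurable borel"
    by (rule borel_measurable_continuous_on_indicator) (use assms in auto)
  thus "(\<lambda>x. g x * indicator {a..b} x) \<in> borel_measurable borel" by (simp add: mult.commute)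
  show "0 \<le> g x * indicator {a..b} x" for x using assms(2) by (auto simp: indicator_def)
  have "(g has_integral integral {a..b} g) {a..b}"
    by (intro integrable_integral integrable_continuous_interval assms)
  hence "((\<lambda>x. if x \<in> {a..b} then g x else 0) has_integral integral {a..b} g) UNIV"
    by (simp only: has_integral_restrict_UNIV)
  moreover have "(\<lambda>x. if x \<in> {a..b} then g x else 0) = (\<lambda>x. g x * indicator {a..b} x)"
    by (auto simp: indicator_def)
  ultimately show "((\<lambda>x. g x * indicator {a..b} x) has_integral integral {a..b} g) UNIV" by simp
qed

lemma nn_integral_semicircle_lipschitz:
  assumes s: "s > 0" and f: "1-lipschitz_on UNIV f" and nn: "\<And>x. f x \<ge> 0"
  shows "(\<integral>\<^sup>+x. ennreal (f x) \<partial>semicircle (s\<^sup>2)) = ennreal (radial_mean f s)"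
proof -
  have cont: "continuous_on S f" for S by (rule lipschitz_cont[OF f])
  have [measurable]: "f \<in> borel_measurable borel" by (rule borel_measurable_continuous_onI[OF cont])
  have cc: "continuous_on S (\<lambda>\<theta>. f (2 * s * \<rho> * cos \<theta>))" for S \<rho>
    by (intro continuous_on_compose2[OF cont[of UNIV]] continuous_intros) auto
  have arcs0: "arcsine_mean f b \<ge> 0" for b unfolding arcsine_mean_def
    by (intro divide_nonneg_nonneg Henstock_Kurzweil_Integration.integral_nonneg arcsine_mean_integrable[OF f]) (auto simp: nn)
  have "(\<integral>\<^sup>+\<theta>. ennreal (f (2 * s * \<rho> * cos \<theta>)) * ennreal (2 * \<rho> / pi * indicator {0..1} \<rho> * indicator {0..pi} \<theta>) \<partial>lborel)
      = ennreal (arcsine_mean f (s * \<rho>) * (2 * \<rho>) * indicator {0..1} \<rho>)" for \<rho> :: real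
  proof (cases "\<rho> \<in> {0..1}")
    case True
    have "(\<integral>\<^sup>+\<theta>. ennreal (f (2 * s * \<rho> * cos \<theta>)) * ennreal (2 * \<rho> / pi * indicator {0..1} \<rho> * indicator {0..pi} \<theta>) \<partial>lborel)
        = (\<integral>\<^sup>+\<theta>. ennreal (2 * \<rho> / pi) * ennreal (f (2 * s * \<rho> * cos \<theta>) * indicator {0..pi} \<theta>) \<partial>lborel)"
      using True nn by (intro nn_integral_cong) (auto simp: indicator_def ennreal_mult mult.commute)
    also have "\<dots> = ennreal (2 * \<rho> / pi) * ennreal (integral {0..pi} (\<lambda>\<theta>. f (2 * s * \<rho> * cos \<theta>)))"
      by (subst nn_integral_cmult, measurable, subst nn_integral_interval[OF cc]) (auto simp: nn)
    also have "\<dots> = ennreal (2 * \<rho> / pi * integral {0..pi} (\<lambda>\<theta>. f (2 * s * \<rho> * cos \<theta>)))"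
      using True by (intro ennreal_mult'[symmetric]) auto
    also have "2 * \<rho> / pi * integral {0..pi} (\<lambda>\<theta>. f (2 * s * \<rho> * cos \<theta>)) = arcsine_mean f (s * \<rho>) * (2 * \<rho>)"
      by (simp add: arcsine_mean_def mult.assoc)
    finally show ?thesis using True by simp
  qed simp
  hence "(\<integral>\<^sup>+x. ennreal (f x) \<partial>semicircle (s\<^sup>2)) = (\<integral>\<^sup>+\<rho>. ennreal (arcsine_mean f (s * \<rho>) * (2 * \<rho>) * indicator {0..1} \<rho>) \<partial>lborel)"
    using nn_integral_semicircle[OF s, of "\<lambda>x. ennreal (f x)"] by simp
  also have "\<dots> = ennreal (radial_mean f s)"
    unfolding radial_mean_def
  proof (rule nn_integral_interval)
    show "continuous_on {0..1} (\<lambda>\<rho>. arcsine_mean f (s * \<rho>) * (2 * \<rho>))"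
      by (intro continuous_intros continuous_on_compose2[OF arcsine_mean_continuous[OF f, of UNIV]]) auto
  qed (use arcs0 in auto)
  finally show ?thesis .
qed

lemma prob_space_semicircle:
  assumes s: "s > 0" shows "prob_space (semicircle (s\<^sup>2))"
proof (rule prob_spaceI)
  have a: "arcsine_mean (\<lambda>_. 1) b = 1" for b by (simp add: arcsine_mean_def)
  have "radial_mean (\<lambda>_. 1) s = 1" unfolding radial_mean_def a
    by (rule integral_unique) (use has_integral_linear_weight[of 0 1 1] in simp)
  moreover have "1-lipschitz_on UNIV (\<lambda>_ :: real. 1 :: real)" by (rule lipschitz_onI) auto
  ultimately have "(\<integral>\<^sup>+x. ennreal 1 \<partial>semicircle (s\<^sup>2)) = 1"
    using nn_integral_semicircle_lipschitz[OF s, of "\<lambda>_. 1"] by simp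
  thus "emeasure (semicircle (s\<^sup>2)) (space (semicircle (s\<^sup>2))) = 1" by simp
qed

text \<open>
The identity for nonnegative functions is applied to \<open>f + 1\<close>.
\<close>

lemma integral_semicircle:
  assumes s: "s > 0" and f: "1-lipschitz_on UNIV f" "\<And>x. \<bar>f x\<bar> \<le> 1"
  shows "(\<integral>x. f x \<partial>semicircle (s\<^sup>2)) = radial_mean f s"
proof -
  interpret prob_space "semicircle (s\<^sup>2)" by (rule prob_space_semicircle[OF s])
  have [measurable]: "f \<in> borel_measurable borel"
    by (rule borel_measurable_continuous_onI[OF lipschitz_cont[OF f(1)]])
  have [measurable_cong]: "sets (semicircle (s\<^sup>2)) = sets borel" by (simp add: semicircle_def)
  have int: "integrable (semicircle (s\<^sup>2)) f"
    using f(2) by (intro integrable_const_bound[where B = 1]) auto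
  define g where "g x = f x + 1" for x
  have g: "1-lipschitz_on UNIV g" "\<And>x. g x \<ge> 0"
  proof -
    show "1-lipschitz_on UNIV g" using f(1) by (simp add: lipschitz_on_def g_def dist_real_def)
    show "g x \<ge> 0" for x using f(2)[of x] by (simp add: g_def abs_le_iff)
  qed
  have ag: "arcsine_mean g b = arcsine_mean f b + 1" for b
    unfolding arcsine_mean_def g_def
    by (simp add: Henstock_Kurzweil_Integration.integral_add[OF arcsine_mean_integrable[OF f(1)] integrable_const_ivl] add_divide_distrib)
  have rg: "radial_mean g s = radial_mean f s + 1"
  proof -
    have w: "((\<lambda>\<rho>. 1 * (2 * \<rho>)) has_integral 1 * (1\<^sup>2 - 0\<^sup>2)) {0..1 :: real}"
      by (rule has_integral_linear_weight) simp
    have i: "(\<lambda>\<rho>. arcsine_mean f (s * \<rho>) * (2 * \<rho>)) integrable_on {0..1}"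
      by (intro integrable_continuous_interval continuous_intros continuous_on_compose2[OF arcsine_mean_continuous[OF f(1), of UNIV]]) auto
    have "radial_mean g s = integral {0..1} (\<lambda>\<rho>. arcsine_mean f (s * \<rho>) * (2 * \<rho>) + 1 * (2 * \<rho>))"
      unfolding radial_mean_def ag by (simp add: distrib_right)
    also have "\<dots> = radial_mean f s + integral {0..1} (\<lambda>\<rho>. 1 * (2 * \<rho>))"
      unfolding radial_mean_def by (rule Henstock_Kurzweil_Integration.integral_add[OF i has_integral_integrable[OF w]])
    finally show ?thesis using integral_unique[OF w] by simp
  qed
  have "arcsine_mean g b \<ge> 0" for b using ag arcsine_mean_bound[OF f, of b] by (simp add: abs_le_iff)
  hence r0: "radial_mean g s \<ge> 0"
    unfolding radial_mean_def
    by (intro Henstock_Kurzweil_Integration.integral_nonneg integrable_continuous_interval continuous_intros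
        continuous_on_compose2[OF arcsine_mean_continuous[OF g(1), of UNIV]]) auto
  have "(\<integral>x. g x \<partial>semicircle (s\<^sup>2)) = enn2real (\<integral>\<^sup>+x. ennreal (g x) \<partial>semicircle (s\<^sup>2))"
    by (rule integral_eq_nn_integral) (use g in \<open>auto simp: g_def\<close>)
  also have "\<dots> = radial_mean g s"
    using nn_integral_semicircle_lipschitz[OF s g] r0 by simp
  finally have "(\<integral>x. g x \<partial>semicircle (s\<^sup>2)) = radial_mean f s + 1" using rg by simp
  moreover have "(\<integral>x. g x \<partial>semicircle (s\<^sup>2)) = (\<integral>x. f x \<partial>semicircle (s\<^sup>2)) + 1"
    unfolding g_def using int prob_space by simp
  ultimately show ?thesis by simp
qed

section \<open>The Gaussian hypergraph matrix\<close>

definition cover_count :: "nat \<Rightarrow> nat \<Rightarrow> nat \<Rightarrow> nat" where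
  "cover_count n r s = (if s \<le> r then (n - s) choose (r - s) else 0)"

text \<open>
Removing \<open>T\<close> is a bijection to the subsets of the complement of \<open>T\<close> that have \<open>r - card T\<close> elements.
\<close>

lemma card_supersets:
  assumes T: "T \<subseteq> {1..n}"
  shows "card {S. S \<subseteq> {1..n} \<and> card S = r \<and> T \<subseteq> S} = cover_count n r (card T)"
proof (cases "card T \<le> r")
  case True
  have fin: "finite T" using T finite_subset by blast
  have "bij_betw (\<lambda>S. S - T) {S. S \<subseteq> {1..n} \<and> card S = r \<and> T \<subseteq> S} {S. S \<subseteq> {1..n} - T \<and> card S = r - card T}"
  proof (rule bij_betwI[where g = "\<lambda>S. S \<union> T"])
    show "(\<lambda>S. S - T) \<in> {S. S \<subseteq> {1..n} \<and> card S = r \<and> T \<subseteq> S} \<rightarrow> {S. S \<subseteq> {1..n} - T \<and> card S = r - card T}"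
      using fin by (auto simp: card_Diff_subset)
    show "(\<lambda>S. S \<union> T) \<in> {S. S \<subseteq> {1..n} - T \<and> card S = r - card T} \<rightarrow> {S. S \<subseteq> {1..n} \<and> card S = r \<and> T \<subseteq> S}"
    proof (intro funcsetI CollectI conjI)
      fix S assume S: "S \<in> {S. S \<subseteq> {1..n} - T \<and> card S = r - card T}"
      hence "finite S" using finite_subset[of S "{1..n}"] by auto
      thus "card (S \<union> T) = r" using S fin True by (subst card_Un_disjoint) auto
    qed (use T in auto)
  qed auto
  hence "card {S. S \<subseteq> {1..n} \<and> card S = r \<and> T \<subseteq> S} = card {S. S \<subseteq> {1..n} - T \<and> card S = r - card T}"
    by (rule bij_betw_same_card)
  also have "\<dots> = card ({1..n} - T) choose (r - card T)" by (rule n_subsets) simp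
  also have "card ({1..n} - T) = n - card T" using T fin by (simp add: card_Diff_subset)
  finally show ?thesis using True by (simp add: cover_count_def)
next
  case False
  have "{S. S \<subseteq> {1..n} \<and> card S = r \<and> T \<subseteq> S} = {}"
  proof safe
    fix S assume "S \<subseteq> {1..n}" "T \<subseteq> S" "r = card S"
    moreover have "finite S" using \<open>S \<subseteq> {1..n}\<close> by (rule finite_subset) simp
    ultimately show "S \<in> {}" using False card_mono[of S T] by simp
  qed
  thus ?thesis using False by (simp add: cover_count_def)
qed

text \<open>
The inequality between the counts for 4 and 3 vertices and the last identity make the variances \<open>\<beta>\<^sup>2\<close> and
\<open>\<gamma>\<^sup>2\<close> of the decomposition into \<open>U\<close>, \<open>V\<close> and \<open>W\<close> nonnegative. The identity is Pascal's rule, applied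
twice.
\<close>

lemma cover_count_facts:
  assumes r: "2 \<le> r" "r \<le> n" and n: "4 \<le> n"
  shows "cover_count n r 2 = (n - 2) choose (r - 2)" "cover_count n r 2 > 0"
    "cover_count n r 4 \<le> cover_count n r 3" "cover_count n r 3 \<le> cover_count n r 2"
    "cover_count n r 2 + cover_count n r 4 = 2 * cover_count n r 3 + ((n - 4) choose (r - 2))"
proof -
  show c2: "cover_count n r 2 = (n - 2) choose (r - 2)" using r by (simp add: cover_count_def)
  show "cover_count n r 2 > 0" unfolding c2 using r by simp
  define a where "a = n - 4"
  define b where "b = r - 2"
  have na: "n - 2 = Suc (Suc a)" "n - 3 = Suc a" "n - 4 = a" using n by (simp_all add: a_def)
  have rb: "r = Suc (Suc b)" using r by (simp add: b_def)
  have c3: "cover_count n r 3 = (case b of 0 \<Rightarrow> 0 | Suc d \<Rightarrow> Suc a choose d)"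
    by (simp add: cover_count_def rb na split: nat.splits)
  have c4: "cover_count n r 4 = (case b of 0 \<Rightarrow> 0 | Suc d \<Rightarrow> (case d of 0 \<Rightarrow> 0 | Suc k \<Rightarrow> a choose k))"
    by (simp add: cover_count_def rb na split: nat.splits)
  have c2': "cover_count n r 2 = Suc (Suc a) choose b" unfolding c2 na b_def ..
  show "cover_count n r 4 \<le> cover_count n r 3" "cover_count n r 3 \<le> cover_count n r 2"
    "cover_count n r 2 + cover_count n r 4 = 2 * cover_count n r 3 + ((n - 4) choose (r - 2))"
    unfolding c2' c3 c4 na b_def[symmetric]
    by (auto split: nat.splits)
qed

text \<open>
The common shape of the perturbations caused by \<open>U\<close> and \<open>V\<close> and of the form that dominates them.
\<close>

lemma quad_low_rank:
  "quad n (\<lambda>i j. p + q * (y i + y j) + t * (y i * y j) + of_bool (i = j) * d i) x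
    = p * (\<Sum>i<n. x i)\<^sup>2 + 2 * q * ((\<Sum>i<n. y i * x i) * (\<Sum>i<n. x i)) + t * (\<Sum>i<n. y i * x i)\<^sup>2 + (\<Sum>i<n. d i * (x i)\<^sup>2)"
proof -
  have "quad n (\<lambda>i j. p + q * (y i + y j) + t * (y i * y j) + of_bool (i = j) * d i) x
    = (\<Sum>i<n. \<Sum>j<n. p * (x i * x j)) + (\<Sum>i<n. \<Sum>j<n. q * ((y i * x i) * x j)) + (\<Sum>i<n. \<Sum>j<n. q * (x i * (y j * x j)))
     + (\<Sum>i<n. \<Sum>j<n. t * ((y i * x i) * (y j * x j))) + (\<Sum>i<n. \<Sum>j<n. of_bool (i = j) * (d i * x i * x j))"
    unfolding quad_def sum.distrib[symmetric] by (intro sum.cong refl) (simp add: algebra_simps)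
  also have "(\<Sum>i<n. \<Sum>j<n. of_bool (i = j) * (d i * x i * x j)) = (\<Sum>i<n. d i * (x i)\<^sup>2)"
    by (intro sum.cong refl) (simp only: sum_of_bool_eq lessThan_iff power2_eq_square mult.assoc)
  finally have q: "quad n (\<lambda>i j. p + q * (y i + y j) + t * (y i * y j) + of_bool (i = j) * d i) x
    = (\<Sum>i<n. \<Sum>j<n. p * (x i * x j)) + (\<Sum>i<n. \<Sum>j<n. q * ((y i * x i) * x j)) + (\<Sum>i<n. \<Sum>j<n. q * (x i * (y j * x j)))
     + (\<Sum>i<n. \<Sum>j<n. t * ((y i * x i) * (y j * x j))) + (\<Sum>i<n. d i * (x i)\<^sup>2)" .
  have h: "(\<Sum>i<n. \<Sum>j<n. c * (u i * v j)) = c * ((\<Sum>i<n. u i) * (\<Sum>j<n. v j))" for c and u v :: "nat \<Rightarrow> real"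
    by (simp only: sum_distrib_left[symmetric] sum_product)
  show ?thesis
    unfolding q h[of p x x] h[of q "\<lambda>i. y i * x i" x] h[of q x "\<lambda>i. y i * x i"] h[of t "\<lambda>i. y i * x i" "\<lambda>i. y i * x i"]
    by (simp only: power2_eq_square mult.assoc mult_2 ring_distribs) (simp only: ac_simps)
qed

text \<open>
An entry of the matrix \<open>H\<^sub>n\<close> of the hypergraph model, before the factor \<open>1 / sqrt n\<close>.
\<close>

definition hypergraph_entry :: "nat \<Rightarrow> nat \<Rightarrow> (nat \<Rightarrow> nat set) \<Rightarrow> (nat \<Rightarrow> real) \<Rightarrow> nat \<Rightarrow> nat \<Rightarrow> real" where
  "hypergraph_entry n r e z i j = (\<Sum>l=1..n choose r. of_bool (i \<noteq> j \<and> Suc i \<in> e l \<and> Suc j \<in> e l) * z l) / sqrt (real ((n - 2) choose (r - 2)))"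

text \<open>
The coefficient \<open>\<gamma>\<close> of the Gaussian orthogonal ensemble inside the hypergraph matrix. Its square is the
fraction of the edges through two given vertices that avoid two other given vertices.
\<close>

definition goe_weight :: "nat \<Rightarrow> nat \<Rightarrow> real" where
  "goe_weight n r = sqrt (real ((n - 4) choose (r - 2)) / real ((n - 2) choose (r - 2)))"

lemma hypergraph_covariance:
  assumes e: "bij_betw e {1..n choose r} {S. S \<subseteq> {1..n} \<and> card S = r}"
    and ijkl: "i < n" "j < n" "k < n" "l < n"
  shows "(\<Sum>m=1..n choose r. of_bool (i \<noteq> j \<and> Suc i \<in> e m \<and> Suc j \<in> e m) * of_bool (k \<noteq> l \<and> Suc k \<in> e m \<and> Suc l \<in> e m))
    = of_bool (i \<noteq> j \<and> k \<noteq> l) * real (cover_count n r (card {i, j, k, l}))"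
proof (cases "i \<noteq> j \<and> k \<noteq> l")
  case True
  define T where "T = {Suc i, Suc j, Suc k, Suc l}"
  have cT: "card T = card {i, j, k, l}"
  proof -
    have T: "T = Suc ` {i, j, k, l}" by (auto simp: T_def)
    have "inj_on Suc {i, j, k, l}" by (auto simp: inj_on_def)
    thus ?thesis unfolding T by (rule card_image)
  qed
  have "(\<Sum>m=1..n choose r. of_bool (i \<noteq> j \<and> Suc i \<in> e m \<and> Suc j \<in> e m) * of_bool (k \<noteq> l \<and> Suc k \<in> e m \<and> Suc l \<in> e m))
      = (\<Sum>m=1..n choose r. (of_bool (T \<subseteq> e m) :: real))"
    using True by (intro sum.cong refl) (auto simp: T_def)
  also have "\<dots> = real (card {m \<in> {1..n choose r}. T \<subseteq> e m})" by (simp add: of_bool_def sum.If_cases Int_def)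
  also have "card {m \<in> {1..n choose r}. T \<subseteq> e m} = card {S. S \<subseteq> {1..n} \<and> card S = r \<and> T \<subseteq> S}"
  proof (rule bij_betw_same_card[of e])
    show "bij_betw e {m \<in> {1..n choose r}. T \<subseteq> e m} {S. S \<subseteq> {1..n} \<and> card S = r \<and> T \<subseteq> S}"
    proof (rule bij_betw_subset[OF e])
      have im: "e ` {1..n choose r} = {S. S \<subseteq> {1..n} \<and> card S = r}" using e by (simp add: bij_betw_def)
      show "e ` {m \<in> {1..n choose r}. T \<subseteq> e m} = {S. S \<subseteq> {1..n} \<and> card S = r \<and> T \<subseteq> S}"
      proof safe
        fix S assume "S \<subseteq> {1..n}" "T \<subseteq> S" "r = card S"
        hence "S \<in> e ` {1..n choose r}" unfolding im by simp
        then obtain m where "m \<in> {1..n choose r}" "S = e m" by (elim imageE)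
        thus "S \<in> e ` {m \<in> {1..n choose card S}. T \<subseteq> e m}" using \<open>T \<subseteq> S\<close> \<open>r = card S\<close> by blast
      qed (use im in blast)+
    qed auto
  qed
  also have "\<dots> = cover_count n r (card T)"
    by (rule card_supersets) (use ijkl in \<open>auto simp: T_def\<close>)
  finally show ?thesis using True by (simp add: cT)
qed (auto intro!: sum.neutral)

lemma hypergraph_entry_sym: "hypergraph_entry n r e z i j = hypergraph_entry n r e z j i"
  unfolding hypergraph_entry_def by (intro arg_cong2[of _ _ _ _ "(/)"] sum.cong refl) auto

lemma distr_pair_snd:
  assumes "prob_space M" "prob_space N"
  shows "distr (M \<Otimes>\<^sub>M N) N snd = N"
proof (rule measure_eqI)
  interpret M: prob_space M by fact
  interpret N: prob_space N by fact
  fix A assume "A \<in> sets (distr (M \<Otimes>\<^sub>M N) N snd)"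
  hence A: "A \<in> sets N" by simp
  have "snd -` A \<inter> space (M \<Otimes>\<^sub>M N) = space M \<times> A"
    using sets.sets_into_space[OF A] by (auto simp: space_pair_measure)
  thus "emeasure (distr (M \<Otimes>\<^sub>M N) N snd) A = emeasure N A"
    using A by (simp add: emeasure_distr N.emeasure_pair_measure_Times M.emeasure_space_1)
qed simp

text \<open>
For two pairs of distinct indices, the covariances of \<open>V\<^sub>i + V\<^sub>j\<close> and of \<open>W\<^sub>i\<^sub>j\<close> are functions of the
size of the union.
\<close>

lemma pair_overlap:
  assumes "i \<noteq> j" "k \<noteq> l"
  shows "of_bool (i = k) + of_bool (i = l) + of_bool (j = k) + of_bool (j = l) = 4 - real (card {i, j, k, l})"
    "goe_cov i j k l = of_bool (card {i, j, k, l} = 2)" "card {i, j, k, l} \<in> {2, 3, 4}"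
proof -
  have "of_bool (i = k) + of_bool (i = l) + of_bool (j = k) + of_bool (j = l) = 4 - real (card {i, j, k, l})
      \<and> goe_cov i j k l = of_bool (card {i, j, k, l} = 2) \<and> card {i, j, k, l} \<in> {2, 3, 4}"
  proof (cases "k = i \<or> k = j")
    case True
    thus ?thesis
    proof
      assume "k = i"
      thus ?thesis using assms by (cases "l = j") (auto simp: goe_cov_def card_insert_if)
    next
      assume "k = j"
      thus ?thesis using assms by (cases "l = i") (auto simp: goe_cov_def card_insert_if)
    qed
  next
    case False
    show ?thesis
    proof (cases "l = i \<or> l = j")
      case True
      thus ?thesis
      proof
        assume "l = i"
        thus ?thesis using assms False by (auto simp: goe_cov_def card_insert_if)
      next
        assume "l = j"
        thus ?thesis using assms False by (auto simp: goe_cov_def card_insert_if)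
      qed
    next
      case l: False
      have "card {i, j, k, l} = 4" using assms False l by (simp add: card_insert_if)
      thus ?thesis using assms False l by (auto simp: goe_cov_def)
    qed
  qed
  thus "of_bool (i = k) + of_bool (i = l) + of_bool (j = k) + of_bool (j = l) = 4 - real (card {i, j, k, l})"
    "goe_cov i j k l = of_bool (card {i, j, k, l} = 2)" "card {i, j, k, l} \<in> {2, 3, 4}" by blast+
qed

text \<open>
The noise \<open>fst w\<close> has the coordinates \<open>V\<^sub>0, \<dots>, V\<^sub>n\<^sub>-\<^sub>1\<close> and, at the additional index \<open>n\<close>, the variable \<open>U\<close>;
the noise \<open>snd w\<close> yields the matrix \<open>W\<close>.
\<close>

definition noise_model :: "real \<Rightarrow> real \<Rightarrow> real \<Rightarrow> nat \<Rightarrow> (nat \<Rightarrow> real) \<times> (nat \<times> nat \<Rightarrow> real) \<Rightarrow> nat \<Rightarrow> nat \<Rightarrow> real" where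
  "noise_model \<alpha> \<beta> \<gamma> n w i j =
     of_bool (i \<noteq> j) * (\<alpha> * fst w n + \<beta> * (fst w i + fst w j) + \<gamma> * symm (snd w) i j)"

lemma noise_model_sym: "noise_model \<alpha> \<beta> \<gamma> n w i j = noise_model \<alpha> \<beta> \<gamma> n w j i"
  by (auto simp: noise_model_def symm_sym)

text \<open>
Two entries \<open>(i, j)\<close> and \<open>(k, l)\<close> have a covariance that depends only on the number of vertices in the union
of the pairs. The three possible values, for 2, 3 and 4 vertices, are matched by the choice of the three
coefficients of the noise model.
\<close>

lemma hypergraph_law:
  assumes Z: "gauss_fam P {1..n choose r} Z (\<lambda>i j. of_bool (i = j))"
    and e: "bij_betw e {1..n choose r} {S. S \<subseteq> {1..n} \<and> card S = r}"
    and r: "2 \<le> r" "r \<le> n" and n: "4 \<le> n" and f: "L-lipschitz_on UNIV f"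
  obtains \<alpha> \<beta> where "0 \<le> \<alpha>" "\<alpha> \<le> 1" "0 \<le> \<beta>" "\<beta> \<le> 1"
    "\<And>\<kappa>. (\<integral>\<omega>. spec_sum n f (\<lambda>i j. \<kappa> * hypergraph_entry n r e (\<lambda>l. Z l \<omega>) i j) \<partial>P)
       = (\<integral>w. spec_sum n f (\<lambda>i j. \<kappa> * noise_model \<alpha> \<beta> (goe_weight n r) n w i j)
           \<partial>(gauss_space {..n} \<Otimes>\<^sub>M gauss_space (sq n)))"
proof -
  let ?Y = "gauss_space {..n}" and ?X = "gauss_space (sq n)"
  let ?N = "?Y \<Otimes>\<^sub>M ?X"
  define C where "C = real ((n - 2) choose (r - 2))"
  note cf = cover_count_facts[OF r n]
  define c3 c4 where "c3 = real (cover_count n r 3)" and "c4 = real (cover_count n r 4)"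
  have C: "C > 0" "real (cover_count n r 2) = C" using cf(1,2) by (simp_all add: C_def)
  have c34: "0 \<le> c4" "c4 \<le> c3" "c3 \<le> C" using cf by (simp_all add: c3_def c4_def C_def)
  have Cw: "real ((n - 4) choose (r - 2)) = C - 2 * c3 + c4"
  proof -
    have "real (cover_count n r 2 + cover_count n r 4) = real (2 * cover_count n r 3 + ((n - 4) choose (r - 2)))"
      unfolding cf(5) ..
    thus ?thesis by (simp add: C c3_def c4_def)
  qed
  define \<alpha> \<beta> \<gamma> where "\<alpha> = sqrt (c4 / C)" and "\<beta> = sqrt ((c3 - c4) / C)" and "\<gamma> = goe_weight n r"
  have sqs: "\<alpha>\<^sup>2 = c4 / C" "\<beta>\<^sup>2 = (c3 - c4) / C" "\<gamma>\<^sup>2 = (C - 2 * c3 + c4) / C"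
    using C c34 Cw by (simp_all add: \<alpha>_def \<beta>_def \<gamma>_def goe_weight_def flip: C_def)
  have "\<alpha>\<^sup>2 \<le> 1\<^sup>2" "\<beta>\<^sup>2 \<le> 1\<^sup>2" "\<gamma>\<^sup>2 \<le> 1\<^sup>2"
    unfolding sqs using C c34 by (auto simp: divide_le_eq_1)
  hence le1: "\<alpha> \<le> 1" "\<beta> \<le> 1" "\<gamma> \<le> 1" by (auto intro: power2_le_imp_le)
  have ge0: "0 \<le> \<alpha>" "0 \<le> \<beta>" "0 \<le> \<gamma>" using C c34 by (simp_all add: \<alpha>_def \<beta>_def \<gamma>_def goe_weight_def)
  let ?W = "noise_model \<alpha> \<beta> \<gamma> n"
  define K where "K p q = of_bool (fst p \<noteq> snd p \<and> fst q \<noteq> snd q) * real (cover_count n r (card {fst p, snd p, fst q, snd q})) / C"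
    for p q :: "nat \<times> nat"
  have famH: "gauss_fam P (sq n) (\<lambda>p \<omega>. hypergraph_entry n r e (\<lambda>l. Z l \<omega>) (fst p) (snd p)) K"
  proof (rule gauss_fam_white_linearI[OF Z, where
        L = "\<lambda>p m. of_bool (fst p \<noteq> snd p \<and> Suc (fst p) \<in> e m \<and> Suc (snd p) \<in> e m) / sqrt C"])
    show "hypergraph_entry n r e (\<lambda>l. Z l \<omega>) (fst p) (snd p)
        = (\<Sum>m\<in>{1..n choose r}. of_bool (fst p \<noteq> snd p \<and> Suc (fst p) \<in> e m \<and> Suc (snd p) \<in> e m) / sqrt C * Z m \<omega>)" for p \<omega>
      by (simp only: hypergraph_entry_def C_def sum_divide_distrib times_divide_eq_left)
    show "K p q = (\<Sum>m\<in>{1..n choose r}. of_bool (fst p \<noteq> snd p \<and> Suc (fst p) \<in> e m \<and> Suc (snd p) \<in> e m) / sqrt C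
         * (of_bool (fst q \<noteq> snd q \<and> Suc (fst q) \<in> e m \<and> Suc (snd q) \<in> e m) / sqrt C))"
      if "p \<in> sq n" "q \<in> sq n" for p q
    proof -
      have cv: "(\<Sum>m=1..n choose r. of_bool (fst p \<noteq> snd p \<and> Suc (fst p) \<in> e m \<and> Suc (snd p) \<in> e m) * of_bool (fst q \<noteq> snd q \<and> Suc (fst q) \<in> e m \<and> Suc (snd q) \<in> e m))
          = of_bool (fst p \<noteq> snd p \<and> fst q \<noteq> snd q) * real (cover_count n r (card {fst p, snd p, fst q, snd q}))"
        by (rule hypergraph_covariance[OF e]) (use that in auto)
      have "sqrt C * sqrt C = C" using C by simp
      thus ?thesis unfolding K_def cv[symmetric] sum_divide_distrib
        by (simp only: times_divide_times_eq)
    qed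
  qed simp
  have gx: "gauss_fam ?X (sq n) (\<lambda>q x. x q) (\<lambda>i j. of_bool (i = j))"
    and gy: "gauss_fam ?Y {..n} (\<lambda>q x. x q) (\<lambda>i j. of_bool (i = j))"
    by (rule gauss_fam_gauss_space; simp)+
  define V where "V i j u = \<alpha> * of_bool (n = u) + \<beta> * (of_bool (i = u) + of_bool (j = u))" for i j u :: nat
  have Vsum: "(\<Sum>u\<in>{..n}. V i j u * g u) = \<alpha> * g n + \<beta> * (g i + g j)" if "i < n" "j < n" for i j and g :: "nat \<Rightarrow> real"
  proof -
    have "(\<Sum>u\<in>{..n}. V i j u * g u) = \<alpha> * (\<Sum>u\<in>{..n}. of_bool (n = u) * g u)
        + \<beta> * ((\<Sum>u\<in>{..n}. of_bool (i = u) * g u) + (\<Sum>u\<in>{..n}. of_bool (j = u) * g u))"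
      by (simp only: V_def sum_distrib_left sum.distrib[symmetric] distrib_left distrib_right mult.assoc)
    thus ?thesis using that by (simp only: sum_of_bool_finite finite_atMost atMost_iff le_refl less_imp_le)
  qed
  have famW: "gauss_fam ?N (sq n) (\<lambda>p w. ?W w (fst p) (snd p)) K"
  proof (rule gauss_fam_white_linearI[OF gauss_fam_pair[OF gy gx],
      where L = "\<lambda>p s. of_bool (fst p \<noteq> snd p) * (case s of Inl u \<Rightarrow> V (fst p) (snd p) u | Inr q \<Rightarrow> \<gamma> * sym_delta (fst p) (snd p) q)"])
    fix p and w :: "(nat \<Rightarrow> real) \<times> (nat \<times> nat \<Rightarrow> real)" assume p: "p \<in> sq n"
    obtain i j where ij: "p = (i, j)" "i < n" "j < n" using p by auto
    have "(\<Sum>s\<in>{..n} <+> sq n. of_bool (i \<noteq> j) * (case s of Inl u \<Rightarrow> V i j u | Inr q \<Rightarrow> \<gamma> * sym_delta i j q) * (case s of Inl i \<Rightarrow> fst w i | Inr j \<Rightarrow> snd w j))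
        = of_bool (i \<noteq> j) * ((\<Sum>u\<in>{..n}. V i j u * fst w u) + \<gamma> * (\<Sum>q\<in>sq n. sym_delta i j q * snd w q))"
      by (simp add: sum.Plus comp_def sum_distrib_left mult.assoc distrib_left)
    thus "?W w (fst p) (snd p) = (\<Sum>s\<in>{..n} <+> sq n. of_bool (fst p \<noteq> snd p) * (case s of Inl u \<Rightarrow> V (fst p) (snd p) u | Inr q \<Rightarrow> \<gamma> * sym_delta (fst p) (snd p) q)
          * (case s of Inl i \<Rightarrow> fst w i | Inr j \<Rightarrow> snd w j))"
      unfolding ij fst_conv snd_conv using Vsum[OF ij(2,3)] sum_sym_delta[OF ij(2,3)] by (simp add: noise_model_def)
  next
    fix p q assume "p \<in> sq n" "q \<in> sq n"
    then obtain i j k l where ij: "p = (i, j)" "i < n" "j < n" "q = (k, l)" "k < n" "l < n" by auto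
    have "(\<Sum>s\<in>{..n} <+> sq n. of_bool (i \<noteq> j) * (case s of Inl u \<Rightarrow> V i j u | Inr q \<Rightarrow> \<gamma> * sym_delta i j q)
          * (of_bool (k \<noteq> l) * (case s of Inl u \<Rightarrow> V k l u | Inr q \<Rightarrow> \<gamma> * sym_delta k l q)))
        = of_bool (i \<noteq> j \<and> k \<noteq> l) * ((\<Sum>u\<in>{..n}. V i j u * V k l u) + \<gamma>\<^sup>2 * (\<Sum>q\<in>sq n. sym_delta i j q * sym_delta k l q))"
      by (simp add: sum.Plus comp_def sum_distrib_left distrib_left power2_eq_square ac_simps)
    also have "\<dots> = of_bool (i \<noteq> j \<and> k \<noteq> l) * ((\<alpha>\<^sup>2 + \<beta>\<^sup>2 * (of_bool (i = k) + of_bool (i = l) + of_bool (j = k) + of_bool (j = l)))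
          + \<gamma>\<^sup>2 * goe_cov i j k l)"
    proof -
      have v: "V k l n = \<alpha>" "V k l i = \<beta> * (of_bool (i = k) + of_bool (i = l))"
        "V k l j = \<beta> * (of_bool (j = k) + of_bool (j = l))"
        using ij by (auto simp: V_def)
      show ?thesis unfolding Vsum[OF ij(2,3)] sym_delta_cov[OF ij(2,3)] v
        by (simp only: power2_eq_square ring_distribs ac_simps)
    qed
    also have "\<dots> = K p q"
    proof (cases "i \<noteq> j \<and> k \<noteq> l")
      case True
      note ov = pair_overlap[OF True[THEN conjunct1] True[THEN conjunct2]]
      have Kc: "K p q = real (cover_count n r (card {i, j, k, l})) / C"
        using True by (simp add: K_def ij)
      have S: "of_bool (i = k) + of_bool (i = l) + of_bool (j = k) + of_bool (j = l) = 4 - real (card {i, j, k, l})"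
        by (rule ov(1))
      consider "card {i, j, k, l} = 2" | "card {i, j, k, l} = 3" | "card {i, j, k, l} = 4" using ov(3) by auto
      thus ?thesis
        unfolding Kc S ov(2) sqs
        by cases (use True C in \<open>simp_all add: c3_def[symmetric] c4_def[symmetric] add_divide_distrib[symmetric]\<close>)
    qed (auto simp: K_def ij)
    finally show "K p q = (\<Sum>s\<in>{..n} <+> sq n. of_bool (fst p \<noteq> snd p) * (case s of Inl u \<Rightarrow> V (fst p) (snd p) u | Inr q \<Rightarrow> \<gamma> * sym_delta (fst p) (snd p) q)
          * (of_bool (fst q \<noteq> snd q) * (case s of Inl u \<Rightarrow> V (fst q) (snd q) u | Inr u \<Rightarrow> \<gamma> * sym_delta (fst q) (snd q) u)))"
      unfolding ij fst_conv snd_conv by (rule sym)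
  qed simp
  have mean: "(\<integral>\<omega>. spec_sum n f (\<lambda>i j. 0 + \<kappa> * hypergraph_entry n r e (\<lambda>l. Z l \<omega>) i j) \<partial>P)
      = (\<integral>w. spec_sum n f (\<lambda>i j. 0 + \<kappa> * ?W w i j) \<partial>?N)" for \<kappa>
    by (rule gauss_fam_spec_sum_eq[OF famH famW refl _ _ _ f])
       (auto simp: sym_on_def intro: hypergraph_entry_sym noise_model_sym)
  show ?thesis
    by (rule that[of \<alpha> \<beta>]) (use le1 ge0 mean in \<open>simp_all add: \<gamma>_def\<close>)
qed

text \<open>
The part with \<open>U\<close> and \<open>V\<close> has bounded rank apart from the diagonal. It is dominated by a form
whose trace has mean \<open>O(n)\<close>, whereas its Hilbert-Schmidt norm would only give \<open>O(n powr (3/2))\<close>.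
\<close>

lemma noise_model_near_goe:
  assumes f: "1-lipschitz_on UNIV f" "\<And>x. \<bar>f x\<bar> \<le> 1" and \<kappa>: "\<kappa> \<ge> 0"
    and ge0: "0 \<le> \<alpha>" "0 \<le> \<beta>" "0 \<le> \<gamma>" and le1: "\<alpha> \<le> 1" "\<beta> \<le> 1" "\<gamma> \<le> 1"
  shows "\<bar>(\<integral>w. spec_sum n f (\<lambda>i j. \<kappa> * noise_model \<alpha> \<beta> \<gamma> n w i j)
           \<partial>(gauss_space {..n} \<Otimes>\<^sub>M gauss_space (sq n)))
      - goe_mean n (\<kappa> * \<gamma>) f\<bar> \<le> 24 * \<kappa> * real n"
proof -
  let ?Y = "gauss_space {..n}" and ?X = "gauss_space (sq n)"
  let ?N = "?Y \<Otimes>\<^sub>M ?X"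
  interpret Y: prob_space ?Y by (rule prob_space_gauss_space)
  interpret X: prob_space ?X by (rule prob_space_gauss_space)
  interpret P: pair_prob_space ?Y ?X ..
  define A where "A w i j = \<kappa> * \<gamma> * symm (snd w) i j" for w :: "(nat \<Rightarrow> real) \<times> (nat \<times> nat \<Rightarrow> real)" and i j
  define B where "B w i j = \<kappa> * noise_model \<alpha> \<beta> \<gamma> n w i j" for w i j
  have As: "sym_on n (A w)" for w by (simp add: sym_on_def A_def symm_sym)
  have Bs: "sym_on n (B w)" for w by (auto simp: sym_on_def B_def intro: noise_model_sym)
  define bd where "bd w = \<kappa> * (real n * (1 + (fst w n)\<^sup>2) + (\<Sum>i<n. (fst w i)\<^sup>2) + real n
      + (\<Sum>i<n. 1 + (fst w i)\<^sup>2) + (\<Sum>i<n. 1 + (snd w (i, i))\<^sup>2))" for w :: "(nat \<Rightarrow> real) \<times> (nat \<times> nat \<Rightarrow> real)"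
  have ptw: "\<bar>spec_sum n f (B w) - spec_sum n f (A w)\<bar> \<le> 3 * bd w" for w
  proof -
    define y where "y = fst w"
    define x where "x = snd w"
    define U where "U = y n"
    define dS where "dS i = \<kappa> * (\<bar>U\<bar> + 2 * \<bar>y i\<bar> + \<bar>symm x i i\<bar>)" for i
    define S where "S i j = \<kappa> * (\<bar>U\<bar> + 1) + 0 * (y i + y j) + \<kappa> * (y i * y j) + of_bool (i = j) * dS i" for i j
    define dD where "dD i = \<kappa> * (- (\<alpha> * U) - 2 * \<beta> * y i - \<gamma> * symm x i i)" for i
    have "\<bar>spec_sum n f (B w) - spec_sum n f (A w)\<bar> \<le> 3 * 1 * (\<Sum>i<n. S i i)"
    proof (rule spec_sum_perturb[OF As Bs _ _ f(1), where S = S])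
      show "sym_on n S" by (auto simp: sym_on_def S_def mult.commute)
      fix v :: "nat \<Rightarrow> real"
      define s1 where "s1 = (\<Sum>i<n. v i)"
      define t1 where "t1 = (\<Sum>i<n. y i * v i)"
      have "B w i j = A w i j + (\<kappa> * \<alpha> * U + \<kappa> * \<beta> * (y i + y j) + 0 * (y i * y j) + of_bool (i = j) * dD i)" for i j
        by (auto simp: B_def A_def noise_model_def dD_def U_def y_def x_def algebra_simps)
      hence "quad n (B w) v - quad n (A w) v = quad n (\<lambda>i j. \<kappa> * \<alpha> * U + \<kappa> * \<beta> * (y i + y j) + 0 * (y i * y j) + of_bool (i = j) * dD i) v"
        using quad_add[of n "A w" "\<lambda>i j. \<kappa> * \<alpha> * U + \<kappa> * \<beta> * (y i + y j) + 0 * (y i * y j) + of_bool (i = j) * dD i" v]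
        by (simp add: quad_def)
      also have "\<dots> = \<kappa> * (\<alpha> * U * s1\<^sup>2) + \<kappa> * (\<beta> * (2 * (t1 * s1))) + (\<Sum>i<n. dD i * (v i)\<^sup>2)"
        unfolding quad_low_rank s1_def[symmetric] t1_def[symmetric] by (simp add: algebra_simps)
      finally have D: "quad n (B w) v - quad n (A w) v = \<kappa> * (\<alpha> * U * s1\<^sup>2) + \<kappa> * (\<beta> * (2 * (t1 * s1))) + (\<Sum>i<n. dD i * (v i)\<^sup>2)" .
      have Sq: "quad n S v = \<kappa> * (\<bar>U\<bar> * s1\<^sup>2) + \<kappa> * (t1\<^sup>2 + s1\<^sup>2) + (\<Sum>i<n. dS i * (v i)\<^sup>2)"
        unfolding S_def[abs_def] quad_low_rank s1_def[symmetric] t1_def[symmetric] by (simp add: algebra_simps)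
      have 1: "\<bar>\<kappa> * (\<alpha> * U * s1\<^sup>2)\<bar> \<le> \<kappa> * (\<bar>U\<bar> * s1\<^sup>2)"
      proof -
        have "\<alpha> * (\<bar>U\<bar> * s1\<^sup>2) \<le> 1 * (\<bar>U\<bar> * s1\<^sup>2)" using le1 by (intro mult_right_mono) auto
        thus ?thesis using \<kappa> ge0 by (simp add: abs_mult mult_left_mono mult.assoc)
      qed
      have 2: "\<bar>\<kappa> * (\<beta> * (2 * (t1 * s1)))\<bar> \<le> \<kappa> * (t1\<^sup>2 + s1\<^sup>2)"
      proof -
        have "2 * (\<bar>t1\<bar> * \<bar>s1\<bar>) \<le> t1\<^sup>2 + s1\<^sup>2"
          using zero_le_power2[of "\<bar>t1\<bar> - \<bar>s1\<bar>"] by (simp add: power2_diff)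
        moreover have "\<beta> * (2 * (\<bar>t1\<bar> * \<bar>s1\<bar>)) \<le> 1 * (2 * (\<bar>t1\<bar> * \<bar>s1\<bar>))"
          using le1 by (intro mult_right_mono) auto
        ultimately have "\<beta> * (2 * (\<bar>t1\<bar> * \<bar>s1\<bar>)) \<le> t1\<^sup>2 + s1\<^sup>2" by simp
        hence "\<kappa> * (\<beta> * (2 * (\<bar>t1\<bar> * \<bar>s1\<bar>))) \<le> \<kappa> * (t1\<^sup>2 + s1\<^sup>2)" using \<kappa> by (intro mult_left_mono)
        thus ?thesis using \<kappa> ge0 by (simp add: abs_mult)
      qed
      have 3: "\<bar>\<Sum>i<n. dD i * (v i)\<^sup>2\<bar> \<le> (\<Sum>i<n. dS i * (v i)\<^sup>2)"
      proof (intro order_trans[OF sum_abs] sum_mono)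
        fix i
        have "\<bar>- (\<alpha> * U) - 2 * \<beta> * y i - \<gamma> * symm x i i\<bar> \<le> \<alpha> * \<bar>U\<bar> + \<beta> * (2 * \<bar>y i\<bar>) + \<gamma> * \<bar>symm x i i\<bar>"
        proof -
          have "\<bar>\<alpha> * U\<bar> = \<alpha> * \<bar>U\<bar>" "\<bar>2 * \<beta> * y i\<bar> = \<beta> * (2 * \<bar>y i\<bar>)" "\<bar>\<gamma> * symm x i i\<bar> = \<gamma> * \<bar>symm x i i\<bar>"
            using ge0 by (simp_all add: abs_mult)
          thus ?thesis by linarith
        qed
        also have "\<dots> \<le> 1 * \<bar>U\<bar> + 1 * (2 * \<bar>y i\<bar>) + 1 * \<bar>symm x i i\<bar>"
          using le1 by (intro add_mono mult_right_mono) auto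
        finally have "\<bar>dD i\<bar> \<le> dS i" using \<kappa> by (simp add: dD_def dS_def abs_mult mult_left_mono)
        thus "\<bar>dD i * (v i)\<^sup>2\<bar> \<le> dS i * (v i)\<^sup>2" by (simp add: abs_mult mult_right_mono)
      qed
      show "\<bar>quad n (B w) v - quad n (A w) v\<bar> \<le> quad n S v" unfolding D Sq using 1 2 3 by linarith
    qed
    also have "(\<Sum>i<n. S i i) \<le> bd w"
    proof -
      have "S i i \<le> \<kappa> * ((1 + U\<^sup>2) + (y i)\<^sup>2 + 1 + (1 + (y i)\<^sup>2) + (1 + (x (i, i))\<^sup>2))" for i
      proof -
        have "symm x i i = sqrt 2 * x (i, i)"
          by (simp add: symm_def real_div_sqrt flip: mult_2) (metis mult.commute real_div_sqrt times_divide_eq_right zero_le_numeral)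
        moreover note sqrt2_abs_le[of "x (i, i)"]
        ultimately have "\<bar>symm x i i\<bar> \<le> 1 + (x (i, i))\<^sup>2" by (simp add: abs_mult)
        hence "\<bar>U\<bar> + 1 + y i * y i + (\<bar>U\<bar> + 2 * \<bar>y i\<bar> + \<bar>symm x i i\<bar>) \<le> (1 + U\<^sup>2) + (y i)\<^sup>2 + 1 + (1 + (y i)\<^sup>2) + (1 + (x (i, i))\<^sup>2)"
          using two_abs_le[of U] two_abs_le[of "y i"] by (simp add: power2_eq_square)
        hence "\<kappa> * (\<bar>U\<bar> + 1 + y i * y i + (\<bar>U\<bar> + 2 * \<bar>y i\<bar> + \<bar>symm x i i\<bar>)) \<le> \<kappa> * ((1 + U\<^sup>2) + (y i)\<^sup>2 + 1 + (1 + (y i)\<^sup>2) + (1 + (x (i, i))\<^sup>2))"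
          using \<kappa> by (rule mult_left_mono)
        moreover have "S i i = \<kappa> * (\<bar>U\<bar> + 1 + y i * y i + (\<bar>U\<bar> + 2 * \<bar>y i\<bar> + \<bar>symm x i i\<bar>))"
          by (simp add: S_def dS_def algebra_simps)
        ultimately show ?thesis by simp
      qed
      hence "(\<Sum>i<n. S i i) \<le> (\<Sum>i<n. \<kappa> * ((1 + U\<^sup>2) + (y i)\<^sup>2 + 1 + (1 + (y i)\<^sup>2) + (1 + (x (i, i))\<^sup>2)))"
        by (intro sum_mono)
      also have "\<dots> = bd w"
        by (simp add: bd_def U_def y_def x_def sum.distrib distrib_left flip: sum_distrib_left)
      finally show ?thesis .
    qed
    finally show ?thesis by simp
  qed
  have ym: "(\<lambda>w. fst w i) \<in> borel_measurable ?N" if "i \<le> n" for i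
    by (rule measurable_compose[OF measurable_fst measurable_gauss_space_coord]) (use that in simp)
  have xm: "(\<lambda>w. snd w q) \<in> borel_measurable ?N" if "q \<in> sq n" for q
    by (rule measurable_compose[OF measurable_snd measurable_gauss_space_coord[OF that]])
  have sm: "(\<lambda>w. symm (snd w) i j) \<in> borel_measurable ?N" if "i < n" "j < n" for i j
    unfolding symm_def using xm[of "(i, j)"] xm[of "(j, i)"] that by simp
  have Am: "(\<lambda>w. spec_sum n f (A w)) \<in> borel_measurable ?N"
    by (rule spec_sum_measurable[OF _ As f(1)]) (use sm in \<open>simp add: A_def\<close>)
  have Bm: "(\<lambda>w. spec_sum n f (B w)) \<in> borel_measurable ?N"
  proof (rule spec_sum_measurable[OF _ Bs f(1)])
    show "(\<lambda>w. B w i j) \<in> borel_measurable ?N" if "i < n" "j < n" for i j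
      unfolding B_def noise_model_def using sm[OF that] ym[of i] ym[of j] ym[of n] that by simp
  qed
  have Ai: "integrable ?N (\<lambda>w. spec_sum n f (A w))"
    using Am spec_sum_bound[OF As f(2)] by (intro P.integrable_const_bound[where B = "real n"]) auto
  have Bi: "integrable ?N (\<lambda>w. spec_sum n f (B w))"
    using Bm spec_sum_bound[OF Bs f(2)] by (intro P.integrable_const_bound[where B = "real n"]) auto
  have Aint: "(\<integral>w. spec_sum n f (A w) \<partial>?N) = goe_mean n (\<kappa> * \<gamma>) f"
  proof -
    have "(\<integral>w. spec_sum n f (A w) \<partial>?N) = (\<integral>y. \<integral>x. spec_sum n f (A (y, x)) \<partial>?X \<partial>?Y)"
      by (rule P.integral_fst'[OF Ai, symmetric])
    moreover have "A (y, x) = (\<lambda>i j. \<kappa> * \<gamma> * symm x i j)" for y x by (intro ext) (simp add: A_def)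
    ultimately show ?thesis using Y.prob_space by (simp add: goe_mean_def)
  qed
  have dfst: "distr ?N ?Y fst = ?Y" by (rule X.distr_pair_fst)
  have dsnd: "distr ?N ?X snd = ?X" by (rule distr_pair_snd[OF Y.prob_space_axioms X.prob_space_axioms])
  have lift_fst: "integrable ?N (\<lambda>w. (fst w i)\<^sup>2)" "(\<integral>w. (fst w i)\<^sup>2 \<partial>?N) = 1" if "i \<le> n" for i
  proof -
    have c: "(\<lambda>y. (y i)\<^sup>2) \<in> borel_measurable ?Y"
      using measurable_gauss_space_coord[of i "{..n}"] that by simp
    show "integrable ?N (\<lambda>w. (fst w i)\<^sup>2)"
      using gauss_space_sq_mean(1)[of "{..n}" i] that by (subst integrable_distr_eq[OF measurable_fst c, symmetric]) (simp add: dfst)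
    show "(\<integral>w. (fst w i)\<^sup>2 \<partial>?N) = 1"
      using gauss_space_sq_mean(2)[of "{..n}" i] that by (subst integral_distr[OF measurable_fst c, symmetric]) (simp add: dfst)
  qed
  have lift_snd: "integrable ?N (\<lambda>w. (snd w q)\<^sup>2)" "(\<integral>w. (snd w q)\<^sup>2 \<partial>?N) = 1" if "q \<in> sq n" for q
  proof -
    have c: "(\<lambda>y. (y q)\<^sup>2) \<in> borel_measurable ?X"
      using measurable_gauss_space_coord[OF that] by simp
    show "integrable ?N (\<lambda>w. (snd w q)\<^sup>2)"
      using gauss_space_sq_mean(1)[of "sq n" q] that by (subst integrable_distr_eq[OF measurable_snd c, symmetric]) (simp add: dsnd)
    show "(\<integral>w. (snd w q)\<^sup>2 \<partial>?N) = 1"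
      using gauss_space_sq_mean(2)[of "sq n" q] that by (subst integral_distr[OF measurable_snd c, symmetric]) (simp add: dsnd)
  qed
  have bdi: "integrable ?N bd" and bdint: "(\<integral>w. bd w \<partial>?N) = \<kappa> * (8 * real n)"
  proof -
    have I: "has_bochner_integral ?N (\<lambda>w. (fst w i)\<^sup>2) 1" if "i \<le> n" for i
      using lift_fst[OF that] by (simp add: has_bochner_integral_iff)
    have J: "has_bochner_integral ?N (\<lambda>w. (snd w q)\<^sup>2) 1" if "q \<in> sq n" for q
      using lift_snd[OF that] by (simp add: has_bochner_integral_iff)
    have O: "has_bochner_integral ?N (\<lambda>w. c) c" for c :: real
      using P.prob_space by (simp add: has_bochner_integral_iff)
    have "has_bochner_integral ?N bd (\<kappa> * (real n * (1 + 1) + (\<Sum>i<n. 1) + real n + (\<Sum>i<n. 1 + 1) + (\<Sum>i<n. 1 + 1)))"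
      unfolding bd_def
      by (intro has_bochner_integral_mult_right has_bochner_integral_add has_bochner_integral_sum I J O) auto
    thus "integrable ?N bd" "(\<integral>w. bd w \<partial>?N) = \<kappa> * (8 * real n)"
      by (auto simp: has_bochner_integral_iff algebra_simps)
  qed
  have "\<bar>(\<integral>w. spec_sum n f (B w) \<partial>?N) - goe_mean n (\<kappa> * \<gamma>) f\<bar>
      = \<bar>\<integral>w. spec_sum n f (B w) - spec_sum n f (A w) \<partial>?N\<bar>"
    using Ai Bi Aint by simp
  also have "\<dots> \<le> (\<integral>w. \<bar>spec_sum n f (B w) - spec_sum n f (A w)\<bar> \<partial>?N)" by (rule integral_abs_bound)
  also have "\<dots> \<le> (\<integral>w. 3 * bd w \<partial>?N)"
    using Ai Bi bdi ptw by (intro integral_mono) auto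
  also have "\<dots> = 24 * \<kappa> * real n" by (simp add: bdint)
  finally show ?thesis by (simp add: B_def[abs_def])
qed

lemma goe_weight_bounds:
  assumes "2 \<le> r" "r \<le> n" "4 \<le> n" shows "0 \<le> goe_weight n r" "goe_weight n r \<le> 1"
proof -
  have "(n - 4) choose (r - 2) \<le> (n - 2) choose (r - 2)"
    using cover_count_facts[OF assms] by linarith
  moreover have "r - 2 \<le> n - 2" using assms by simp
  ultimately show "0 \<le> goe_weight n r" "goe_weight n r \<le> 1"
    by (simp_all add: goe_weight_def divide_le_eq_1)
qed

lemma hypergraph_mean:
  assumes Z: "gauss_fam P {1..n choose r} Z (\<lambda>i j. of_bool (i = j))"
    and e: "bij_betw e {1..n choose r} {S. S \<subseteq> {1..n} \<and> card S = r}"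
    and r: "2 \<le> r" "r \<le> n" and n: "4 \<le> n"
    and f: "1-lipschitz_on UNIV f" "\<And>x. \<bar>f x\<bar> \<le> 1" and \<kappa>: "\<kappa> \<ge> 0"
  shows "\<bar>(\<integral>\<omega>. spec_sum n f (\<lambda>i j. \<kappa> * hypergraph_entry n r e (\<lambda>l. Z l \<omega>) i j) \<partial>P)
      - goe_mean n (\<kappa> * goe_weight n r) f\<bar> \<le> 24 * \<kappa> * real n"
proof -
  obtain \<alpha> \<beta> where ab: "0 \<le> \<alpha>" "\<alpha> \<le> 1" "0 \<le> \<beta>" "\<beta> \<le> 1"
    "\<And>\<kappa>. (\<integral>\<omega>. spec_sum n f (\<lambda>i j. \<kappa> * hypergraph_entry n r e (\<lambda>l. Z l \<omega>) i j) \<partial>P)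
       = (\<integral>w. spec_sum n f (\<lambda>i j. \<kappa> * noise_model \<alpha> \<beta> (goe_weight n r) n w i j)
           \<partial>(gauss_space {..n} \<Otimes>\<^sub>M gauss_space (sq n)))"
    using hypergraph_law[OF Z e r n f(1)] by blast
  show ?thesis unfolding ab(5)
    by (rule noise_model_near_goe[OF f \<kappa>]) (use ab goe_weight_bounds[OF r n] in auto)
qed

text \<open>
The absorption identity for binomial coefficients, applied twice.
\<close>

lemma goe_weight_square:
  assumes r: "2 \<le> r" "r \<le> n" and n: "4 \<le> n"
  shows "(goe_weight n r)\<^sup>2 = (real n - real r) * (real n - real r - 1) / ((real n - 2) * (real n - 3))"
proof -
  define C2 C3 C4 where "C2 = real ((n - 2) choose (r - 2))" and "C3 = real ((n - 3) choose (r - 2))"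
    and "C4 = real ((n - 4) choose (r - 2))"
  have C2: "C2 > 0" using r by (simp add: C2_def)
  have "((n - 2) - (r - 2)) * ((n - 2) choose (r - 2)) = (n - 2) * ((n - 2 - 1) choose (r - 2))"
    by (rule binomial_absorb_comp)
  moreover have "(n - 2) - (r - 2) = n - r" "n - 2 - 1 = n - 3" using r by auto
  ultimately have "real ((n - r) * ((n - 2) choose (r - 2))) = real ((n - 2) * ((n - 3) choose (r - 2)))" by simp
  hence e1: "(real n - real r) * C2 = (real n - 2) * C3"
    using r n by (simp add: C2_def C3_def of_nat_diff)
  have "((n - 3) - (r - 2)) * ((n - 3) choose (r - 2)) = (n - 3) * ((n - 3 - 1) choose (r - 2))"
    by (rule binomial_absorb_comp)
  moreover have "(n - 3) - (r - 2) = n - r - 1" "n - 3 - 1 = n - 4" using r by auto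
  ultimately have "real ((n - r - 1) * ((n - 3) choose (r - 2))) = real ((n - 3) * ((n - 4) choose (r - 2)))" by simp
  hence e2: "real (n - r - 1) * C3 = (real n - 3) * C4"
    using n by (simp add: C3_def C4_def of_nat_diff)
  have e3: "(real n - real r) * real (n - r - 1) = (real n - real r) * (real n - real r - 1)"
    using r by (cases "r = n") (auto simp: of_nat_diff)
  have n': "real n - 2 > 0" "real n - 3 > 0" using n by auto
  have "(goe_weight n r)\<^sup>2 = C4 / C2" by (simp add: goe_weight_def C2_def C4_def)
  moreover have "C4 * ((real n - 2) * (real n - 3)) = (real n - real r) * (real n - real r - 1) * C2"
  proof -
    have "C4 * ((real n - 2) * (real n - 3)) = (real n - 2) * ((real n - 3) * C4)" by simp
    also have "\<dots> = real (n - r - 1) * ((real n - 2) * C3)" by (simp only: e2[symmetric] mult.left_commute)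
    also have "\<dots> = (real n - real r) * real (n - r - 1) * C2" by (simp only: e1[symmetric]) (simp only: ac_simps)
    finally show ?thesis by (simp only: e3)
  qed
  moreover have "(real n - 2) * (real n - 3) \<noteq> 0" using n' by simp
  ultimately show ?thesis using C2 by (simp only: frac_eq_eq less_imp_neq[THEN not_sym] not_False_eq_True)
qed

section \<open>Empirical spectral distributions and convergence\<close>

text \<open>
The empirical spectral distribution is the law of a uniformly chosen eigenvalue.
\<close>

lemma esd_fmat:
  assumes n: "n > 0" and sym: "sym_on n M"
  shows "prob_space (esd (fmat n M))" "sets (esd (fmat n M)) = sets borel"
    "\<And>f :: real \<Rightarrow> real. f \<in> borel_measurable borel \<Longrightarrow> (\<integral>t. f t \<partial>esd (fmat n M)) = spec_sum n f M / real n"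
proof -
  obtain lam u where u: "orth_on n u"
    "\<And>i j. i < n \<Longrightarrow> j < n \<Longrightarrow> M i j = (\<Sum>k<n. lam k * u k i * u k j)"
    using spectral_decomposition[OF sym] by blast
  define U where "U = uniform_count_measure {..<n}"
  interpret U: prob_space U unfolding U_def by (rule prob_space_uniform_count_measure) (use n in auto)
  define D where "D = distr U borel lam"
  have mlam: "lam \<in> U \<rightarrow>\<^sub>M borel" by (simp add: U_def measurable_def)
  have "esd (fmat n M) = measure_of UNIV (sets borel) (emeasure D)"
    unfolding esd_def
  proof (rule measure_of_eq)
    fix B :: "real set" assume "B \<in> sigma_sets UNIV (sets borel)"
    hence B: "B \<in> sets borel" using sets.sigma_sets_eq[of "borel :: real measure"] by simp
    have "(\<Sum>t\<in>#proots (char_poly (fmat n M)). emeasure (return borel t) B) = (\<Sum>k<n. indicator B (lam k))"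
      using B by (simp add: proots_eigenbasis[OF u] image_mset.compositionality comp_def sum_unfold_sum_mset)
    also have "\<dots> = ennreal (real (card {k \<in> {..<n}. lam k \<in> B}))"
      by (simp add: indicator_def sum.If_cases Int_def ennreal_of_nat_eq_real_of_nat)
    finally have "ennreal (1 / real (dim_row (fmat n M))) * (\<Sum>t\<in>#proots (char_poly (fmat n M)). emeasure (return borel t) B)
        = ennreal (real (card {k \<in> {..<n}. lam k \<in> B}) / real n)"
      by (simp add: flip: ennreal_mult)
    also have "\<dots> = emeasure D B"
    proof -
      have "lam -` B \<inter> space U = {k \<in> {..<n}. lam k \<in> B}" by (auto simp: U_def space_uniform_count_measure)
      moreover have "{k \<in> {..<n}. lam k \<in> B} \<subseteq> {..<n}" by auto
      hence "emeasure U {k \<in> {..<n}. lam k \<in> B} = ennreal (real (card {k \<in> {..<n}. lam k \<in> B}) / real n)"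
        unfolding U_def using emeasure_uniform_count_measure[of "{..<n}" "{k \<in> {..<n}. lam k \<in> B}"] by simp
      ultimately show ?thesis using B mlam by (simp add: D_def emeasure_distr)
    qed
    finally show "ennreal (1 / real (dim_row (fmat n M))) * (\<Sum>t\<in>#proots (char_poly (fmat n M)). emeasure (return borel t) B)
        = emeasure D B" .
  qed simp
  also have "\<dots> = D" using measure_of_of_measure[of D] by (simp add: D_def)
  finally have eD: "esd (fmat n M) = D" .
  show "prob_space (esd (fmat n M))" unfolding eD D_def using mlam by (rule U.prob_space_distr)
  show "sets (esd (fmat n M)) = sets borel" unfolding eD D_def by simp
  fix f :: "real \<Rightarrow> real" assume f: "f \<in> borel_measurable borel"
  have "(\<integral>t. f t \<partial>esd (fmat n M)) = (\<integral>k. f (lam k) \<partial>U)"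
    unfolding eD D_def by (rule integral_distr[OF mlam f])
  also have "\<dots> = (\<Sum>k<n. f (lam k)) / real n"
    unfolding U_def by (simp add: integral_uniform_count_measure)
  also have "\<dots> = spec_sum n f M / real n" using spec_sum_eigenbasis[OF u, of f] by simp
  finally show "(\<integral>t. f t \<partial>esd (fmat n M)) = spec_sum n f M / real n" .
qed

lemma cts_step_lipschitz:
  assumes "a < b" shows "(1 / (b - a))-lipschitz_on UNIV (cts_step a b)"
proof (rule lipschitz_onI)
  fix x y
  have e: "cts_step a b z = max 0 (min 1 ((b - z) / (b - a)))" for z
    using assms by (auto simp: cts_step_def divide_simps)
  have "\<bar>cts_step a b x - cts_step a b y\<bar> \<le> \<bar>(b - x) / (b - a) - (b - y) / (b - a)\<bar>"
    unfolding e by (auto simp: max_def min_def)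
  also have "(b - x) / (b - a) - (b - y) / (b - a) = (y - x) / (b - a)"
    by (simp flip: diff_divide_distrib)
  also have "\<bar>(y - x) / (b - a)\<bar> = 1 / (b - a) * \<bar>x - y\<bar>" using assms by (simp add: abs_divide abs_minus_commute)
  finally show "dist (cts_step a b x) (cts_step a b y) \<le> 1 / (b - a) * dist x y" by (simp add: dist_real_def)
qed (use assms in simp)

text \<open>
Half-lines are the limit of continuous step functions, for which measurability is known. Half-lines generate
the Borel sets, which makes the empirical spectral distribution a Markov kernel.
\<close>

lemma spec_sum_atMost_measurable:
  assumes M: "\<And>i j. i < n \<Longrightarrow> j < n \<Longrightarrow> (\<lambda>\<omega>. M \<omega> i j) \<in> borel_measurable P" and sym: "\<And>\<omega>. sym_on n (M \<omega>)"
  shows "(\<lambda>\<omega>. spec_sum n (indicator {..a}) (M \<omega>)) \<in> borel_measurable P"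
proof (rule borel_measurable_LIMSEQ_real)
  define g where "g k = cts_step a (a + 1 / real (Suc k))" for k
  show "(\<lambda>\<omega>. spec_sum n (g k) (M \<omega>)) \<in> borel_measurable P" for k
    unfolding g_def by (rule spec_sum_measurable[OF M sym cts_step_lipschitz]) auto
  fix \<omega>
  obtain lam u where u: "orth_on n u"
    "\<And>i j. i < n \<Longrightarrow> j < n \<Longrightarrow> M \<omega> i j = (\<Sum>k<n. lam k * u k i * u k j)"
    using spectral_decomposition[OF sym] by blast
  have lim: "(\<lambda>k. g k x) \<longlonglongrightarrow> indicator {..a} x" for x
  proof (cases "x \<le> a")
    case False
    have "(\<lambda>k. a + 1 / real (Suc k)) \<longlonglongrightarrow> a + 0" by (intro tendsto_intros lim_1_over_n LIMSEQ_Suc)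
    hence "\<forall>\<^sub>F k in sequentially. a + 1 / real (Suc k) < x" by (rule order_tendstoD(2)) (use False in auto)
    hence "\<forall>\<^sub>F k in sequentially. g k x = indicator {..a} x"
      by eventually_elim (use False in \<open>auto simp: g_def cts_step_def\<close>)
    thus ?thesis by (rule tendsto_eventually)
  qed (simp add: g_def cts_step_def)
  show "(\<lambda>k. spec_sum n (g k) (M \<omega>)) \<longlonglongrightarrow> spec_sum n (indicator {..a}) (M \<omega>)"
  proof -
    have "spec_sum n h (M \<omega>) = (\<Sum>k<n. h (lam k))" for h by (rule spec_sum_eigenbasis[OF u])
    thus ?thesis by (simp only:) (intro tendsto_sum lim)
  qed
qed

lemma esd_kernel:
  assumes n: "n > 0" and M: "\<And>i j. i < n \<Longrightarrow> j < n \<Longrightarrow> (\<lambda>\<omega>. M \<omega> i j) \<in> borel_measurable P"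
    and sym: "\<And>\<omega>. sym_on n (M \<omega>)"
  shows "(\<lambda>\<omega>. esd (fmat n (M \<omega>))) \<in> P \<rightarrow>\<^sub>M prob_algebra borel"
proof (rule measurable_prob_algebra_generated[where \<Omega> = UNIV and G = "range (\<lambda>a :: real. {..a})"])
  show "sets borel = sigma_sets UNIV (range (\<lambda>a :: real. {..a}))"
    by (subst borel_eq_atMost) simp
  show "Int_stable (range (\<lambda>a :: real. {..a}))"
    by (auto simp: Int_stable_def)
  show "prob_space (esd (fmat n (M \<omega>)))" "sets (esd (fmat n (M \<omega>))) = sets borel" for \<omega>
    using esd_fmat[OF n sym] by auto
  fix A :: "real set" assume "A \<in> range (\<lambda>a. {..a})"
  then obtain a where A: "A = {..a}" by auto
  have "emeasure (esd (fmat n (M \<omega>))) A = ennreal (spec_sum n (indicator A) (M \<omega>) / real n)" for \<omega>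
  proof -
    interpret E: prob_space "esd (fmat n (M \<omega>))" by (rule esd_fmat[OF n sym])
    have "measure (esd (fmat n (M \<omega>))) A = (\<integral>t. indicator A t \<partial>esd (fmat n (M \<omega>)))"
      by (simp add: A esd_fmat(2)[OF n sym])
    also have "\<dots> = spec_sum n (indicator A) (M \<omega>) / real n"
      by (rule esd_fmat(3)[OF n sym]) (simp add: A)
    finally show ?thesis by (simp add: E.emeasure_eq_measure)
  qed
  thus "(\<lambda>\<omega>. emeasure (esd (fmat n (M \<omega>))) A) \<in> borel_measurable P"
    using spec_sum_atMost_measurable[OF M sym, of a] by (simp add: A)
qed auto

text \<open>
The mixture of the empirical spectral distributions over the probability space has the defining
property, and testing with indicators shows that nothing else has it.
\<close>

lemma expected_esd_props:
  assumes P: "prob_space P" and n: "n > 0"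
    and M: "\<And>i j. i < n \<Longrightarrow> j < n \<Longrightarrow> (\<lambda>\<omega>. M \<omega> i j) \<in> borel_measurable P"
    and sym: "\<And>\<omega>. sym_on n (M \<omega>)"
  defines "\<mu> \<equiv> expected_esd P (\<lambda>\<omega>. fmat n (M \<omega>))"
  shows "real_distribution \<mu>"
    "f \<in> borel_measurable borel \<Longrightarrow> bounded (range f) \<Longrightarrow> (\<integral>t. f t \<partial>\<mu>) = (\<integral>\<omega>. spec_sum n f (M \<omega>) \<partial>P) / real n"
proof -
  interpret prob_space P by fact
  let ?E = "\<lambda>\<omega>. esd (fmat n (M \<omega>))"
  define Q where "Q \<nu> \<longleftrightarrow> sets \<nu> = sets borel \<and> prob_space \<nu> \<and>
     (\<forall>f \<in> borel_measurable borel. bounded (range f) \<longrightarrow>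
        has_bochner_integral P (\<lambda>\<omega>. \<integral>t. f t \<partial>?E \<omega>) (\<integral>t. f t \<partial>\<nu> :: real))" for \<nu> :: "real measure"
  have K: "?E \<in> P \<rightarrow>\<^sub>M prob_algebra borel" by (rule esd_kernel[OF n M sym])
  have K': "?E \<in> P \<rightarrow>\<^sub>M subprob_algebra borel" by (rule measurable_prob_algebraD[OF K])
  have Pin: "P \<in> space (prob_algebra P)" by (simp add: space_prob_algebra P)
  have ex: "Q (P \<bind> ?E)"
    unfolding Q_def
  proof (intro conjI ballI impI)
    show "sets (P \<bind> ?E) = sets borel" by (rule sets_bind'[OF Pin K])
    show "prob_space (P \<bind> ?E)" by (rule prob_space_bind'[OF Pin K])
    fix f :: "real \<Rightarrow> real" assume f: "f \<in> borel_measurable borel" "bounded (range f)"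
    obtain B where B: "\<And>x. norm (f x) \<le> B" using f(2) by (auto simp: bounded_iff)
    have m: "(\<lambda>\<omega>. \<integral>t. f t \<partial>?E \<omega>) \<in> borel_measurable P"
      by (rule measurable_compose[OF K' integral_measurable_subprob_algebra[OF f(1)]])
    have b: "norm (\<integral>t. f t \<partial>?E \<omega>) \<le> B" for \<omega>
    proof -
      interpret E: prob_space "?E \<omega>" by (rule esd_fmat[OF n sym])
      have fi: "integrable (?E \<omega>) f"
        using B f(1) by (intro E.integrable_const_bound[where B = B]) (auto simp: measurable_cong_sets[OF esd_fmat(2)[OF n sym] refl])
      have "norm (\<integral>t. f t \<partial>?E \<omega>) \<le> (\<integral>t. norm (f t) \<partial>?E \<omega>)" by (rule integral_norm_bound)
      also have "\<dots> \<le> (\<integral>t. B \<partial>?E \<omega>)" using fi B by (intro integral_mono) auto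
      finally show ?thesis using E.prob_space by simp
    qed
    have "integrable P (\<lambda>\<omega>. \<integral>t. f t \<partial>?E \<omega>)"
      using m b by (intro integrable_const_bound[where B = B]) auto
    moreover have "(\<integral>t. f t \<partial>(P \<bind> ?E)) = (\<integral>\<omega>. \<integral>t. f t \<partial>?E \<omega> \<partial>P)"
    proof (rule integral_bind[where K = borel and B = B and B' = 1])
      show "AE \<omega> in P. emeasure (?E \<omega>) (space (?E \<omega>)) \<le> ennreal 1"
        using prob_space.emeasure_space_1[OF esd_fmat(1)[OF n sym]] by simp
      show "?E \<in> P \<rightarrow>\<^sub>M subprob_algebra borel" by (rule K')
    qed (use f B finite_measure_axioms not_empty in \<open>auto intro!: AE_I2\<close>)
    ultimately show "has_bochner_integral P (\<lambda>\<omega>. \<integral>t. f t \<partial>?E \<omega>) (\<integral>t. f t \<partial>(P \<bind> ?E))"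
      by (simp add: has_bochner_integral_iff)
  qed
  have uniq: "\<nu> = \<nu>'" if "Q \<nu>" "Q \<nu>'" for \<nu> \<nu>'
  proof (rule measure_eqI)
    show "sets \<nu> = sets \<nu>'" using that by (simp add: Q_def)
    fix A assume "A \<in> sets \<nu>"
    hence A: "A \<in> sets borel" using that by (simp add: Q_def)
    interpret N: prob_space \<nu> using that by (simp add: Q_def)
    interpret N': prob_space \<nu>' using that by (simp add: Q_def)
    have "bounded (range (indicator A :: real \<Rightarrow> real))"
      by (rule boundedI[of _ 1]) (auto simp: indicator_def)
    hence "has_bochner_integral P (\<lambda>\<omega>. \<integral>t. indicator A t \<partial>?E \<omega>) (\<integral>t. indicator A t \<partial>\<nu> :: real)"
      "has_bochner_integral P (\<lambda>\<omega>. \<integral>t. indicator A t \<partial>?E \<omega>) (\<integral>t. indicator A t \<partial>\<nu>' :: real)"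
      using that A unfolding Q_def by auto
    hence "(\<integral>t. indicator A t \<partial>\<nu> :: real) = (\<integral>t. indicator A t \<partial>\<nu>')"
      by (rule has_bochner_integral_eq)
    moreover have "sets \<nu> = sets borel" "sets \<nu>' = sets borel" using that by (simp_all add: Q_def)
    ultimately show "emeasure \<nu> A = emeasure \<nu>' A"
      using A by (simp add: N.emeasure_eq_measure N'.emeasure_eq_measure)
  qed
  have "\<mu> = (THE \<nu>. Q \<nu>)" unfolding \<mu>_def expected_esd_def Q_def ..
  also have "\<dots> = P \<bind> ?E" by (rule the_equality[where P = Q, OF ex uniq[OF _ ex]])
  finally have Q\<mu>: "Q \<mu>" using ex by simp
  show "real_distribution \<mu>"
    using Q\<mu> by (simp add: Q_def real_distribution_def real_distribution_axioms_def)
  show "(\<integral>t. f t \<partial>\<mu>) = (\<integral>\<omega>. spec_sum n f (M \<omega>) \<partial>P) / real n"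
    if f: "f \<in> borel_measurable borel" "bounded (range f)"
  proof -
    have "has_bochner_integral P (\<lambda>\<omega>. \<integral>t. f t \<partial>?E \<omega>) (\<integral>t. f t \<partial>\<mu>)"
      using Q\<mu> f unfolding Q_def by blast
    hence "(\<integral>t. f t \<partial>\<mu>) = (\<integral>\<omega>. \<integral>t. f t \<partial>?E \<omega> \<partial>P)" by (simp add: has_bochner_integral_iff)
    also have "\<dots> = (\<integral>\<omega>. spec_sum n f (M \<omega>) / real n \<partial>P)" by (simp add: esd_fmat(3)[OF n sym f(1)])
    finally show ?thesis by simp
  qed
qed

lemma H_mat_fmat:
  "(1 / sqrt (real n)) \<cdot>\<^sub>m H_mat n r e z = fmat n (\<lambda>i j. 1 / sqrt (real n) * hypergraph_entry n r e z i j)"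
proof (rule eq_matI)
  fix i j assume "i < dim_row (fmat n (\<lambda>i j. 1 / sqrt (real n) * hypergraph_entry n r e z i j))"
    "j < dim_col (fmat n (\<lambda>i j. 1 / sqrt (real n) * hypergraph_entry n r e z i j))"
  hence ij: "i < n" "j < n" by auto
  have e: "edge_mat n S $$ (i, j) = of_bool (i \<noteq> j \<and> Suc i \<in> S \<and> Suc j \<in> S)" for S
    using ij by (simp add: edge_mat_def mat_diag_def edge_vec_def)
  show "((1 / sqrt (real n)) \<cdot>\<^sub>m H_mat n r e z) $$ (i, j) = fmat n (\<lambda>i j. 1 / sqrt (real n) * hypergraph_entry n r e z i j) $$ (i, j)"
    using ij by (simp add: H_mat_def fmat_def hypergraph_entry_def e mult.commute)
qed (auto simp: H_mat_def)

text \<open>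
The constant 79 collects three comparisons: 24 for the hypergraph matrix and the Gaussian orthogonal
ensemble, 53 for the ensemble and the arcsine laws, and 2 for the Riemann sum.
\<close>

lemma hypergraph_semicircle_bound:
  assumes P: "prob_space P" and Z: "gauss_fam P {1..n choose r} Z (\<lambda>i j. of_bool (i = j))"
    and e: "bij_betw e {1..n choose r} {S. S \<subseteq> {1..n} \<and> card S = r}"
    and r: "2 \<le> r" "r \<le> n" and n: "4 \<le> n" and \<gamma>: "goe_weight n r > 0" and s: "s > 0"
  defines "\<mu> \<equiv> expected_esd P (\<lambda>\<omega>. (1 / sqrt (real n)) \<cdot>\<^sub>m H_mat n r e (\<lambda>l. Z l \<omega>))"
  shows "real_distribution \<mu>"
    "1-lipschitz_on UNIV f \<Longrightarrow> (\<And>x. \<bar>f x\<bar> \<le> 1) \<Longrightarrow>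
      \<bar>(\<integral>t. f t \<partial>\<mu>) - (\<integral>t. f t \<partial>semicircle (s\<^sup>2))\<bar> \<le> 79 / sqrt (real n) + 2 * \<bar>s - goe_weight n r\<bar>"
proof -
  let ?\<gamma> = "goe_weight n r"
  define \<kappa> where "\<kappa> = 1 / sqrt (real n)"
  have \<kappa>: "\<kappa> > 0" using n by (simp add: \<kappa>_def)
  define M where "M \<omega> i j = \<kappa> * hypergraph_entry n r e (\<lambda>l. Z l \<omega>) i j" for \<omega> i j
  have \<mu>: "\<mu> = expected_esd P (\<lambda>\<omega>. fmat n (M \<omega>))"
    unfolding \<mu>_def H_mat_fmat M_def \<kappa>_def ..
  have sym: "sym_on n (M \<omega>)" for \<omega> by (auto simp: sym_on_def M_def intro: hypergraph_entry_sym)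
  have meas: "(\<lambda>\<omega>. M \<omega> i j) \<in> borel_measurable P" for i j
    unfolding M_def hypergraph_entry_def using Z
    by (intro borel_measurable_times borel_measurable_divide borel_measurable_sum borel_measurable_const) (auto simp: gauss_fam_def)
  have n0: "n > 0" using n by simp
  note props = expected_esd_props[OF P n0 meas sym, folded \<mu>]
  show "real_distribution \<mu>" by (rule props(1))
  assume f: "1-lipschitz_on UNIV f" "\<And>x. \<bar>f x\<bar> \<le> 1"
  define N where "N = real n"
  have N: "N > 0" using n by (simp add: N_def)
  have \<gamma>1: "?\<gamma> \<le> 1" by (rule goe_weight_bounds[OF r n])
  have "(\<integral>t. f t \<partial>\<mu>) = (\<integral>\<omega>. spec_sum n f (M \<omega>) \<partial>P) / N"
    unfolding N_def
  proof (rule props(2))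
    show "f \<in> borel_measurable borel" by (rule borel_measurable_continuous_onI[OF lipschitz_cont[OF f(1)]])
    show "bounded (range f)" using f(2) by (intro boundedI[of _ 1]) auto
  qed
  hence 1: "\<bar>(\<integral>t. f t \<partial>\<mu>) - goe_mean n (\<kappa> * ?\<gamma>) f / N\<bar> \<le> 24 * \<kappa>"
  proof -
    have "\<bar>(\<integral>\<omega>. spec_sum n f (M \<omega>) \<partial>P) - goe_mean n (\<kappa> * ?\<gamma>) f\<bar> \<le> 24 * \<kappa> * N"
      unfolding M_def N_def by (rule hypergraph_mean[OF Z e r n f]) (use \<kappa> in simp)
    hence "\<bar>(\<integral>\<omega>. spec_sum n f (M \<omega>) \<partial>P) - goe_mean n (\<kappa> * ?\<gamma>) f\<bar> / N \<le> 24 * \<kappa>"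
      using N by (simp add: pos_divide_le_eq)
    moreover have "\<bar>(\<integral>\<omega>. spec_sum n f (M \<omega>) \<partial>P) - goe_mean n (\<kappa> * ?\<gamma>) f\<bar> / N
        = \<bar>(\<integral>\<omega>. spec_sum n f (M \<omega>) \<partial>P) / N - goe_mean n (\<kappa> * ?\<gamma>) f / N\<bar>"
      using N by (simp flip: diff_divide_distrib)
    ultimately show ?thesis using \<open>(\<integral>t. f t \<partial>\<mu>) = (\<integral>\<omega>. spec_sum n f (M \<omega>) \<partial>P) / N\<close> by simp
  qed
  define \<Sigma> where "\<Sigma> = (\<Sum>k<n. arcsine_mean f (\<kappa> * ?\<gamma> * real (isqrt k)))"
  have 2: "\<bar>goe_mean n (\<kappa> * ?\<gamma>) f / N - \<Sigma> / N\<bar> \<le> 53 * \<kappa>"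
  proof -
    have "\<bar>goe_mean n (\<kappa> * ?\<gamma>) f - \<Sigma>\<bar> \<le> 49 * (\<kappa> * ?\<gamma>) * N + 4 * sqrt N"
      unfolding \<Sigma>_def N_def by (rule goe_mean_arcsine[OF f]) (use \<kappa> \<gamma> n in auto)
    also have "\<dots> \<le> 49 * (\<kappa> * 1) * N + 4 * (\<kappa> * N)"
    proof (intro add_mono mult_right_mono mult_left_mono \<gamma>1)
      show "sqrt N \<le> \<kappa> * N" using N by (simp add: \<kappa>_def N_def real_div_sqrt)
    qed (use \<kappa> N in auto)
    finally have "\<bar>goe_mean n (\<kappa> * ?\<gamma>) f - \<Sigma>\<bar> / N \<le> 53 * \<kappa>" using N by (simp add: pos_divide_le_eq algebra_simps)
    moreover have "\<bar>goe_mean n (\<kappa> * ?\<gamma>) f - \<Sigma>\<bar> / N = \<bar>goe_mean n (\<kappa> * ?\<gamma>) f / N - \<Sigma> / N\<bar>"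
      using N by (simp flip: diff_divide_distrib)
    ultimately show ?thesis by simp
  qed
  have 3: "\<bar>radial_mean f s - \<Sigma> / N\<bar> \<le> 2 * (\<bar>s - ?\<gamma>\<bar> + \<kappa>)"
  proof -
    have "\<Sigma> = (\<Sum>k<n. arcsine_mean f (?\<gamma> / sqrt (real n) * real (isqrt k)))"
      unfolding \<Sigma>_def by (intro sum.cong refl) (simp add: \<kappa>_def)
    thus ?thesis using radial_riemann[OF f(1), of ?\<gamma> n s] \<gamma> \<gamma>1 n by (simp add: N_def \<kappa>_def)
  qed
  have "\<bar>(\<integral>t. f t \<partial>\<mu>) - (\<integral>t. f t \<partial>semicircle (s\<^sup>2))\<bar> \<le> 79 * \<kappa> + 2 * \<bar>s - ?\<gamma>\<bar>"
  proof -
    have tri: "\<bar>p - q\<bar> \<le> \<bar>p - u\<bar> + \<bar>u - v\<bar> + \<bar>q - v\<bar>" for p q u v :: real by linarith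
    have "\<bar>(\<integral>t. f t \<partial>\<mu>) - radial_mean f s\<bar> \<le> 24 * \<kappa> + 53 * \<kappa> + 2 * (\<bar>s - ?\<gamma>\<bar> + \<kappa>)"
      by (rule order_trans[OF tri add_mono[OF add_mono[OF 1 2] 3]])
    thus ?thesis unfolding integral_semicircle[OF s f] by simp
  qed
  thus "\<bar>(\<integral>t. f t \<partial>\<mu>) - (\<integral>t. f t \<partial>semicircle (s\<^sup>2))\<bar> \<le> 79 / sqrt (real n) + 2 * \<bar>s - ?\<gamma>\<bar>"
    by (simp add: \<kappa>_def)
qed

lemma lip_norm_nonneg: "0 \<le> lip_norm f"
  unfolding lip_norm_def by (rule SUP_upper2[of "(0, 1)"]) auto

lemma sup_norm_nonneg: "0 \<le> sup_norm f"
  unfolding sup_norm_def by (rule SUP_upper2[of 0]) auto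

lemma BL_unit_ball:
  assumes "lip_norm f + sup_norm f \<le> 1"
  shows "1-lipschitz_on UNIV f" "\<bar>f x\<bar> \<le> 1"
proof -
  have "lip_norm f + 0 \<le> lip_norm f + sup_norm f" "0 + sup_norm f \<le> lip_norm f + sup_norm f"
    by (intro add_mono order_refl lip_norm_nonneg sup_norm_nonneg)+
  hence le: "lip_norm f \<le> 1" "sup_norm f \<le> 1" using assms by (auto intro: order_trans)
  have "ereal \<bar>f x\<bar> \<le> sup_norm f" unfolding sup_norm_def by (rule SUP_upper) simp
  hence "ereal \<bar>f x\<bar> \<le> 1" using le(2) by (rule order_trans)
  thus "\<bar>f x\<bar> \<le> 1" by (simp add: one_ereal_def)
  show "1-lipschitz_on UNIV f"
  proof (rule lipschitz_onI)
    fix x y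
    show "dist (f x) (f y) \<le> 1 * dist x y"
    proof (cases "x = y")
      case False
      have "ereal (\<bar>f x - f y\<bar> / \<bar>x - y\<bar>) \<le> lip_norm f"
        unfolding lip_norm_def by (rule SUP_upper2[of "(x, y)"]) (use False in auto)
      hence "ereal (\<bar>f x - f y\<bar> / \<bar>x - y\<bar>) \<le> 1" using le(1) by (rule order_trans)
      hence "\<bar>f x - f y\<bar> / \<bar>x - y\<bar> \<le> 1" by (simp add: one_ereal_def)
      thus ?thesis using False by (simp add: dist_real_def divide_le_eq)
    qed simp
  qed simp
qed

lemma d_BL_le:
  assumes "\<And>f. 1-lipschitz_on UNIV f \<Longrightarrow> (\<And>x. \<bar>f x\<bar> \<le> 1) \<Longrightarrow> \<bar>(\<integral>t. f t \<partial>\<mu>) - (\<integral>t. f t \<partial>\<nu>)\<bar> \<le> C"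
  shows "0 \<le> d_BL \<mu> \<nu>" "d_BL \<mu> \<nu> \<le> C"
proof -
  have z: "(\<lambda>_. 0) \<in> {f. lip_norm f + sup_norm f \<le> 1}"
  proof -
    have "lip_norm (\<lambda>_. 0) \<le> 0" unfolding lip_norm_def by (rule SUP_least) auto
    moreover have "sup_norm (\<lambda>_. 0) \<le> 0" unfolding sup_norm_def by (rule SUP_least) auto
    ultimately have "lip_norm (\<lambda>_. 0) + sup_norm (\<lambda>_. 0) \<le> 0 + 0" by (rule add_mono)
    thus ?thesis by (auto intro: order_trans)
  qed
  have b: "\<bar>(\<integral>t. f t \<partial>\<mu>) - (\<integral>t. f t \<partial>\<nu>)\<bar> \<le> C" if "f \<in> {f. lip_norm f + sup_norm f \<le> 1}" for f
    using that by (intro assms BL_unit_ball) auto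
  show "d_BL \<mu> \<nu> \<le> C" unfolding d_BL_def by (rule cSUP_least) (use z b in auto)
  have "\<bar>(\<integral>t. 0 \<partial>\<mu>) - (\<integral>t. 0 \<partial>\<nu> :: real)\<bar> \<le> d_BL \<mu> \<nu>"
    unfolding d_BL_def by (rule cSUP_upper2[OF _ z]) (use b in \<open>auto intro!: bdd_aboveI2[where M = C]\<close>)
  thus "0 \<le> d_BL \<mu> \<nu>" by simp
qed

text \<open>
Multiples of the piecewise linear step functions are admissible test functions, and they detect weak
convergence.
\<close>

lemma weak_conv_lipschitz_rate:
  fixes R :: "nat \<Rightarrow> real"
  assumes sc: "real_distribution \<nu>"
    and main: "\<forall>\<^sub>F n in sequentially. real_distribution (\<mu> n) \<and>
      (\<forall>f. 1-lipschitz_on UNIV f \<longrightarrow> (\<forall>x. \<bar>f x\<bar> \<le> 1) \<longrightarrow> \<bar>(\<integral>t. f t \<partial>\<mu> n) - (\<integral>t. f t \<partial>\<nu>)\<bar> \<le> R n)"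
    and R0: "R \<longlonglongrightarrow> 0"
  shows "weak_conv_m \<mu> \<nu>"
proof -
  obtain n0 where n0: "\<And>n. n \<ge> n0 \<Longrightarrow> real_distribution (\<mu> n)"
    "\<And>n f. n \<ge> n0 \<Longrightarrow> 1-lipschitz_on UNIV f \<Longrightarrow> (\<And>x. \<bar>f x\<bar> \<le> 1) \<Longrightarrow>
      \<bar>(\<integral>t. f t \<partial>\<mu> n) - (\<integral>t. f t \<partial>\<nu>)\<bar> \<le> R n"
    using main unfolding eventually_sequentially by blast
  \<comment> \<open>The criterion concerns sequences of probability measures, so the initial members are replaced.\<close>
  define \<mu>' where "\<mu>' n = (if n \<ge> n0 then \<mu> n else \<nu>)" for n
  have "weak_conv_m \<mu>' \<nu>"
  proof (rule integral_cts_step_conv_imp_weak_conv)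
    show "real_distribution (\<mu>' n)" for n using n0(1) sc by (simp add: \<mu>'_def)
    show "real_distribution \<nu>" by (rule sc)
    fix x y :: real assume xy: "x < y"
    \<comment> \<open>Scaling by \<open>d\<close> brings the step function into the class of test functions.\<close>
    define d where "d = min 1 (y - x)"
    have d: "0 < d" "d \<le> 1" "d \<le> y - x" using xy by (auto simp: d_def)
    define g where "g t = d * cts_step x y t" for t
    have "1-lipschitz_on UNIV g"
    proof (rule lipschitz_onI)
      fix a b :: real
      have "\<bar>cts_step x y a - cts_step x y b\<bar> \<le> 1 / (y - x) * \<bar>a - b\<bar>"
        by (rule lipschitz_abs[OF cts_step_lipschitz[OF xy]])
      hence "d * \<bar>cts_step x y a - cts_step x y b\<bar> \<le> (y - x) * (1 / (y - x) * \<bar>a - b\<bar>)"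
        using d by (intro mult_mono) auto
      also have "\<dots> = \<bar>a - b\<bar>" using xy by simp
      finally show "dist (g a) (g b) \<le> 1 * dist a b"
        using d by (simp add: g_def dist_real_def abs_mult flip: right_diff_distrib)
    qed simp
    moreover have "\<bar>g t\<bar> \<le> 1" for t
    proof -
      have "0 \<le> cts_step x y t" "cts_step x y t \<le> 1" using xy by (auto simp: cts_step_def)
      hence "d * cts_step x y t \<le> 1 * 1" using d by (intro mult_mono) auto
      thus ?thesis using \<open>0 \<le> cts_step x y t\<close> d by (simp add: g_def)
    qed
    ultimately have b: "\<bar>(\<integral>t. g t \<partial>\<mu> n) - (\<integral>t. g t \<partial>\<nu>)\<bar> \<le> R n" if "n \<ge> n0" for n
      using n0(2)[OF that] by blast
    have "((\<lambda>n. (\<integral>t. g t \<partial>\<mu>' n) - (\<integral>t. g t \<partial>\<nu>)) \<longlongrightarrow> 0) sequentially"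
    proof (rule Lim_null_comparison[OF _ R0])
      show "\<forall>\<^sub>F n in sequentially. norm ((\<integral>t. g t \<partial>\<mu>' n) - (\<integral>t. g t \<partial>\<nu>)) \<le> R n"
        using eventually_ge_at_top[of n0] by eventually_elim (use b in \<open>auto simp: \<mu>'_def\<close>)
    qed
    hence "(\<lambda>n. (\<integral>t. g t \<partial>\<mu>' n) / d) \<longlonglongrightarrow> (\<integral>t. g t \<partial>\<nu>) / d"
      using d by (intro tendsto_divide tendsto_const) (auto simp: LIM_zero_iff)
    thus "(\<lambda>n. \<integral>t. cts_step x y t \<partial>\<mu>' n) \<longlonglongrightarrow> (\<integral>t. cts_step x y t \<partial>\<nu>)"
      using d by (simp add: g_def)
  qed
  moreover have "\<forall>\<^sub>F n in sequentially. cdf (\<mu>' n) t = cdf (\<mu> n) t" for t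
    using eventually_ge_at_top[of n0] by eventually_elim (simp add: \<mu>'_def)
  hence "((\<lambda>n. cdf (\<mu>' n) t) \<longlonglongrightarrow> L) \<longleftrightarrow> ((\<lambda>n. cdf (\<mu> n) t) \<longlonglongrightarrow> L)" for t L
    by (rule tendsto_cong)
  ultimately show ?thesis by (simp add: weak_conv_m_def weak_conv_def)
qed

text \<open>
Compare \<open>\<gamma>\<^sup>2\<close> with \<open>(1 - r / n)\<^sup>2\<close> and this with \<open>(1 - c)\<^sup>2\<close>. Passing from squares to their roots costs a factor
\<open>1 / (1 - c)\<close>, which is finite because \<open>c < 1\<close>.
\<close>

lemma goe_weight_approx:
  assumes r: "2 \<le> r" "r \<le> n" and n: "6 \<le> n" and c: "0 \<le> c" "c < 1"
  shows "\<bar>(1 - c) - goe_weight n r\<bar> \<le> (36 / real n + 2 * \<bar>real r / real n - c\<bar>) / (1 - c)"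
proof -
  let ?\<gamma> = "goe_weight n r"
  define x where "x = real r / real n"
  define h where "h = 1 / real n"
  have n0: "real n > 0" using n by simp
  have h: "0 < h" "h \<le> 1 / 6" using n by (auto simp: h_def field_simps)
  have x: "0 \<le> x" "x \<le> 1" using r n0 by (auto simp: x_def)
  define D where "D = (1 - 2 * h) * (1 - 3 * h)"
  have "(1 - 2 * h) * (1 - 3 * h) = 1 - 5 * h + 6 * (h * h)" by (simp add: algebra_simps)
  moreover have "h * h \<ge> 0" by simp
  ultimately have "D \<ge> 1 - 5 * h" unfolding D_def by linarith
  hence D: "D \<ge> 1 - 5 * h" "D \<ge> 1 / 6" using h by linarith+
  have "D \<le> 1 * 1" unfolding D_def using h by (intro mult_mono) auto
  hence D1: "D \<le> 1" by simp
  have g2: "?\<gamma>\<^sup>2 = (1 - x) * (1 - x - h) / D"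
  proof -
    have "?\<gamma>\<^sup>2 = (real n - real r) * (real n - real r - 1) / ((real n - 2) * (real n - 3))"
      by (rule goe_weight_square) (use r n in auto)
    moreover have "real n - real r = real n * (1 - x)" "real n - real r - 1 = real n * (1 - x - h)"
      "real n - 2 = real n * (1 - 2 * h)" "real n - 3 = real n * (1 - 3 * h)"
      using n0 by (simp_all add: x_def h_def field_simps)
    ultimately have "?\<gamma>\<^sup>2 = (real n * (1 - x)) * (real n * (1 - x - h)) / ((real n * (1 - 2 * h)) * (real n * (1 - 3 * h)))" by simp
    also have "\<dots> = (real n * real n) * ((1 - x) * (1 - x - h)) / ((real n * real n) * D)" by (simp add: D_def ac_simps)
    also have "\<dots> = (1 - x) * (1 - x - h) / D" using n0 by simp
    finally show ?thesis .
  qed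
  have 1: "\<bar>?\<gamma>\<^sup>2 - (1 - x)\<^sup>2\<bar> \<le> 36 * h"
  proof -
    have "?\<gamma>\<^sup>2 - (1 - x)\<^sup>2 = (1 - x) * ((1 - x) * (1 - D) - h) / D"
      using D unfolding g2 by (simp add: power2_eq_square field_simps)
    moreover have "\<bar>(1 - x) * ((1 - x) * (1 - D) - h)\<bar> \<le> 1 * (6 * h)"
      unfolding abs_mult
    proof (intro mult_mono)
      have "0 \<le> (1 - x) * (1 - D)" using x D1 by simp
      moreover have "(1 - x) * (1 - D) \<le> 1 * (5 * h)"
        by (intro mult_mono) (use x D D1 in linarith)+
      ultimately have "0 \<le> (1 - x) * (1 - D)" "(1 - x) * (1 - D) \<le> 5 * h" by simp_all
      thus "\<bar>(1 - x) * (1 - D) - h\<bar> \<le> 6 * h" using h by auto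
    qed (use x in auto)
    ultimately have "\<bar>?\<gamma>\<^sup>2 - (1 - x)\<^sup>2\<bar> \<le> 6 * h / D"
      using D by (simp add: abs_divide divide_right_mono)
    also have "\<dots> \<le> 6 * h / (1 / 6)" using D h by (intro divide_left_mono) auto
    finally show ?thesis by simp
  qed
  have 2: "\<bar>(1 - x)\<^sup>2 - (1 - c)\<^sup>2\<bar> \<le> 2 * \<bar>x - c\<bar>"
  proof -
    have "(1 - x)\<^sup>2 - (1 - c)\<^sup>2 = (c - x) * (2 - x - c)" by (simp add: power2_eq_square algebra_simps)
    hence "\<bar>(1 - x)\<^sup>2 - (1 - c)\<^sup>2\<bar> = \<bar>x - c\<bar> * \<bar>2 - x - c\<bar>" by (simp add: abs_mult abs_minus_commute)
    also have "\<dots> \<le> \<bar>x - c\<bar> * 2" using x c by (intro mult_left_mono) auto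
    finally show ?thesis by simp
  qed
  have g0: "?\<gamma> \<ge> 0" by (simp add: goe_weight_def)
  have "\<bar>(1 - c) - ?\<gamma>\<bar> * (1 - c) \<le> \<bar>(1 - c) - ?\<gamma>\<bar> * ((1 - c) + ?\<gamma>)"
    using g0 by (intro mult_left_mono) auto
  also have "\<dots> = \<bar>((1 - c) - ?\<gamma>) * ((1 - c) + ?\<gamma>)\<bar>" using g0 c by (simp add: abs_mult)
  also have "((1 - c) - ?\<gamma>) * ((1 - c) + ?\<gamma>) = (1 - c)\<^sup>2 - ?\<gamma>\<^sup>2" by (simp add: power2_eq_square algebra_simps)
  also have "\<bar>(1 - c)\<^sup>2 - ?\<gamma>\<^sup>2\<bar> \<le> 36 * h + 2 * \<bar>x - c\<bar>" using 1 2 by linarith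
  finally show ?thesis using c by (simp add: pos_le_divide_eq h_def x_def)
qed

theorem theorem2p2:
  fixes r :: "nat \<Rightarrow> nat"
    and c :: real
    and e :: "nat \<Rightarrow> nat \<Rightarrow> nat set"
    and P :: "nat \<Rightarrow> 'a measure"
    and Z :: "nat \<Rightarrow> nat \<Rightarrow> 'a \<Rightarrow> real"
  assumes r_bounds: "\<And>n. n \<ge> 2 \<Longrightarrow> 2 \<le> r n \<and> r n \<le> n"
    and r_lim: "(\<lambda>n. real (r n) / real n) \<longlonglongrightarrow> c"
    and c_range: "0 \<le> c" "c < 1"
    and enum: "\<And>n. n \<ge> 2 \<Longrightarrow>
      bij_betw (e n) {1..n choose r n} {S. S \<subseteq> {1..n} \<and> card S = r n}"
    and prob: "\<And>n. n \<ge> 2 \<Longrightarrow> prob_space (P n)"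
    and indep: "\<And>n. n \<ge> 2 \<Longrightarrow>
      prob_space.indep_vars (P n) (\<lambda>_. borel) (Z n) {1..n choose r n}"
    and gauss: "\<And>n l. n \<ge> 2 \<Longrightarrow> l \<in> {1..n choose r n} \<Longrightarrow>
      distributed (P n) lborel (Z n l) std_normal_density"
  defines "\<mu> \<equiv> \<lambda>n. expected_esd (P n)
      (\<lambda>\<omega>. (1 / sqrt (real n)) \<cdot>\<^sub>m H_mat n (r n) (e n) (\<lambda>l. Z n l \<omega>))"
  shows "weak_conv_m \<mu> (semicircle ((1 - c)\<^sup>2)) \<and>
    (\<lambda>n. d_BL (\<mu> n) (semicircle ((1 - c)\<^sup>2)))
      \<in> O(\<lambda>n. max \<bar>real (r n) / real n - c\<bar> (1 / sqrt (real n)))"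
proof -
  define s where "s = 1 - c"
  have s: "s > 0" using c_range by (simp add: s_def)
  define K where "K = 79 + 76 / s"
  define R where "R n = max \<bar>real (r n) / real n - c\<bar> (1 / sqrt (real n))" for n
  have lim_inv: "(\<lambda>n. 1 / sqrt (real n)) \<longlonglongrightarrow> 0" by real_asymp
  have lim_x: "(\<lambda>n. \<bar>real (r n) / real n - c\<bar>) \<longlonglongrightarrow> 0"
    using r_lim by (simp add: LIM_zero tendsto_rabs_zero)
  have R0: "R \<longlonglongrightarrow> 0" unfolding R_def using tendsto_max[OF lim_x lim_inv] by simp
  have small: "\<forall>\<^sub>F n in sequentially. (36 / real n + 2 * \<bar>real (r n) / real n - c\<bar>) / s < s"
  proof (rule order_tendstoD(2))
    have "(\<lambda>n. (36 / real n + 2 * \<bar>real (r n) / real n - c\<bar>) / s) \<longlonglongrightarrow> (0 + 2 * 0) / s"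
      by (intro tendsto_intros lim_x) (real_asymp | use s in simp)+
    thus "(\<lambda>n. (36 / real n + 2 * \<bar>real (r n) / real n - c\<bar>) / s) \<longlonglongrightarrow> 0" by simp
  qed (rule s)
  have main: "\<forall>\<^sub>F n in sequentially. real_distribution (\<mu> n) \<and>
      (\<forall>f. 1-lipschitz_on UNIV f \<longrightarrow> (\<forall>x. \<bar>f x\<bar> \<le> 1) \<longrightarrow>
        \<bar>(\<integral>t. f t \<partial>\<mu> n) - (\<integral>t. f t \<partial>semicircle (s\<^sup>2))\<bar> \<le> K * R n)"
    using small eventually_ge_at_top[of 6]
  proof eventually_elim
    case (elim n)
    have n2: "n \<ge> 2" using elim by simp
    have r: "2 \<le> r n" "r n \<le> n" using r_bounds[OF n2] by auto
    have ap: "\<bar>s - goe_weight n (r n)\<bar> \<le> (36 / real n + 2 * \<bar>real (r n) / real n - c\<bar>) / s"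
      unfolding s_def by (rule goe_weight_approx[OF r elim(2) c_range])
    hence \<gamma>: "goe_weight n (r n) > 0" using elim(1) by linarith
    have Z: "gauss_fam (P n) {1..n choose r n} (Z n) (\<lambda>i j. of_bool (i = j))"
      by (rule gauss_fam_indep[OF prob[OF n2] _ indep[OF n2] gauss[OF n2]]) auto
    have n4: "4 \<le> n" using elim by simp
    note B = hypergraph_semicircle_bound[OF prob[OF n2] Z enum[OF n2] r n4 \<gamma> s, folded \<mu>_def]
    have bnd: "79 / sqrt (real n) + 2 * \<bar>s - goe_weight n (r n)\<bar> \<le> K * R n"
    proof -
      have "sqrt (real n) \<le> real n" using n2 by (intro real_le_lsqrt) (auto simp: power2_eq_square)
      hence "36 / real n \<le> 36 / sqrt (real n)" using n2 by (intro divide_left_mono) auto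
      moreover have Rb: "1 / sqrt (real n) \<le> R n" "\<bar>real (r n) / real n - c\<bar> \<le> R n" by (auto simp: R_def)
      ultimately have "36 / real n + 2 * \<bar>real (r n) / real n - c\<bar> \<le> 38 * R n" by simp
      hence "(36 / real n + 2 * \<bar>real (r n) / real n - c\<bar>) / s \<le> 38 * R n / s" using s by (intro divide_right_mono) auto
      hence "\<bar>s - goe_weight n (r n)\<bar> \<le> 38 * R n / s" using ap by linarith
      moreover have "K * R n = 79 * R n + 2 * (38 * R n / s)" by (simp add: K_def algebra_simps)
      ultimately show ?thesis using Rb(1) by simp
    qed
    show ?case
    proof (intro conjI allI impI)
      show "real_distribution (\<mu> n)" unfolding \<mu>_def by (rule B(1)[unfolded \<mu>_def])
      fix f :: "real \<Rightarrow> real" assume "1-lipschitz_on UNIV f" "\<forall>x. \<bar>f x\<bar> \<le> 1"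
      hence "\<bar>(\<integral>t. f t \<partial>\<mu> n) - (\<integral>t. f t \<partial>semicircle (s\<^sup>2))\<bar> \<le> 79 / sqrt (real n) + 2 * \<bar>s - goe_weight n (r n)\<bar>"
        unfolding \<mu>_def by (intro B(2)[unfolded \<mu>_def]) auto
      thus "\<bar>(\<integral>t. f t \<partial>\<mu> n) - (\<integral>t. f t \<partial>semicircle (s\<^sup>2))\<bar> \<le> K * R n" using bnd by linarith
    qed
  qed
  have sc: "real_distribution (semicircle (s\<^sup>2))"
    using prob_space_semicircle[OF s] by (simp add: real_distribution_def real_distribution_axioms_def semicircle_def)
  have "(\<lambda>n. d_BL (\<mu> n) (semicircle (s\<^sup>2))) \<in> O(R)"
  proof (rule bigoI[where c = K])
    show "\<forall>\<^sub>F n in sequentially. norm (d_BL (\<mu> n) (semicircle (s\<^sup>2))) \<le> K * norm (R n)"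
      using main
    proof eventually_elim
      case (elim n)
      have "0 \<le> d_BL (\<mu> n) (semicircle (s\<^sup>2))" "d_BL (\<mu> n) (semicircle (s\<^sup>2)) \<le> K * R n"
        by (rule d_BL_le[of "\<mu> n" "semicircle (s\<^sup>2)" "K * R n"]; use elim in blast)+
      moreover have "R n \<ge> 0" by (simp add: R_def)
      ultimately show ?case by simp
    qed
  qed
  moreover have "weak_conv_m \<mu> (semicircle (s\<^sup>2))"
  proof (rule weak_conv_lipschitz_rate[OF sc])
    show "(\<lambda>n. K * R n) \<longlonglongrightarrow> 0" using tendsto_mult_right_zero[OF R0, of K] .
  qed (use main in blast)
  ultimately show ?thesis unfolding s_def R_def[abs_def] by blast
qed

end
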